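(* Let $\mathbb X$ be a virtual equipment and let $j\colon A\to E$ be a tight-cell. The functor $\Lambda^L_j\colon\mathbf{RAdj}_L(j)\to\mathbf{RMnd}(j)^{\mathrm{op}}$, sending a $j$-relative adjunction to its induced $j$-relative monad, admits a partial right-adjoint section, defined on those $j$-relative monads $T$ admitting algebra objects, and sending such a $T$ to $f_T\dashv_j u_T$. That is: for every $j$-relative monad $T'$ admitting an algebra object $u_{T'}\colon\mathbf{Alg}(T')\to E$, there is a $j$-relative adjunction $f_{T'}\dashv_j u_{T'}$ (with unit the unit of $T'$) whose induced $j$-relative monad is $T'$, and for every $j$-relative adjunction $\ell\dashv_j r$ with induced $j$-relative monad $T$, the function $$\mathbf{RAdj}_L(j)\big(\ell\dashv_j r,\;f_{T'}\dashv_j u_{T'}\big)\to\mathbf{RMnd}(j)(T',T)$$ given by the action of $\Lambda^L_j$ is a bijection. Moreover, a left-morphism into $f_{T'}\dashv_j u_{T'}$ is strict if and only if its transpose (its image under this bijection) is the identity $j$-relative monad morphism.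
   Context: Virtual equipments. A virtual double category has objects; a category of tight-cells $f\colon A\to B$ (the composite of $f\colon A\to B$ and $g\colon B\to C$ is $gf$); loose-cells $p\colon A\nrightarrow B$; and 2-cells, each having as frame a chain of loose-cells $p_1\colon A_1\nrightarrow A_0,\dots,p_n\colon A_n\nrightarrow A_{n-1}$ ($n\ge 0$; chains are always listed in this order, and called a chain from $A_n$ to $A_0$), a loose-cell $q\colon B_n\nrightarrow B_0$, and tight-cells $f_0\colon A_0\to B_0$ (left) and $f_n\colon A_n\to B_n$ (right); 2-cells have identities and associative unital multicategory-style composition. $\phi\colon p_1,\dots,p_n\Rightarrow q$ denotes a 2-cell whose tight-cells are identities; $(\phi_1,\dots,\phi_n)$ denotes juxtaposition (followed by the opcartesian 2-cell when the codomains have a composite). A 2-cell $q_1,\dots,q_m\Rightarrow q$ is opcartesian if every 2-cell (with any tight-cells) with domain $p_1,\dots,p_l,q_1,\dots,q_m,r_1,\dots,r_n$ factors uniquely through it; then $q$ is the loose-composite $q_1\odot\cdots\odot q_m$ (the loose-identity $A(1,1)\colon A\nrightarrow A$ if $m=0$). A unary 2-cell from $p$ to $q$ with left $f$ and right $g$ is cartesian if every 2-cell into $q$ with left $ff'$ and right $gg'$ factors uniquely through it via a 2-cell with left $f'$ and right $g'$; then $p$ is the restriction $q(f,g)$. A virtual equipment has all loose-identities and restrictions. Write $E(f,g):=E(1,1)(f,g)$; for $f\colon D\to E$, $g\colon A\to E$ it is a loose-cell $A\nrightarrow D$. The canonical isomorphisms $q(f,g)\cong C(f,1)\odot q\odot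 B(1,g)$ are used implicitly. A 2-cell $f\Rightarrow g$ between tight-cells $A\to B$ is equivalently a 2-cell $B(1,f)\Rightarrow B(1,g)$, or $B(g,1)\Rightarrow B(f,1)$, or $()\Rightarrow B(f,g)$; objects, tight-cells and these 2-cells form a 2-category. Restriction is functorial in 2-cells (contravariantly in the first argument, covariantly in the second). For $f\colon A\to B$, $\frown_f\colon ()\Rightarrow B(f,f)$ (corresponding to $1_f$) and $\smile_f\colon B(1,f),B(f,1)\Rightarrow B(1,1)$ are the canonical 2-cells. $\phi(f,g)$ denotes the 2-cell obtained from $\phi$ by restricting along $f$ on the left and $g$ on the right; e.g. $\smile_t(x,y)\colon E(x,t),E(t,y)\Rightarrow E(x,y)$ is composition and $\frown_c(x,y)\colon C(x,y)\Rightarrow C'(cx,cy)$ is the action of $c\colon C\to C'$. Relative monads. A $j$-relative monad $T=(t,\dagger,\eta)$ comprises a tight-cell $t\colon A\to E$, a 2-cell $\dagger\colon E(j,t)\Rightarrow E(t,t)$ and a 2-cell $\eta\colon j\Rightarrow t$ such that: (i) $E(\eta,t)\circ\dagger=1$; (ii) $\dagger\circ E(j,\eta)\circ\frown_j=\frown_t$; (iii) the 2-cells $E(j,t),E(j,t)\Rightarrow E(t,t)$ given by $(\dagger,\dagger)$ followed by $\smile_t(t,t)$, and by $(1,\dagger)$ followed by $\smile_t(j,t)$ followed by $\dagger$, are equal. A morphism is a 2-cell $\tau\colon t\Rightarrow t'$ with $\tau\circ\eta=\eta'$ and $E(t,\tau)\circ\dagger=E(\tau,t')\circ\dagger'\circ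 E(j,\tau)$. These form $\mathbf{RMnd}(j)$. Relative adjunctions. A $j$-relative adjunction $\ell\dashv_j r$ consists of tight-cells $\ell\colon A\to C$, $r\colon C\to E$ and an isomorphism $\sharp\colon C(\ell,1)\cong E(j,r):\flat$; its unit $\eta\colon j\Rightarrow r\ell$ corresponds to $\sharp(1,\ell)\circ\frown_\ell$ (and determines $\sharp$). A left-morphism from $\ell\dashv_j r$ to $\ell'\dashv_j r'$ is a pair $(c\colon C\to C',\lambda\colon\ell'\Rightarrow c\ell)$ with $r=r'c$ and $\sharp=\sharp'(1,c)\circ C'(\lambda,c)\circ\frown_c(\ell,1)$; it is strict if $\lambda$ is an identity. These form $\mathbf{RAdj}_L(j)$. $\ell\dashv_j r$ induces the $j$-relative monad with carrier $r\ell$, unit $\eta$ and extension operator $E(j,r\ell)\xrightarrow{\flat(1,\ell)}C(\ell,\ell)\xrightarrow{\frown_r(\ell,\ell)}E(r\ell,r\ell)$; $\Lambda^L_j$ sends $(c,\lambda)$ to $r'\lambda\colon r'\ell'\Rightarrow r'c\ell=r\ell$. Algebras. A $T$-algebra is a tight-cell $e\colon D\to E$ with a 2-cell $\rtimes\colon E(j,e)\Rightarrow E(t,e)$ such that $E(\eta,e)\circ\rtimes=1$ and the 2-cells $E(j,t),E(j,e)\Rightarrow E(t,e)$ given by $(\dagger,\rtimes)$ followed by $\smile_t(t,e)$, and by $(1,\rtimes)$ followed by $\smile_t(j,e)$ followed by $\rtimes$, are equal. E.g. $(t,\dagger)$. For a chain $p_1,\dots,p_n$ from $D'$ to $D$,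 a $(p_1,\dots,p_n)$-graded $T$-algebra morphism from $(e\colon D\to E,\rtimes)$ to $(e'\colon D'\to E,\rtimes')$ is a 2-cell $\epsilon\colon E(1,e),p_1,\dots,p_n\Rightarrow E(1,e')$ such that the 2-cells $E(1,t),E(j,1),E(1,e),p_1,\dots,p_n\Rightarrow E(1,e')$ given by $(\lambda,1,\dots,1)$ followed by $\epsilon$, and by $(1,1,\epsilon)$ followed by $\lambda'$, are equal; here $\lambda\colon E(1,t),E(j,1),E(1,e)\Rightarrow E(1,e)$ is $(1,\rtimes)$ followed by $\smile_t(1,e)$, and similarly $\lambda'$. Algebra object. A $T$-algebra $(u_T\colon\mathbf{Alg}(T)\to E,\rtimes_T)$ is an algebra object for $T$ when: (1) for every $T$-algebra $(e\colon D\to E,\rtimes)$ there is a unique tight-cell $\langle\rangle_{(e,\rtimes)}\colon D\to\mathbf{Alg}(T)$ with $u_T\langle\rangle_{(e,\rtimes)}=e$ and $\rtimes_T(1,\langle\rangle_{(e,\rtimes)})=\rtimes$; (2) for every graded $T$-algebra morphism $\epsilon\colon E(1,e),p_1,\dots,p_n\Rightarrow E(1,e')$ there is a unique 2-cell $\langle\rangle_\epsilon\colon\mathbf{Alg}(T)(1,\langle\rangle_{(e,\rtimes)}),p_1,\dots,p_n\Rightarrow\mathbf{Alg}(T)(1,\langle\rangle_{(e',\rtimes')})$ with $\epsilon=(1_{E(1,u_T)},\langle\rangle_\epsilon)$, using $E(1,e)\cong E(1,u_T)\odot\mathbf{Alg}(T)(1,\langle\rangle_{(e,\rtimes)})$.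 Write $f_T:=\langle\rangle_{(t,\dagger)}\colon A\to\mathbf{Alg}(T)$, so $u_Tf_T=t$. *)

theory Defs
  imports Main
begin

section \<open>Virtual double categories\<close>

text \<open>
  The four carriers are sets over four type variables.  A loose-cell \<open>p : A \<nrightarrow> B\<close> has
  \<open>lsrc p = A\<close> and \<open>ltgt p = B\<close>.  A 2-cell with domain \<open>[p\<^sub>1, \<dots>, p\<^sub>n]\<close> is drawn from left to
  right, where \<open>p\<^sub>i : A\<^sub>i \<nrightarrow> A\<^sub>i\<^sub>-\<^sub>1\<close>, with \<open>cleft : A\<^sub>0 \<rightarrow> B\<^sub>0\<close> and \<open>cright : A\<^sub>n \<rightarrow> B\<^sub>n\<close>.

  \<open>tcomp X g f\<close> is the composite \<open>gf\<close>.
  \<open>ccomp X \<phi> f [\<phi>\<^sub>1, \<dots>, \<phi>\<^sub>n]\<close> is the composite of \<open>\<phi>\<close> with the horizontal chain of 2-cells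
  \<open>\<phi>\<^sub>1, \<dots>, \<phi>\<^sub>n\<close> whose leftmost tight-cell is \<open>f\<close>.  For \<open>n > 0\<close> the argument \<open>f\<close> is redundant,
  but a chain of length 0 of 2-cells is a tight-cell \<open>f\<close>, along which a nullary \<open>\<phi>\<close> can be
  precomposed.
\<close>

record ('o, 't, 'l, 'c) vdc =
  Ob :: "'o set"
  Tight :: "'t set"
  tdom :: "'t \<Rightarrow> 'o"
  tcod :: "'t \<Rightarrow> 'o"
  tid :: "'o \<Rightarrow> 't"
  tcomp :: "'t \<Rightarrow> 't \<Rightarrow> 't" (infixr "\<cdot>\<index>" 75)
  Loose :: "'l set"
  lsrc :: "'l \<Rightarrow> 'o"
  ltgt :: "'l \<Rightarrow> 'o"
  Cell :: "'c set"
  cdom :: "'c \<Rightarrow> 'l list"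
  ccod :: "'c \<Rightarrow> 'l"
  cleft :: "'c \<Rightarrow> 't"
  cright :: "'c \<Rightarrow> 't"
  cid :: "'l \<Rightarrow> 'c"
  ccomp :: "'c \<Rightarrow> 't \<Rightarrow> 'c list \<Rightarrow> 'c"

definition thom :: "('o, 't, 'l, 'c, 'z) vdc_scheme \<Rightarrow> 'o \<Rightarrow> 'o \<Rightarrow> 't set" where
  "thom X A B = {f \<in> Tight X. tdom X f = A \<and> tcod X f = B}"

text \<open>\<open>loose_chain X A\<^sub>0 ps A\<^sub>n\<close>: \<open>ps\<close> is a chain of loose-cells from \<open>A\<^sub>n\<close> to \<open>A\<^sub>0\<close>.\<close>

primrec loose_chain ::
  "('o, 't, 'l, 'c, 'z) vdc_scheme \<Rightarrow> 'o \<Rightarrow> 'l list \<Rightarrow> 'o \<Rightarrow> bool" where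
  "loose_chain X A [] B \<longleftrightarrow> A \<in> Ob X \<and> A = B"
| "loose_chain X A (p # ps) B \<longleftrightarrow> p \<in> Loose X \<and> ltgt X p = A \<and> loose_chain X (lsrc X p) ps B"

text \<open>\<open>cell_chain X f \<phi>s g\<close>: the 2-cells \<open>\<phi>s\<close> can be juxtaposed, and the outer tight-cells of
  the juxtaposition are \<open>f\<close> and \<open>g\<close>.\<close>

primrec cell_chain ::
  "('o, 't, 'l, 'c, 'z) vdc_scheme \<Rightarrow> 't \<Rightarrow> 'c list \<Rightarrow> 't \<Rightarrow> bool" where
  "cell_chain X f [] g \<longleftrightarrow> f \<in> Tight X \<and> f = g"
| "cell_chain X f (\<phi> # \<phi>s) g \<longleftrightarrow> \<phi> \<in> Cell X \<and> cleft X \<phi> = f \<and> cell_chain X (cright X \<phi>) \<phi>s g"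

primrec right_end :: "('o, 't, 'l, 'c, 'z) vdc_scheme \<Rightarrow> 't \<Rightarrow> 'c list \<Rightarrow> 't" where
  "right_end X f [] = f"
| "right_end X f (\<phi> # \<phi>s) = right_end X (cright X \<phi>) \<phi>s"

text \<open>Composition of each member of a chain \<open>[\<phi>\<^sub>1, \<dots>, \<phi>\<^sub>n]\<close> with the corresponding block of a
  chain \<open>concat [\<chi>s\<^sub>1, \<dots>, \<chi>s\<^sub>n]\<close> with leftmost tight-cell \<open>h\<close>.\<close>

fun blockwise_comp ::
  "('o, 't, 'l, 'c, 'z) vdc_scheme \<Rightarrow> 'c list \<Rightarrow> 't \<Rightarrow> 'c list list \<Rightarrow> 'c list" where
  "blockwise_comp X (\<phi> # \<phi>s) h (\<chi>s # \<chi>ss) =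
     ccomp X \<phi> h \<chi>s # blockwise_comp X \<phi>s (right_end X h \<chi>s) \<chi>ss"
| "blockwise_comp X _ h _ = []"

locale virtual_double_category =
  fixes X :: "('o, 't, 'l, 'c, 'z) vdc_scheme" (structure)
  assumes tdom_Ob: "f \<in> Tight X \<Longrightarrow> tdom X f \<in> Ob X"
    and tcod_Ob: "f \<in> Tight X \<Longrightarrow> tcod X f \<in> Ob X"
    and tid_thom: "A \<in> Ob X \<Longrightarrow> tid X A \<in> thom X A A"
    and tcomp_thom: "\<lbrakk>f \<in> thom X A B; g \<in> thom X B C\<rbrakk> \<Longrightarrow> g \<cdot> f \<in> thom X A C"
    and tcomp_tid_left: "f \<in> thom X A B \<Longrightarrow> tid X B \<cdot> f = f"
    and tcomp_tid_right: "f \<in> thom X A B \<Longrightarrow> f \<cdot> tid X A = f"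
    and tcomp_assoc: "\<lbrakk>f \<in> thom X A B; g \<in> thom X B C; h \<in> thom X C D\<rbrakk>
      \<Longrightarrow> (h \<cdot> g) \<cdot> f = h \<cdot> (g \<cdot> f)"
    and lsrc_Ob: "p \<in> Loose X \<Longrightarrow> lsrc X p \<in> Ob X"
    and ltgt_Ob: "p \<in> Loose X \<Longrightarrow> ltgt X p \<in> Ob X"
    and ccod_Loose: "\<phi> \<in> Cell X \<Longrightarrow> ccod X \<phi> \<in> Loose X"
    and cleft_Tight: "\<phi> \<in> Cell X \<Longrightarrow> cleft X \<phi> \<in> Tight X"
    and cright_Tight: "\<phi> \<in> Cell X \<Longrightarrow> cright X \<phi> \<in> Tight X"
    and cdom_chain: "\<phi> \<in> Cell X
      \<Longrightarrow> loose_chain X (tdom X (cleft X \<phi>)) (cdom X \<phi>) (tdom X (cright X \<phi>))"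
    and tcod_cleft: "\<phi> \<in> Cell X \<Longrightarrow> tcod X (cleft X \<phi>) = ltgt X (ccod X \<phi>)"
    and tcod_cright: "\<phi> \<in> Cell X \<Longrightarrow> tcod X (cright X \<phi>) = lsrc X (ccod X \<phi>)"
    and cid_frame: "p \<in> Loose X \<Longrightarrow> cid X p \<in> Cell X \<and> cdom X (cid X p) = [p] \<and>
      ccod X (cid X p) = p \<and> cleft X (cid X p) = tid X (ltgt X p) \<and>
      cright X (cid X p) = tid X (lsrc X p)"
    and ccomp_frame: "\<lbrakk>\<phi> \<in> Cell X; cell_chain X f \<phi>s g; map (ccod X) \<phi>s = cdom X \<phi>;
        tcod X f = tdom X (cleft X \<phi>)\<rbrakk>
      \<Longrightarrow> ccomp X \<phi> f \<phi>s \<in> Cell X \<and> cdom X (ccomp X \<phi> f \<phi>s) = concat (map (cdom X) \<phi>s) \<and>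
        ccod X (ccomp X \<phi> f \<phi>s) = ccod X \<phi> \<and> cleft X (ccomp X \<phi> f \<phi>s) = cleft X \<phi> \<cdot> f \<and>
        cright X (ccomp X \<phi> f \<phi>s) = cright X \<phi> \<cdot> g"
    and ccomp_cid_left: "\<phi> \<in> Cell X \<Longrightarrow> ccomp X (cid X (ccod X \<phi>)) (cleft X \<phi>) [\<phi>] = \<phi>"
    and ccomp_cid_right: "\<phi> \<in> Cell X
      \<Longrightarrow> ccomp X \<phi> (tid X (tdom X (cleft X \<phi>))) (map (cid X) (cdom X \<phi>)) = \<phi>"
    and ccomp_assoc: "\<lbrakk>\<phi> \<in> Cell X; cell_chain X f \<phi>s g; map (ccod X) \<phi>s = cdom X \<phi>;
        tcod X f = tdom X (cleft X \<phi>);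
        cell_chain X h (concat \<chi>ss) k; map (map (ccod X)) \<chi>ss = map (cdom X) \<phi>s;
        tcod X h = tdom X f\<rbrakk>
      \<Longrightarrow> ccomp X (ccomp X \<phi> f \<phi>s) h (concat \<chi>ss) = ccomp X \<phi> (f \<cdot> h) (blockwise_comp X \<phi>s h \<chi>ss)"

text \<open>Composition with a chain of 2-cells whose leftmost tight-cell is an identity.\<close>

definition gcomp :: "('o, 't, 'l, 'c, 'z) vdc_scheme \<Rightarrow> 'c \<Rightarrow> 'c list \<Rightarrow> 'c"
    (infixr "\<bullet>\<index>" 70) where
  "\<phi> \<bullet>\<^bsub>X\<^esub> \<phi>s = ccomp X \<phi> (tid X (tdom X (cleft X \<phi>))) \<phi>s"

text \<open>The 2-cells \<open>ps \<Rightarrow> q\<close>, i.e. those whose tight-cells are identities.\<close>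

definition globular :: "('o, 't, 'l, 'c, 'z) vdc_scheme \<Rightarrow> 'l list \<Rightarrow> 'l \<Rightarrow> 'c set" where
  "globular X ps q = {\<phi> \<in> Cell X. cdom X \<phi> = ps \<and> ccod X \<phi> = q \<and>
     cleft X \<phi> = tid X (ltgt X q) \<and> cright X \<phi> = tid X (lsrc X q)}"

text \<open>The two chain conditions on \<open>\<chi>\<close> say that \<open>\<phi>\<close> sits between \<open>ps\<close> and \<open>rs\<close>; this does not
  follow from the shape of the domain of \<open>\<chi>\<close> if \<open>\<phi>\<close> is nullary.\<close>

definition opcartesian :: "('o, 't, 'l, 'c, 'z) vdc_scheme \<Rightarrow> 'c \<Rightarrow> bool" where
  "opcartesian X \<phi> \<longleftrightarrow> \<phi> \<in> globular X (cdom X \<phi>) (ccod X \<phi>) \<and>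
     (\<forall>ps rs \<chi>. \<chi> \<in> Cell X \<and> cdom X \<chi> = ps @ cdom X \<phi> @ rs \<and>
        loose_chain X (tdom X (cleft X \<chi>)) ps (ltgt X (ccod X \<phi>)) \<and>
        loose_chain X (lsrc X (ccod X \<phi>)) rs (tdom X (cright X \<chi>)) \<longrightarrow>
        (\<exists>!\<psi>. \<psi> \<in> Cell X \<and> cdom X \<psi> = ps @ [ccod X \<phi>] @ rs \<and> ccod X \<psi> = ccod X \<chi> \<and>
           cleft X \<psi> = cleft X \<chi> \<and> cright X \<psi> = cright X \<chi> \<and>
           \<psi> \<bullet>\<^bsub>X\<^esub> (map (cid X) ps @ [\<phi>] @ map (cid X) rs) = \<chi>))"

definition cartesian :: "('o, 't, 'l, 'c, 'z) vdc_scheme \<Rightarrow> 'c \<Rightarrow> bool" where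
  "cartesian X \<phi> \<longleftrightarrow> \<phi> \<in> Cell X \<and> (\<exists>p. cdom X \<phi> = [p]) \<and>
     (\<forall>\<chi> f' g'. \<chi> \<in> Cell X \<and> ccod X \<chi> = ccod X \<phi> \<and>
        f' \<in> Tight X \<and> tcod X f' = tdom X (cleft X \<phi>) \<and> cleft X \<chi> = cleft X \<phi> \<cdot>\<^bsub>X\<^esub> f' \<and>
        g' \<in> Tight X \<and> tcod X g' = tdom X (cright X \<phi>) \<and> cright X \<chi> = cright X \<phi> \<cdot>\<^bsub>X\<^esub> g' \<longrightarrow>
        (\<exists>!\<psi>. \<psi> \<in> Cell X \<and> cdom X \<psi> = cdom X \<chi> \<and> [ccod X \<psi>] = cdom X \<phi> \<and>
           cleft X \<psi> = f' \<and> cright X \<psi> = g' \<and> ccomp X \<phi> f' [\<psi>] = \<chi>))"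

locale virtual_equipment = virtual_double_category +
  assumes has_loose_identities:
      "A \<in> Ob X \<Longrightarrow> \<exists>\<iota>. opcartesian X \<iota> \<and> cdom X \<iota> = [] \<and> cleft X \<iota> = tid X A"
    and has_restrictions:
      "\<lbrakk>q \<in> Loose X; f \<in> Tight X; tcod X f = ltgt X q; g \<in> Tight X; tcod X g = lsrc X q\<rbrakk>
       \<Longrightarrow> \<exists>\<kappa>. cartesian X \<kappa> \<and> ccod X \<kappa> = q \<and> cleft X \<kappa> = f \<and> cright X \<kappa> = g"


section \<open>Loose-identities, restrictions and hom loose-cells\<close>

text \<open>A loose-identity \<open>A(1,1)\<close> and a restriction \<open>q(f,g)\<close> are chosen arbitrarily, together with
  their universal 2-cells \<open>() \<Rightarrow> A(1,1)\<close> and \<open>q(f,g) \<Rightarrow> q\<close>.\<close>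

definition lunit :: "('o, 't, 'l, 'c, 'z) vdc_scheme \<Rightarrow> 'o \<Rightarrow> 'c" where
  "lunit X A = (SOME \<iota>. opcartesian X \<iota> \<and> cdom X \<iota> = [] \<and> cleft X \<iota> = tid X A)"

definition lid :: "('o, 't, 'l, 'c, 'z) vdc_scheme \<Rightarrow> 'o \<Rightarrow> 'l" where
  "lid X A = ccod X (lunit X A)"

definition cart :: "('o, 't, 'l, 'c, 'z) vdc_scheme \<Rightarrow> 'l \<Rightarrow> 't \<Rightarrow> 't \<Rightarrow> 'c" where
  "cart X q f g = (SOME \<kappa>. cartesian X \<kappa> \<and> ccod X \<kappa> = q \<and> cleft X \<kappa> = f \<and> cright X \<kappa> = g)"

definition restr :: "('o, 't, 'l, 'c, 'z) vdc_scheme \<Rightarrow> 'l \<Rightarrow> 't \<Rightarrow> 't \<Rightarrow> 'l" where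
  "restr X q f g = hd (cdom X (cart X q f g))"

text \<open>\<open>hom X f g\<close> is \<open>E(f,g)\<close>, where \<open>E\<close> is the common codomain of \<open>f\<close> and \<open>g\<close>.\<close>

definition hom :: "('o, 't, 'l, 'c, 'z) vdc_scheme \<Rightarrow> 't \<Rightarrow> 't \<Rightarrow> 'l" where
  "hom X f g = restr X (lid X (tcod X f)) f g"

definition hcart :: "('o, 't, 'l, 'c, 'z) vdc_scheme \<Rightarrow> 't \<Rightarrow> 't \<Rightarrow> 'c" where
  "hcart X f g = cart X (lid X (tcod X f)) f g"

text \<open>The factorisation through \<open>E(f,g) \<Rightarrow> E(1,1)\<close> of a 2-cell \<open>\<chi>\<close> into \<open>E(1,1)\<close> with left
  \<open>ff'\<close> and right \<open>gg'\<close>.\<close>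

definition hlift ::
  "('o, 't, 'l, 'c, 'z) vdc_scheme \<Rightarrow> 't \<Rightarrow> 't \<Rightarrow> 't \<Rightarrow> 't \<Rightarrow> 'c \<Rightarrow> 'c" where
  "hlift X f g f' g' \<chi> = (THE \<psi>. \<psi> \<in> Cell X \<and> cdom X \<psi> = cdom X \<chi> \<and> ccod X \<psi> = hom X f g \<and>
     cleft X \<psi> = f' \<and> cright X \<psi> = g' \<and> ccomp X (hcart X f g) f' [\<psi>] = \<chi>)"

text \<open>The 2-cell \<open>A(1,1), A(1,1) \<Rightarrow> A(1,1)\<close> exhibiting \<open>A(1,1) \<odot> A(1,1)\<close> as \<open>A(1,1)\<close>.\<close>

definition lmult :: "('o, 't, 'l, 'c, 'z) vdc_scheme \<Rightarrow> 'o \<Rightarrow> 'c" where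
  "lmult X A = (THE \<mu>. \<mu> \<in> globular X [lid X A, lid X A] (lid X A) \<and>
     \<mu> \<bullet>\<^bsub>X\<^esub> [lunit X A, cid X (lid X A)] = cid X (lid X A))"

text \<open>The 2-cell \<open>C(1,1) \<Rightarrow> C'(1,1)\<close> with left and right \<open>c : C \<rightarrow> C'\<close>.\<close>

definition laction :: "('o, 't, 'l, 'c, 'z) vdc_scheme \<Rightarrow> 't \<Rightarrow> 'c" where
  "laction X c = (THE \<alpha>. \<alpha> \<in> Cell X \<and> cdom X \<alpha> = [lid X (tdom X c)] \<and>
     ccod X \<alpha> = lid X (tcod X c) \<and> cleft X \<alpha> = c \<and> cright X \<alpha> = c \<and>
     \<alpha> \<bullet>\<^bsub>X\<^esub> [lunit X (tdom X c)] = ccomp X (lunit X (tcod X c)) c [])"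

text \<open>\<open>smile X t x y\<close> is \<open>\<smile>\<^sub>t(x,y) : E(x,t), E(t,y) \<Rightarrow> E(x,y)\<close>.\<close>

definition smile :: "('o, 't, 'l, 'c, 'z) vdc_scheme \<Rightarrow> 't \<Rightarrow> 't \<Rightarrow> 't \<Rightarrow> 'c" where
  "smile X t x y = hlift X x y (tid X (tdom X x)) (tid X (tdom X y))
     (ccomp X (lmult X (tcod X t)) x [hcart X x t, hcart X t y])"

text \<open>\<open>frown X c x y\<close> is \<open>\<frown>\<^sub>c(x,y) : C(x,y) \<Rightarrow> C'(cx,cy)\<close>.\<close>

definition frown :: "('o, 't, 'l, 'c, 'z) vdc_scheme \<Rightarrow> 't \<Rightarrow> 't \<Rightarrow> 't \<Rightarrow> 'c" where
  "frown X c x y = hlift X (c \<cdot>\<^bsub>X\<^esub> x) (c \<cdot>\<^bsub>X\<^esub> y) (tid X (tdom X x)) (tid X (tdom X y))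
     (ccomp X (laction X c) x [hcart X x y])"

text \<open>For \<open>\<phi> : B(a,b) \<Rightarrow> B'(a',b')\<close>, the 2-cell \<open>\<phi>(x,y) : B(ax,by) \<Rightarrow> B'(a'x,b'y)\<close>.\<close>

definition hrestr ::
  "('o, 't, 'l, 'c, 'z) vdc_scheme \<Rightarrow> 't \<Rightarrow> 't \<Rightarrow> 't \<Rightarrow> 't \<Rightarrow> 'c \<Rightarrow> 't \<Rightarrow> 't \<Rightarrow> 'c" where
  "hrestr X a b a' b' \<phi> x y =
     hlift X (a' \<cdot>\<^bsub>X\<^esub> x) (b' \<cdot>\<^bsub>X\<^esub> y) (tid X (tdom X x)) (tid X (tdom X y))
       (ccomp X (hcart X a' b') x
         [ccomp X \<phi> x [hlift X a b x y (hcart X (a \<cdot>\<^bsub>X\<^esub> x) (b \<cdot>\<^bsub>X\<^esub> y))]])"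


subsection \<open>2-cells between tight-cells\<close>

text \<open>A 2-cell \<open>f \<Rightarrow> g\<close> between tight-cells \<open>A \<rightarrow> B\<close> is taken in the form \<open>() \<Rightarrow> B(f,g)\<close>.\<close>

definition tight2 :: "('o, 't, 'l, 'c, 'z) vdc_scheme \<Rightarrow> 't \<Rightarrow> 't \<Rightarrow> 'c set" where
  "tight2 X f g = globular X [] (hom X f g)"

text \<open>\<open>tight2_id X f\<close> is \<open>\<frown>\<^sub>f : () \<Rightarrow> B(f,f)\<close>, i.e. the identity 2-cell \<open>1\<^sub>f\<close>.\<close>

definition tight2_id :: "('o, 't, 'l, 'c, 'z) vdc_scheme \<Rightarrow> 't \<Rightarrow> 'c" where
  "tight2_id X f = hlift X f f (tid X (tdom X f)) (tid X (tdom X f))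
     (ccomp X (lunit X (tcod X f)) f [])"

text \<open>The composite \<open>\<tau> \<circ> \<sigma> : f \<Rightarrow> h\<close> of \<open>\<sigma> : f \<Rightarrow> g\<close> and \<open>\<tau> : g \<Rightarrow> h\<close>.\<close>

definition tight2_comp ::
  "('o, 't, 'l, 'c, 'z) vdc_scheme \<Rightarrow> 't \<Rightarrow> 't \<Rightarrow> 't \<Rightarrow> 'c \<Rightarrow> 'c \<Rightarrow> 'c" where
  "tight2_comp X f g h \<tau> \<sigma> = smile X g f h \<bullet>\<^bsub>X\<^esub> [\<sigma>, \<tau>]"

text \<open>The whiskering \<open>r\<sigma> : rf \<Rightarrow> rg\<close> of \<open>\<sigma> : f \<Rightarrow> g\<close>.\<close>

definition tight2_whisker ::
  "('o, 't, 'l, 'c, 'z) vdc_scheme \<Rightarrow> 't \<Rightarrow> 't \<Rightarrow> 't \<Rightarrow> 'c \<Rightarrow> 'c" where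
  "tight2_whisker X r f g \<sigma> = frown X r f g \<bullet>\<^bsub>X\<^esub> [\<sigma>]"

text \<open>For \<open>\<sigma> : f \<Rightarrow> f'\<close>, \<open>hom_pre X f f' \<sigma> g\<close> is \<open>E(\<sigma>,g) : E(f',g) \<Rightarrow> E(f,g)\<close> and
  \<open>hom_post X g f f' \<sigma>\<close> is \<open>E(g,\<sigma>) : E(g,f) \<Rightarrow> E(g,f')\<close>.\<close>

definition hom_pre ::
  "('o, 't, 'l, 'c, 'z) vdc_scheme \<Rightarrow> 't \<Rightarrow> 't \<Rightarrow> 'c \<Rightarrow> 't \<Rightarrow> 'c" where
  "hom_pre X f f' \<sigma> g = smile X f' f g \<bullet>\<^bsub>X\<^esub> [\<sigma>, cid X (hom X f' g)]"

definition hom_post ::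
  "('o, 't, 'l, 'c, 'z) vdc_scheme \<Rightarrow> 't \<Rightarrow> 't \<Rightarrow> 't \<Rightarrow> 'c \<Rightarrow> 'c" where
  "hom_post X g f f' \<sigma> = smile X f g f' \<bullet>\<^bsub>X\<^esub> [cid X (hom X g f), \<sigma>]"


section \<open>Relative monads\<close>

record ('t, 'c) rel_monad =
  rm_tight :: 't
  rm_ext :: 'c
  rm_unit :: 'c

definition relative_monad ::
  "('o, 't, 'l, 'c, 'z) vdc_scheme \<Rightarrow> 't \<Rightarrow> ('t, 'c) rel_monad \<Rightarrow> bool" where
  "relative_monad X j T \<longleftrightarrow> (let t = rm_tight T; ext = rm_ext T; \<eta> = rm_unit T in
     t \<in> thom X (tdom X j) (tcod X j) \<and>
     ext \<in> globular X [hom X j t] (hom X t t) \<and>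
     \<eta> \<in> tight2 X j t \<and>
     hom_pre X j t \<eta> t \<bullet>\<^bsub>X\<^esub> [ext] = cid X (hom X j t) \<and>
     ext \<bullet>\<^bsub>X\<^esub> [hom_post X j j t \<eta> \<bullet>\<^bsub>X\<^esub> [tight2_id X j]] = tight2_id X t \<and>
     smile X t t t \<bullet>\<^bsub>X\<^esub> [ext, ext] =
       ext \<bullet>\<^bsub>X\<^esub> [smile X t j t \<bullet>\<^bsub>X\<^esub> [cid X (hom X j t), ext]])"

definition RMnd_hom ::
  "('o, 't, 'l, 'c, 'z) vdc_scheme \<Rightarrow> 't \<Rightarrow> ('t, 'c) rel_monad \<Rightarrow> ('t, 'c) rel_monad \<Rightarrow> 'c set" where
  "RMnd_hom X j T T' = (let t = rm_tight T; t' = rm_tight T' in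
     {\<tau> \<in> tight2 X t t'.
        tight2_comp X j t t' \<tau> (rm_unit T) = rm_unit T' \<and>
        hom_post X t t t' \<tau> \<bullet>\<^bsub>X\<^esub> [rm_ext T] =
          hom_pre X t t' \<tau> t' \<bullet>\<^bsub>X\<^esub> [rm_ext T' \<bullet>\<^bsub>X\<^esub> [hom_post X j t t' \<tau>]]})"


section \<open>Relative adjunctions\<close>

record ('t, 'c) rel_adj =
  ladj :: 't
  radj :: 't
  sharp :: 'c
  flat :: 'c

definition relative_adjunction ::
  "('o, 't, 'l, 'c, 'z) vdc_scheme \<Rightarrow> 't \<Rightarrow> ('t, 'c) rel_adj \<Rightarrow> bool" where
  "relative_adjunction X j R \<longleftrightarrow> (let l = ladj R; r = radj R; C = tcod X l in
     l \<in> thom X (tdom X j) C \<and>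
     r \<in> thom X C (tcod X j) \<and>
     sharp R \<in> globular X [hom X l (tid X C)] (hom X j r) \<and>
     flat R \<in> globular X [hom X j r] (hom X l (tid X C)) \<and>
     flat R \<bullet>\<^bsub>X\<^esub> [sharp R] = cid X (hom X l (tid X C)) \<and>
     sharp R \<bullet>\<^bsub>X\<^esub> [flat R] = cid X (hom X j r))"

text \<open>For \<open>y : D \<rightarrow> C\<close>, the 2-cells \<open>\<sharp>(1,y) : C(l,y) \<Rightarrow> E(j,ry)\<close> and
  \<open>\<flat>(1,y) : E(j,ry) \<Rightarrow> C(l,y)\<close>.\<close>

definition sharp_at ::
  "('o, 't, 'l, 'c, 'z) vdc_scheme \<Rightarrow> 't \<Rightarrow> ('t, 'c) rel_adj \<Rightarrow> 't \<Rightarrow> 'c" where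
  "sharp_at X j R y =
     hrestr X (ladj R) (tid X (tcod X (ladj R))) j (radj R) (sharp R) (tid X (tdom X j)) y"

definition flat_at ::
  "('o, 't, 'l, 'c, 'z) vdc_scheme \<Rightarrow> 't \<Rightarrow> ('t, 'c) rel_adj \<Rightarrow> 't \<Rightarrow> 'c" where
  "flat_at X j R y =
     hrestr X j (radj R) (ladj R) (tid X (tcod X (ladj R))) (flat R) (tid X (tdom X j)) y"

definition adj_unit ::
  "('o, 't, 'l, 'c, 'z) vdc_scheme \<Rightarrow> 't \<Rightarrow> ('t, 'c) rel_adj \<Rightarrow> 'c" where
  "adj_unit X j R = sharp_at X j R (ladj R) \<bullet>\<^bsub>X\<^esub> [tight2_id X (ladj R)]"

definition induced_monad ::
  "('o, 't, 'l, 'c, 'z) vdc_scheme \<Rightarrow> 't \<Rightarrow> ('t, 'c) rel_adj \<Rightarrow> ('t, 'c) rel_monad" where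
  "induced_monad X j R =
     \<lparr>rm_tight = radj R \<cdot>\<^bsub>X\<^esub> ladj R,
      rm_ext = frown X (radj R) (ladj R) (ladj R) \<bullet>\<^bsub>X\<^esub> [flat_at X j R (ladj R)],
      rm_unit = adj_unit X j R\<rparr>"

definition RAdj_L_hom ::
  "('o, 't, 'l, 'c, 'z) vdc_scheme \<Rightarrow> 't \<Rightarrow> ('t, 'c) rel_adj \<Rightarrow> ('t, 'c) rel_adj
    \<Rightarrow> ('t \<times> 'c) set" where
  "RAdj_L_hom X j R R' = (let l = ladj R; l' = ladj R'; C = tcod X l; C' = tcod X l' in
     {(c, \<sigma>). c \<in> thom X C C' \<and> \<sigma> \<in> tight2 X l' (c \<cdot>\<^bsub>X\<^esub> l) \<and>
        radj R = radj R' \<cdot>\<^bsub>X\<^esub> c \<and>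
        sharp R = sharp_at X j R' c \<bullet>\<^bsub>X\<^esub>
          [hom_pre X l' (c \<cdot>\<^bsub>X\<^esub> l) \<sigma> c \<bullet>\<^bsub>X\<^esub> [frown X c l (tid X C)]]})"

definition strict_left_morphism ::
  "('o, 't, 'l, 'c, 'z) vdc_scheme \<Rightarrow> ('t, 'c) rel_adj \<Rightarrow> ('t, 'c) rel_adj \<Rightarrow> 't \<times> 'c \<Rightarrow> bool" where
  "strict_left_morphism X R R' m \<longleftrightarrow>
     fst m \<cdot>\<^bsub>X\<^esub> ladj R = ladj R' \<and> snd m = tight2_id X (ladj R')"

definition Lambda_L ::
  "('o, 't, 'l, 'c, 'z) vdc_scheme \<Rightarrow> ('t, 'c) rel_adj \<Rightarrow> ('t, 'c) rel_adj \<Rightarrow> 't \<times> 'c \<Rightarrow> 'c" where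
  "Lambda_L X R R' m =
     tight2_whisker X (radj R') (ladj R') (fst m \<cdot>\<^bsub>X\<^esub> ladj R) (snd m)"


section \<open>Algebras and algebra objects\<close>

record ('t, 'c) rel_alg =
  alg_tight :: 't
  alg_act :: 'c

definition relative_algebra ::
  "('o, 't, 'l, 'c, 'z) vdc_scheme \<Rightarrow> 't \<Rightarrow> ('t, 'c) rel_monad \<Rightarrow> ('t, 'c) rel_alg \<Rightarrow> bool" where
  "relative_algebra X j T a \<longleftrightarrow>
     (let t = rm_tight T; ext = rm_ext T; \<eta> = rm_unit T; e = alg_tight a; act = alg_act a in
     e \<in> thom X (tdom X e) (tcod X j) \<and>
     act \<in> globular X [hom X j e] (hom X t e) \<and>
     hom_pre X j t \<eta> e \<bullet>\<^bsub>X\<^esub> [act] = cid X (hom X j e) \<and>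
     smile X t t e \<bullet>\<^bsub>X\<^esub> [ext, act] =
       act \<bullet>\<^bsub>X\<^esub> [smile X t j e \<bullet>\<^bsub>X\<^esub> [cid X (hom X j t), act]])"

definition free_alg :: "('t, 'c) rel_monad \<Rightarrow> ('t, 'c) rel_alg" where
  "free_alg T = \<lparr>alg_tight = rm_tight T, alg_act = rm_ext T\<rparr>"

text \<open>The 2-cell \<open>E(1,t), E(j,1), E(1,e) \<Rightarrow> E(1,e)\<close> of an algebra, where
  \<open>E(j,1), E(1,e) \<Rightarrow> E(j,e)\<close> is the opcartesian 2-cell implicit in \<open>(1,\<rtimes>)\<close>.\<close>

definition alg_lambda ::
  "('o, 't, 'l, 'c, 'z) vdc_scheme \<Rightarrow> 't \<Rightarrow> ('t, 'c) rel_monad \<Rightarrow> ('t, 'c) rel_alg \<Rightarrow> 'c" where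
  "alg_lambda X j T a = (let t = rm_tight T; e = alg_tight a; i = tid X (tcod X j) in
     smile X t i e \<bullet>\<^bsub>X\<^esub> [cid X (hom X i t), alg_act a \<bullet>\<^bsub>X\<^esub> [smile X i j e]])"

definition graded_morphisms ::
  "('o, 't, 'l, 'c, 'z) vdc_scheme \<Rightarrow> 't \<Rightarrow> ('t, 'c) rel_monad \<Rightarrow> 'l list
    \<Rightarrow> ('t, 'c) rel_alg \<Rightarrow> ('t, 'c) rel_alg \<Rightarrow> 'c set" where
  "graded_morphisms X j T ps a a' =
     (let t = rm_tight T; e = alg_tight a; e' = alg_tight a'; i = tid X (tcod X j) in
     {\<epsilon> \<in> globular X (hom X i e # ps) (hom X i e').
        \<epsilon> \<bullet>\<^bsub>X\<^esub> (alg_lambda X j T a # map (cid X) ps) =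
          alg_lambda X j T a' \<bullet>\<^bsub>X\<^esub> [cid X (hom X i t), cid X (hom X j i), \<epsilon>]})"

text \<open>For an algebra \<open>u : Alg \<rightarrow> E\<close> and \<open>d : D \<rightarrow> Alg\<close>, the algebra on \<open>ud\<close> with action
  \<open>\<rtimes>(1,d)\<close>.\<close>

definition alg_precomp ::
  "('o, 't, 'l, 'c, 'z) vdc_scheme \<Rightarrow> 't \<Rightarrow> ('t, 'c) rel_monad \<Rightarrow> ('t, 'c) rel_alg \<Rightarrow> 't
    \<Rightarrow> ('t, 'c) rel_alg" where
  "alg_precomp X j T u d =
     \<lparr>alg_tight = alg_tight u \<cdot>\<^bsub>X\<^esub> d,
      alg_act = hrestr X j (alg_tight u) (rm_tight T) (alg_tight u) (alg_act u) (tid X (tdom X j)) d\<rparr>"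

definition mediating ::
  "('o, 't, 'l, 'c, 'z) vdc_scheme \<Rightarrow> 't \<Rightarrow> ('t, 'c) rel_monad \<Rightarrow> ('t, 'c) rel_alg
    \<Rightarrow> ('t, 'c) rel_alg \<Rightarrow> 't \<Rightarrow> bool" where
  "mediating X j T u a d \<longleftrightarrow>
     d \<in> thom X (tdom X (alg_tight a)) (tdom X (alg_tight u)) \<and> alg_precomp X j T u d = a"

text \<open>The opcartesian 2-cell \<open>E(1,u), B(1,d) \<Rightarrow> E(1,ud)\<close> exhibiting
  \<open>E(1,ud) \<cong> E(1,u) \<odot> B(1,d)\<close>, for \<open>d : D \<rightarrow> B\<close> and \<open>u : B \<rightarrow> E\<close>.\<close>

definition comp_conj ::
  "('o, 't, 'l, 'c, 'z) vdc_scheme \<Rightarrow> 't \<Rightarrow> 't \<Rightarrow> 'c" where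
  "comp_conj X u d = (let i = tid X (tcod X u); k = tid X (tdom X u) in
     smile X u i (u \<cdot>\<^bsub>X\<^esub> d) \<bullet>\<^bsub>X\<^esub> [cid X (hom X i u), frown X u k d])"

definition algebra_object ::
  "('o, 't, 'l, 'c, 'z) vdc_scheme \<Rightarrow> 't \<Rightarrow> ('t, 'c) rel_monad \<Rightarrow> ('t, 'c) rel_alg \<Rightarrow> bool" where
  "algebra_object X j T u \<longleftrightarrow>
     relative_algebra X j T u \<and>
     (\<forall>a. relative_algebra X j T a \<longrightarrow> (\<exists>!d. mediating X j T u a d)) \<and>
     (\<forall>a a' ps \<epsilon> d d'.
        relative_algebra X j T a \<and> relative_algebra X j T a' \<and>
        loose_chain X (tdom X (alg_tight a)) ps (tdom X (alg_tight a')) \<and>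
        \<epsilon> \<in> graded_morphisms X j T ps a a' \<and>
        mediating X j T u a d \<and> mediating X j T u a' d' \<longrightarrow>
        (let v = alg_tight u; i = tid X (tcod X v); k = tid X (tdom X v) in
         \<exists>!\<psi>. \<psi> \<in> globular X (hom X k d # ps) (hom X k d') \<and>
           \<epsilon> \<bullet>\<^bsub>X\<^esub> (comp_conj X v d # map (cid X) ps) =
             comp_conj X v d' \<bullet>\<^bsub>X\<^esub> [cid X (hom X i v), \<psi>]))"

text \<open>\<open>free_tight X j T u\<close> is the tight-cell \<open>f\<^sub>T : A \<rightarrow> Alg(T)\<close> induced by the algebra \<open>(t,\<dagger>)\<close>.\<close>

definition free_tight ::
  "('o, 't, 'l, 'c, 'z) vdc_scheme \<Rightarrow> 't \<Rightarrow> ('t, 'c) rel_monad \<Rightarrow> ('t, 'c) rel_alg \<Rightarrow> 't" where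
  "free_tight X j T u = (THE d. mediating X j T u (free_alg T) d)"

end

theory Submission
  imports Defs
begin

text \<open>
  A 2-cell \<open>ps \<Rightarrow> E(f,g)\<close> is the same as a cell \<open>ps \<Rightarrow> E(1,1)\<close> with left \<open>f\<close> and right \<open>g\<close>, and cells of the
  latter kind compose like the arrows \<open>f \<rightarrow> g\<close> of a graded category, on which tight-cells act
  functorially. A 2-cell \<open>E(a,b) \<Rightarrow> E'(a',b')\<close> becomes an operation taking \<open>\<chi> : a \<rightarrow> by\<close> to an arrow
  \<open>a' \<rightarrow> b'y\<close>, automatically natural in \<open>y\<close>.

  In this language, let \<open>u\<close> be an algebra object for \<open>T'\<close>, with action \<open>\<rtimes>\<close> and \<open>f = f\<^sub>T\<^sub>'\<close>. Condition (2) says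
  that an arrow \<open>ud \<rightarrow> ud'\<close> compatible with the actions is \<open>u\<psi>\<close> for a unique \<open>\<psi> : d \<rightarrow> d'\<close>. Lifting
  \<open>\<rtimes>\<close> itself gives \<open>\<flat>\<close>, inverse to \<open>\<sharp>\<chi> = u\<chi> \<circ> \<eta>'\<close>. For \<open>\<ell> \<stileturn>\<^sub>j r\<close> and a left-morphism \<open>(c,\<lambda>)\<close> with transpose
  \<open>\<tau> = u\<lambda>\<close>, compatibility with \<open>\<sharp>\<close> reduces to \<open>\<tau> \<circ> \<eta>' = \<eta>\<close>, and the algebra \<open>\<rtimes>(1,c)\<close> on \<open>r = uc\<close> is
  forced to be \<open>\<chi> \<mapsto> r(\<flat>\<chi>) \<circ> \<tau>\<close>. Conversely a monad morphism \<open>\<tau>\<close> makes \<open>r\<close> a \<open>T'\<close>-algebra by this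
  formula, which determines \<open>c\<close>, and \<open>\<tau>\<close> then lifts uniquely to \<open>\<lambda>\<close>.
\<close>

text \<open>Restrictions are chosen arbitrarily, so \<open>E(f,g)(x,y)\<close> and
  \<open>E(fx,gy)\<close> agree only up to isomorphism, and an argument with the 2-cells themselves
  would meet these comparisons at every restriction. For cells into \<open>E(1,1)\<close>,
  restricting is composing the outer tight-cells, which is strictly associative. The cost is a
  translation of every definition; it rests on transposition being injective, so that an equation of
  2-cells is equivalent to one between arrows.

  The grading in condition (2) is essential. \<flat> is the lift of an arrow graded by the single
  loose-cell \<open>E(j,u)\<close>, and the law that \<flat> after \<sharp> is the identity is
  checked by faithfulness of \<open>u\<close> on arrows graded by one loose-cell; only \<lambda> is
  the lift of an ungraded arrow. Faithfulness is the uniqueness half of (2). It applies to every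
  arrow \<open>u\<psi>\<close>, since such an arrow is compatible with the actions by
  naturality.\<close>

lemma thom_iff: "f \<in> thom X A B \<longleftrightarrow> f \<in> Tight X \<and> tdom X f = A \<and> tcod X f = B"
  by (auto simp: thom_def)

section \<open>Frames and composition\<close>

context virtual_double_category
begin

lemma tid_simps [simp]:
  assumes "A \<in> Ob X"
  shows "tid X A \<in> Tight X" "tdom X (tid X A) = A" "tcod X (tid X A) = A"
  using tid_thom [OF assms] by (auto simp: thom_def)

lemma tcomp_simps [simp]:
  assumes "f \<in> Tight X" "g \<in> Tight X" "tcod X f = tdom X g"
  shows "g \<cdot> f \<in> Tight X" "tdom X (g \<cdot> f) = tdom X f" "tcod X (g \<cdot> f) = tcod X g"
  using tcomp_thom [of f "tdom X f" "tcod X f" g "tcod X g"] assms by (auto simp: thom_def)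

lemma tcomp_tid_simps [simp]:
  shows "f \<in> Tight X \<Longrightarrow> tcod X f = B \<Longrightarrow> tid X B \<cdot> f = f"
    and "f \<in> Tight X \<Longrightarrow> tdom X f = A \<Longrightarrow> f \<cdot> tid X A = f"
  using tcomp_tid_left tcomp_tid_right by (auto simp: thom_def)

lemma tcomp_assoc_simp [simp]:
  assumes "f \<in> Tight X" "g \<in> Tight X" "h \<in> Tight X" "tcod X f = tdom X g" "tcod X g = tdom X h"
  shows "(h \<cdot> g) \<cdot> f = h \<cdot> (g \<cdot> f)"
  using tcomp_assoc assms by (auto simp: thom_def)

declare tdom_Ob [simp] tcod_Ob [simp] lsrc_Ob [simp] ltgt_Ob [simp]

text \<open>The whole frame of a 2-cell in one membership, in the order in which it is drawn: left
  tight-cell, domain, codomain, right tight-cell. Typing arguments pass through it, and globular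
  2-cells are the case of identity sides.\<close>

definition cells :: "'t \<Rightarrow> 'l list \<Rightarrow> 'l \<Rightarrow> 't \<Rightarrow> 'c set" where
  "cells f ps q g =
     {\<phi> \<in> Cell X. cdom X \<phi> = ps \<and> ccod X \<phi> = q \<and> cleft X \<phi> = f \<and> cright X \<phi> = g}"

lemma cellsD:
  assumes "\<phi> \<in> cells f ps q g"
  shows "\<phi> \<in> Cell X" "cdom X \<phi> = ps" "ccod X \<phi> = q" "cleft X \<phi> = f" "cright X \<phi> = g"
    "f \<in> Tight X" "g \<in> Tight X" "q \<in> Loose X" "tcod X f = ltgt X q" "tcod X g = lsrc X q"
    "loose_chain X (tdom X f) ps (tdom X g)"
  using assms ccod_Loose cleft_Tight cright_Tight tcod_cleft tcod_cright cdom_chain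
  by (auto simp: cells_def)

lemma globular_cells: "globular X ps q = cells (tid X (ltgt X q)) ps q (tid X (lsrc X q))"
  by (auto simp: globular_def cells_def)

lemma cid_cells: "p \<in> Loose X \<Longrightarrow> cid X p \<in> cells (tid X (ltgt X p)) [p] p (tid X (lsrc X p))"
  using cid_frame by (auto simp: cells_def)

text \<open>\<open>ps\<close> has to match the domain of the cell composed after the chain, and
  \<open>rs\<close> is the domain of that composite. The outer tight-cells are explicit because an
  empty chain still sits on a tight-cell.\<close>

definition chain_cells :: "'t \<Rightarrow> 'c list \<Rightarrow> 't \<Rightarrow> 'l list \<Rightarrow> 'l list \<Rightarrow> bool" where
  "chain_cells f \<phi>s g ps rs \<longleftrightarrow>
     cell_chain X f \<phi>s g \<and> map (ccod X) \<phi>s = ps \<and> concat (map (cdom X) \<phi>s) = rs"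

lemma chain_cells_Nil: "f \<in> Tight X \<Longrightarrow> chain_cells f [] f [] []"
  by (simp add: chain_cells_def)

lemma chain_cells_Cons:
  "\<phi> \<in> cells f rs p g \<Longrightarrow> chain_cells g \<phi>s h ps qs
    \<Longrightarrow> chain_cells f (\<phi> # \<phi>s) h (p # ps) (rs @ qs)"
  by (auto simp: chain_cells_def cells_def)

lemma chain_cells_single: "\<phi> \<in> cells f rs p g \<Longrightarrow> chain_cells f [\<phi>] g [p] rs"
  using chain_cells_Cons [OF _ chain_cells_Nil] cellsD(7) by fastforce

lemma chain_cells_append:
  "chain_cells f \<phi>s g ps rs \<Longrightarrow> chain_cells g \<psi>s h qs ss
    \<Longrightarrow> chain_cells f (\<phi>s @ \<psi>s) h (ps @ qs) (rs @ ss)"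
  by (induction \<phi>s arbitrary: f ps rs) (auto simp: chain_cells_def)

lemma loose_chain_Ob: "loose_chain X A ps B \<Longrightarrow> A \<in> Ob X \<and> B \<in> Ob X"
  by (induction ps arbitrary: A) auto

lemma loose_chain_append:
  "loose_chain X A (ps @ qs) B \<longleftrightarrow> (\<exists>C. loose_chain X A ps C \<and> loose_chain X C qs B)"
  by (induction ps arbitrary: A) (auto dest: loose_chain_Ob)

lemma chain_cells_cid:
  "loose_chain X A ps B \<Longrightarrow> chain_cells (tid X A) (map (cid X) ps) (tid X B) ps ps"
proof (induction ps arbitrary: A)
  case Nil
  then show ?case by (auto intro: chain_cells_Nil)
next
  case (Cons p ps)
  then show ?case
    using chain_cells_Cons [of "cid X p" "tid X A" "[p]" p "tid X (lsrc X p)"] cid_cells by force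
qed

lemma cell_chain_right_end: "cell_chain X f \<phi>s g \<Longrightarrow> right_end X f \<phi>s = g"
  by (induction \<phi>s arbitrary: f) auto

lemma chain_cells_Tight:
  assumes "chain_cells f \<phi>s g ps rs"
  shows "f \<in> Tight X \<and> g \<in> Tight X"
  using assms
proof (induction \<phi>s arbitrary: f ps rs)
  case Nil
  then show ?case by (auto simp: chain_cells_def)
next
  case (Cons \<phi> \<phi>s)
  then show ?case
    using cleft_Tight by (fastforce simp: chain_cells_def)
qed

lemma ccomp_cells:
  assumes "\<phi> \<in> cells f' qs q g'" "chain_cells f \<phi>s g qs rs" "tcod X f = tdom X f'"
  shows "ccomp X \<phi> f \<phi>s \<in> cells (f' \<cdot> f) rs q (g' \<cdot> g)"
  using ccomp_frame [of \<phi> f \<phi>s g] assms by (auto simp: cells_def chain_cells_def)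

lemma ccomp_cells_Nil:
  assumes "\<phi> \<in> cells f' [] q g'" "f \<in> Tight X" "tcod X f = tdom X f'"
  shows "ccomp X \<phi> f [] \<in> cells (f' \<cdot> f) [] q (g' \<cdot> f)"
  using ccomp_cells [OF assms(1) chain_cells_Nil] assms by simp

lemma cells_tcod_eq:
  assumes "\<phi> \<in> cells f' (p # ps) q g'" "\<psi> \<in> cells f rs p g"
  shows "tcod X f = tdom X f'"
  using cellsD(11) [OF assms(1)] cellsD(9) [OF assms(2)] by simp

lemma ccomp_cells_single:
  assumes "\<phi> \<in> cells f' [p] q g'" "\<psi> \<in> cells f rs p g"
  shows "ccomp X \<phi> f [\<psi>] \<in> cells (f' \<cdot> f) rs q (g' \<cdot> g)"
  using ccomp_cells [OF assms(1) chain_cells_single [OF assms(2)]] cells_tcod_eq [OF assms] by simp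

lemma ccomp_cells_pair:
  assumes "\<phi> \<in> cells f' [p, p'] q g'" "\<psi> \<in> cells f rs p g" "\<psi>' \<in> cells g rs' p' h"
  shows "ccomp X \<phi> f [\<psi>, \<psi>'] \<in> cells (f' \<cdot> f) (rs @ rs') q (g' \<cdot> h)"
  using ccomp_cells [OF assms(1) chain_cells_Cons [OF assms(2) chain_cells_single [OF assms(3)]]]
    cells_tcod_eq [OF assms(1,2)] by simp

lemma ccomp_assoc_Nil:
  assumes "\<phi> \<in> cells f' [] q g'" "f \<in> Tight X" "tcod X f = tdom X f'" "h \<in> Tight X" "tcod X h = tdom X f"
  shows "ccomp X (ccomp X \<phi> f []) h [] = ccomp X \<phi> (f \<cdot> h) []"
  using ccomp_assoc [of \<phi> f "[]" f h "[]" h] assms by (auto simp: cells_def)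

lemma ccomp_assoc_single:
  assumes "\<phi> \<in> cells f' [p] q g'" "\<psi> \<in> cells f rs p g" "chain_cells h \<chi>s k rs ss" "tcod X h = tdom X f"
  shows "ccomp X (ccomp X \<phi> f [\<psi>]) h \<chi>s = ccomp X \<phi> (f \<cdot> h) [ccomp X \<psi> h \<chi>s]"
  using ccomp_assoc [of \<phi> f "[\<psi>]" g h "[\<chi>s]" k] assms cells_tcod_eq [OF assms(1,2)]
    cellsD [OF assms(2)]
  by (auto simp: cells_def chain_cells_def)

text \<open>The associativity axiom starts the second block at the right end of the first. The
  premise that \<open>\<chi>s\<close> ends at \<open>k\<close> identifies this tight-cell, also when
  \<open>\<chi>s\<close> is empty because \<psi> is nullary.\<close>

lemma ccomp_assoc_pair:
  assumes "\<phi> \<in> cells f' [p, p'] q g'" "\<psi> \<in> cells f rs p g" "\<psi>' \<in> cells g rs' p' g''"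
    "chain_cells h \<chi>s k rs ss" "chain_cells k \<chi>s' m rs' ss'" "tcod X h = tdom X f"
  shows "ccomp X (ccomp X \<phi> f [\<psi>, \<psi>']) h (\<chi>s @ \<chi>s') =
    ccomp X \<phi> (f \<cdot> h) [ccomp X \<psi> h \<chi>s, ccomp X \<psi>' k \<chi>s']"
proof -
  have "cell_chain X h (\<chi>s @ \<chi>s') m"
    using chain_cells_append [OF assms(4,5)] by (auto simp: chain_cells_def)
  moreover have "right_end X h \<chi>s = k"
    using assms(4) cell_chain_right_end by (auto simp: chain_cells_def)
  ultimately show ?thesis
    using ccomp_assoc [of \<phi> f "[\<psi>,\<psi>']" g'' h "[\<chi>s,\<chi>s']" m] assms cells_tcod_eq [OF assms(1,2)]
      cellsD [OF assms(3)]
    by (auto simp: cells_def chain_cells_def)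
qed

lemma ccomp_cid_cells [simp]:
  "\<phi> \<in> cells f ps q g \<Longrightarrow> ccomp X (cid X q) f [\<phi>] = \<phi>"
  using ccomp_cid_left by (auto simp: cells_def)

lemma ccomp_map_cid:
  "\<phi> \<in> cells f ps q g \<Longrightarrow> ccomp X \<phi> (tid X (tdom X f)) (map (cid X) ps) = \<phi>"
  using ccomp_cid_right by (auto simp: cells_def)

lemma ccomp_cid_single:
  "\<phi> \<in> cells f [p] q g \<Longrightarrow> ccomp X \<phi> (tid X (tdom X f)) [cid X p] = \<phi>"
  using ccomp_map_cid by fastforce

lemma gcomp_cells_eq: "\<phi> \<in> cells f ps q g \<Longrightarrow> \<phi> \<bullet> \<phi>s = ccomp X \<phi> (tid X (tdom X f)) \<phi>s"
  by (auto simp: gcomp_def cells_def)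

lemma gcomp_globular:
  assumes "\<phi> \<in> globular X ps q" "chain_cells (tid X (ltgt X q)) \<phi>s (tid X (lsrc X q)) ps rs"
  shows "\<phi> \<bullet> \<phi>s \<in> globular X rs q"
proof -
  have "q \<in> Loose X" using assms(1) cellsD(8) by (auto simp: globular_cells)
  then show ?thesis
    using ccomp_cells [OF assms(1) [unfolded globular_cells] assms(2)]
      gcomp_cells_eq [OF assms(1) [unfolded globular_cells]] by (simp add: globular_cells)
qed

end

context virtual_equipment
begin

section \<open>Loose-identities and hom loose-cells\<close>

lemma lunit_opcartesian:
  assumes "A \<in> Ob X"
  shows "opcartesian X (lunit X A)" "cdom X (lunit X A) = []" "cleft X (lunit X A) = tid X A"
  using someI_ex [OF has_loose_identities [OF assms]] by (auto simp: lunit_def)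

text \<open>The object is recovered from the left identity, since \<open>tid\<close> is injective on
  objects; source and target agree because the domain of the unit is an empty chain.\<close>

lemma lunit_lid:
  assumes "A \<in> Ob X"
  shows "lunit X A \<in> cells (tid X A) [] (lid X A) (tid X A)"
    and "lid X A \<in> Loose X" and "ltgt X (lid X A) = A" and "lsrc X (lid X A) = A"
proof -
  note o = lunit_opcartesian [OF assms]
  have g: "lunit X A \<in> globular X [] (lid X A)"
    using o by (auto simp: opcartesian_def lid_def)
  note d = cellsD [OF g [unfolded globular_cells]]
  show L: "lid X A \<in> Loose X" using d by simp
  have "tid X (ltgt X (lid X A)) = tid X A" using d(4) o(3) by simp
  then show t: "ltgt X (lid X A) = A" using L assms by (metis tid_simps(2) ltgt_Ob)
  show s: "lsrc X (lid X A) = A" using d(11) L t assms by auto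
  show "lunit X A \<in> cells (tid X A) [] (lid X A) (tid X A)"
    using g t s by (simp add: globular_cells)
qed

declare lunit_lid(2-4) [simp]

text \<open>The uniqueness half of the universal property of a loose-identity. The basic laws of the
  calculus below are proved with it: inserting the unit at one occurrence of \<open>A(1,1)\<close>
  loses no information.\<close>

lemma lunit_cancel:
  assumes "A \<in> Ob X" "\<psi> \<in> cells f (ps @ lid X A # rs) q g" "\<psi>' \<in> cells f (ps @ lid X A # rs) q g"
    "ccomp X \<psi> (tid X (tdom X f)) (map (cid X) ps @ lunit X A # map (cid X) rs) =
     ccomp X \<psi>' (tid X (tdom X f)) (map (cid X) ps @ lunit X A # map (cid X) rs)"
  shows "\<psi> = \<psi>'"
proof -
  note o = lunit_opcartesian [OF assms(1)] and l = lunit_lid [OF assms(1)]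
  let ?ch = "map (cid X) ps @ lunit X A # map (cid X) rs"
  have ch: "loose_chain X (tdom X f) ps A \<and> loose_chain X A rs (tdom X g)"
    using cellsD(11) [OF assms(2)] assms(1) by (auto simp: loose_chain_append)
  have cc: "chain_cells (tid X (tdom X f)) ?ch (tid X (tdom X g)) (ps @ [lid X A] @ rs) (ps @ [] @ rs)"
    using chain_cells_append [OF chain_cells_cid chain_cells_append [OF chain_cells_single [OF l(1)] chain_cells_cid]]
      ch by fastforce
  let ?\<chi> = "ccomp X \<psi> (tid X (tdom X f)) ?ch"
  have \<chi>: "?\<chi> \<in> cells f (ps @ rs) q g"
    using ccomp_cells [OF assms(2), of "tid X (tdom X f)" ?ch "tid X (tdom X g)" "ps @ rs"] cc
      cellsD(6,7) [OF assms(2)] by simp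
  have "\<exists>!\<psi>. \<psi> \<in> Cell X \<and> cdom X \<psi> = ps @ [ccod X (lunit X A)] @ rs \<and> ccod X \<psi> = ccod X ?\<chi> \<and>
           cleft X \<psi> = cleft X ?\<chi> \<and> cright X \<psi> = cright X ?\<chi> \<and>
           \<psi> \<bullet> (map (cid X) ps @ [lunit X A] @ map (cid X) rs) = ?\<chi>"
    using o(1) [unfolded opcartesian_def, THEN conjunct2, rule_format, of ?\<chi> ps rs]
      cellsD [OF \<chi>] cellsD [OF l(1)] ch o(2) l by simp
  moreover have "\<psi> \<in> Cell X \<and> cdom X \<psi> = ps @ [ccod X (lunit X A)] @ rs \<and> ccod X \<psi> = ccod X ?\<chi> \<and>
           cleft X \<psi> = cleft X ?\<chi> \<and> cright X \<psi> = cright X ?\<chi> \<and>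
           \<psi> \<bullet> (map (cid X) ps @ [lunit X A] @ map (cid X) rs) = ?\<chi>"
    using cellsD [OF assms(2)] cellsD [OF \<chi>] cellsD [OF l(1)] by (simp add: gcomp_def)
  moreover have "\<psi>' \<in> Cell X \<and> cdom X \<psi>' = ps @ [ccod X (lunit X A)] @ rs \<and> ccod X \<psi>' = ccod X ?\<chi> \<and>
           cleft X \<psi>' = cleft X ?\<chi> \<and> cright X \<psi>' = cright X ?\<chi> \<and>
           \<psi>' \<bullet> (map (cid X) ps @ [lunit X A] @ map (cid X) rs) = ?\<chi>"
    using cellsD [OF assms(3)] cellsD [OF \<chi>] cellsD [OF l(1)] assms(4) by (simp add: gcomp_def)
  ultimately show ?thesis by blast
qed

text \<open>The existence half, with the unit inserted in the leftmost position. This is the form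
  from which \<open>lmult\<close> and \<open>laction\<close> are obtained.\<close>

lemma lunit_extend:
  assumes "A \<in> Ob X" "\<chi> \<in> cells f rs q g" "tdom X f = A"
  obtains \<psi> where "\<psi> \<in> cells f (lid X A # rs) q g"
    "ccomp X \<psi> (tid X (tdom X f)) (lunit X A # map (cid X) rs) = \<chi>"
proof -
  note o = lunit_opcartesian [OF assms(1)] and l = lunit_lid [OF assms(1)]
  have "\<exists>!\<psi>. \<psi> \<in> Cell X \<and> cdom X \<psi> = [] @ [ccod X (lunit X A)] @ rs \<and> ccod X \<psi> = ccod X \<chi> \<and>
           cleft X \<psi> = cleft X \<chi> \<and> cright X \<psi> = cright X \<chi> \<and>
           \<psi> \<bullet> (map (cid X) [] @ [lunit X A] @ map (cid X) rs) = \<chi>"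
    using o(1) [unfolded opcartesian_def, THEN conjunct2, rule_format, of \<chi> "[]" rs]
      cellsD [OF assms(2)] assms o(2) cellsD [OF l(1)] by simp
  then obtain \<psi> where \<psi>: "\<psi> \<in> Cell X" "cdom X \<psi> = ccod X (lunit X A) # rs" "ccod X \<psi> = ccod X \<chi>"
           "cleft X \<psi> = cleft X \<chi>" "cright X \<psi> = cright X \<chi>"
           "\<psi> \<bullet> (lunit X A # map (cid X) rs) = \<chi>"
    by auto
  have "\<psi> \<in> cells f (lid X A # rs) q g"
    using \<psi> cellsD [OF assms(2)] cellsD [OF l(1)] by (simp add: cells_def)
  then show ?thesis
    using that gcomp_cells_eq \<psi>(6) by metis
qed

text \<open>The multiplication extends the identity 2-cell along a unit in the left slot. Its left
  unit law therefore holds by definition, whereas the right one has to be derived.\<close>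

lemma lmult:
  assumes "A \<in> Ob X"
  shows "lmult X A \<in> cells (tid X A) [lid X A, lid X A] (lid X A) (tid X A)"
    and "ccomp X (lmult X A) (tid X A) [lunit X A, cid X (lid X A)] = cid X (lid X A)"
proof -
  note l = lunit_lid [OF assms]
  let ?P = "\<lambda>\<mu>. \<mu> \<in> globular X [lid X A, lid X A] (lid X A) \<and>
     \<mu> \<bullet> [lunit X A, cid X (lid X A)] = cid X (lid X A)"
  have eq: "?P \<mu> \<longleftrightarrow> \<mu> \<in> cells (tid X A) [lid X A, lid X A] (lid X A) (tid X A) \<and>
    ccomp X \<mu> (tid X A) [lunit X A, cid X (lid X A)] = cid X (lid X A)" for \<mu>
    using l assms gcomp_cells_eq by (fastforce simp: globular_cells)
  have c: "cid X (lid X A) \<in> cells (tid X A) [lid X A] (lid X A) (tid X A)"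
    using cid_cells [of "lid X A"] l by simp
  have "\<exists>!\<mu>. ?P \<mu>"
  proof (rule ex_ex1I)
    show "\<exists>\<mu>. ?P \<mu>"
      using lunit_extend [OF assms c] assms unfolding eq by (metis list.simps(8,9) tid_simps(2))
    show "\<mu> = \<nu>" if "?P \<mu>" "?P \<nu>" for \<mu> \<nu>
      using lunit_cancel [OF assms, of \<mu> "tid X A" "[]" "[lid X A]" "lid X A" "tid X A" \<nu>] that assms
      unfolding eq by simp
  qed
  from theI' [OF this] show "lmult X A \<in> cells (tid X A) [lid X A, lid X A] (lid X A) (tid X A)"
    and "ccomp X (lmult X A) (tid X A) [lunit X A, cid X (lid X A)] = cid X (lid X A)"
    unfolding lmult_def eq by auto
qed

text \<open>The action extends the unit of the codomain precomposed with \<open>c\<close>. Its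
  defining equation is preservation of identities in the universal case.\<close>

lemma laction:
  assumes "c \<in> Tight X"
  shows "laction X c \<in> cells c [lid X (tdom X c)] (lid X (tcod X c)) c"
    and "ccomp X (laction X c) (tid X (tdom X c)) [lunit X (tdom X c)] = ccomp X (lunit X (tcod X c)) c []"
proof -
  let ?A = "tdom X c" and ?B = "tcod X c"
  have A: "?A \<in> Ob X" and B: "?B \<in> Ob X" using assms by auto
  note m = lunit_lid [OF B]
  let ?P = "\<lambda>\<alpha>. \<alpha> \<in> Cell X \<and> cdom X \<alpha> = [lid X (tdom X c)] \<and>
     ccod X \<alpha> = lid X (tcod X c) \<and> cleft X \<alpha> = c \<and> cright X \<alpha> = c \<and>
     \<alpha> \<bullet> [lunit X (tdom X c)] = ccomp X (lunit X (tcod X c)) c []"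
  have eq: "?P \<mu> \<longleftrightarrow> \<mu> \<in> cells c [lid X ?A] (lid X ?B) c \<and>
    ccomp X \<mu> (tid X ?A) [lunit X ?A] = ccomp X (lunit X ?B) c []" for \<mu>
    by (auto simp: gcomp_def cells_def)
  have c: "ccomp X (lunit X ?B) c [] \<in> cells c [] (lid X ?B) c"
    using ccomp_cells_Nil [OF m(1) assms] assms B by simp
  have "\<exists>!\<mu>. ?P \<mu>"
  proof (rule ex_ex1I)
    show "\<exists>\<mu>. ?P \<mu>"
      using lunit_extend [OF A c] assms unfolding eq by (metis list.simps(8))
    show "\<mu> = \<nu>" if "?P \<mu>" "?P \<nu>" for \<mu> \<nu>
      using lunit_cancel [OF A, of \<mu> c "[]" "[]" "lid X ?B" c \<nu>] that
      unfolding eq by simp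
  qed
  from theI' [OF this] show "laction X c \<in> cells c [lid X (tdom X c)] (lid X (tcod X c)) c"
    and "ccomp X (laction X c) (tid X (tdom X c)) [lunit X (tdom X c)] = ccomp X (lunit X (tcod X c)) c []"
    unfolding laction_def eq by auto
qed

lemma cart:
  assumes "q \<in> Loose X" "f \<in> Tight X" "tcod X f = ltgt X q" "g \<in> Tight X" "tcod X g = lsrc X q"
  shows "cartesian X (cart X q f g)" "cart X q f g \<in> cells f [restr X q f g] q g"
proof -
  have *: "cartesian X (cart X q f g) \<and> ccod X (cart X q f g) = q \<and> cleft X (cart X q f g) = f \<and>
      cright X (cart X q f g) = g"
    using someI_ex [OF has_restrictions [OF assms]] by (simp add: cart_def)
  then show "cartesian X (cart X q f g)" by simp
  then show "cart X q f g \<in> cells f [restr X q f g] q g"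
    using * by (auto simp: cells_def restr_def cartesian_def)
qed

lemma hcart:
  assumes "f \<in> Tight X" "g \<in> Tight X" "tcod X f = tcod X g"
  shows "cartesian X (hcart X f g)" "hcart X f g \<in> cells f [hom X f g] (lid X (tcod X f)) g"
proof -
  have q: "lid X (tcod X f) \<in> Loose X" "tcod X f = ltgt X (lid X (tcod X f))"
    "tcod X g = lsrc X (lid X (tcod X f))"
    using assms by auto
  note c = cart [OF q(1) assms(1) q(2) assms(2) q(3)]
  show "cartesian X (hcart X f g)" "hcart X f g \<in> cells f [hom X f g] (lid X (tcod X f)) g"
    using c by (auto simp: hcart_def hom_def)
qed

lemma hom_simps [simp]:
  assumes "f \<in> Tight X" "g \<in> Tight X" "tcod X f = tcod X g"
  shows "hom X f g \<in> Loose X" "ltgt X (hom X f g) = tdom X f" "lsrc X (hom X f g) = tdom X g"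
  using cellsD(11) [OF hcart(2) [OF assms]] assms by auto

lemma hlift_unique:
  assumes "f \<in> Tight X" "g \<in> Tight X" "tcod X f = tcod X g"
    "f' \<in> Tight X" "tcod X f' = tdom X f" "g' \<in> Tight X" "tcod X g' = tdom X g"
    "\<chi> \<in> cells (f \<cdot> f') ps (lid X (tcod X f)) (g \<cdot> g')"
  shows "\<exists>!\<psi>. \<psi> \<in> cells f' ps (hom X f g) g' \<and> ccomp X (hcart X f g) f' [\<psi>] = \<chi>"
proof -
  note h = hcart [OF assms(1-3)]
  have "\<exists>!\<psi>. \<psi> \<in> Cell X \<and> cdom X \<psi> = cdom X \<chi> \<and> [ccod X \<psi>] = cdom X (hcart X f g) \<and>
           cleft X \<psi> = f' \<and> cright X \<psi> = g' \<and> ccomp X (hcart X f g) f' [\<psi>] = \<chi>"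
    using h(1) [unfolded cartesian_def, THEN conjunct2, THEN conjunct2, rule_format, of \<chi> f' g']
      cellsD(1-5) [OF h(2)] cellsD(1-5) [OF assms(8)] assms by simp
  then show ?thesis
    using cellsD(1-5) [OF h(2)] cellsD(1-5) [OF assms(8)] by (simp add: cells_def conj_assoc)
qed

lemma hlift:
  assumes "f \<in> Tight X" "g \<in> Tight X" "tcod X f = tcod X g"
    "f' \<in> Tight X" "tcod X f' = tdom X f" "g' \<in> Tight X" "tcod X g' = tdom X g"
    "\<chi> \<in> cells (f \<cdot> f') ps (lid X (tcod X f)) (g \<cdot> g')"
  shows "hlift X f g f' g' \<chi> \<in> cells f' ps (hom X f g) g'"
    and "ccomp X (hcart X f g) f' [hlift X f g f' g' \<chi>] = \<chi>"
proof -
  have eq: "\<psi> \<in> Cell X \<and> cdom X \<psi> = cdom X \<chi> \<and> ccod X \<psi> = hom X f g \<and>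
     cleft X \<psi> = f' \<and> cright X \<psi> = g' \<and> ccomp X (hcart X f g) f' [\<psi>] = \<chi> \<longleftrightarrow>
     \<psi> \<in> cells f' ps (hom X f g) g' \<and> ccomp X (hcart X f g) f' [\<psi>] = \<chi>" for \<psi>
    using cellsD [OF assms(8)] by (auto simp: cells_def)
  show "hlift X f g f' g' \<chi> \<in> cells f' ps (hom X f g) g'"
    and "ccomp X (hcart X f g) f' [hlift X f g f' g' \<chi>] = \<chi>"
    using theI' [OF hlift_unique [OF assms]] unfolding hlift_def eq by auto
qed

lemma hlift_eqI:
  assumes "f \<in> Tight X" "g \<in> Tight X" "tcod X f = tcod X g"
    "\<psi> \<in> cells f' ps (hom X f g) g'" "ccomp X (hcart X f g) f' [\<psi>] = \<chi>"
  shows "hlift X f g f' g' \<chi> = \<psi>"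
proof -
  have t1: "\<chi> \<in> cells (f \<cdot> f') ps (lid X (tcod X f)) (g \<cdot> g')"
    using ccomp_cells_single [OF hcart(2) [OF assms(1-3)] assms(4)] assms(5) by simp
  have t2: "f' \<in> Tight X" "tcod X f' = tdom X f" "g' \<in> Tight X" "tcod X g' = tdom X g"
    using cellsD [OF assms(4)] assms(1-3) by auto
  note t = t1 t2
  show ?thesis
    using hlift_unique [OF assms(1-3) t(2-5) t(1)] hlift [OF assms(1-3) t(2-5) t(1)] assms(4,5)
    by blast
qed

section \<open>The calculus of cells into loose-identities\<close>

text \<open>\<open>hom_cells f ps g\<close> encodes the 2-cells \<open>ps \<Rightarrow> E(f,g)\<close>. In this form \<open>\<smile>\<close> becomes \<open>\<star>\<close>,
  \<open>\<frown>\<^sub>f\<close> becomes \<open>hone f\<close> and the action of \<open>c\<close> becomes \<open>hact c\<close>.\<close>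

definition hom_cells :: "'b \<Rightarrow> 'c list \<Rightarrow> 'b \<Rightarrow> 'd set" where
  "hom_cells f ps g = cells f ps (lid X (tcod X f)) g"

lemma hom_cellsD:
  assumes "\<chi> \<in> hom_cells f ps g"
  shows "f \<in> Tight X" "g \<in> Tight X" "tcod X g = tcod X f"
    "loose_chain X (tdom X f) ps (tdom X g)" "cleft X \<chi> = f"
proof -
  note d = cellsD [OF assms [unfolded hom_cells_def]]
  show f: "f \<in> Tight X" by (rule d)
  show "g \<in> Tight X" by (rule d)
  show "tcod X g = tcod X f" using d(10) f by simp
  show "loose_chain X (tdom X f) ps (tdom X g)" by (rule d)
  show "cleft X \<chi> = f" by (rule d)
qed

lemma hom_cells_ccomp:
  assumes "\<chi> \<in> hom_cells f ps g" "chain_cells k \<xi>s l ps rs" "tcod X k = tdom X f"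
  shows "ccomp X \<chi> k \<xi>s \<in> hom_cells (f \<cdot> k) rs (g \<cdot> l)"
  using ccomp_cells [OF assms(1) [unfolded hom_cells_def] assms(2,3)] hom_cellsD(1) [OF assms(1)]
    chain_cells_Tight [OF assms(2)] assms(3)
  by (simp add: hom_cells_def)

lemma hom_cells_gcomp:
  assumes "\<chi> \<in> hom_cells f ps g" "chain_cells (tid X (tdom X f)) \<xi>s l ps rs"
  shows "ccomp X \<chi> (tid X (tdom X f)) \<xi>s \<in> hom_cells f rs (g \<cdot> l)"
  using hom_cells_ccomp [OF assms] hom_cellsD(1) [OF assms(1)] by simp

definition mul :: "'d \<Rightarrow> 'd \<Rightarrow> 'd" (infixr "\<star>" 70) where
  "\<chi> \<star> \<psi> = ccomp X (lmult X (tcod X (cleft X \<chi>))) (cleft X \<chi>) [\<chi>, \<psi>]"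

definition hone :: "'b \<Rightarrow> 'd" where
  "hone f = ccomp X (lunit X (tcod X f)) f []"

definition hact :: "'b \<Rightarrow> 'd \<Rightarrow> 'd" where
  "hact c \<chi> = ccomp X (laction X c) (cleft X \<chi>) [\<chi>]"

lemma mul_eq: "\<chi> \<in> hom_cells f ps g \<Longrightarrow> \<chi> \<star> \<psi> = ccomp X (lmult X (tcod X f)) f [\<chi>, \<psi>]"
  using hom_cellsD(5) by (auto simp: mul_def)

lemma hact_eq: "\<chi> \<in> hom_cells f ps g \<Longrightarrow> hact c \<chi> = ccomp X (laction X c) f [\<chi>]"
  using hom_cellsD(5) by (auto simp: hact_def)

lemma mul_hom:
  assumes "\<chi> \<in> hom_cells f ps g" "\<psi> \<in> hom_cells g qs h"
  shows "\<chi> \<star> \<psi> \<in> hom_cells f (ps @ qs) h"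
proof -
  note d = hom_cellsD [OF assms(1)] and e = hom_cellsD [OF assms(2)]
  have A: "tcod X f \<in> Ob X" using d(1) by simp
  have "ccomp X (lmult X (tcod X f)) f [\<chi>, \<psi>] \<in>
      cells (tid X (tcod X f) \<cdot> f) (ps @ qs) (lid X (tcod X f)) (tid X (tcod X f) \<cdot> h)"
    by (rule ccomp_cells_pair [OF lmult(1) [OF A]])
      (use assms d(3) in \<open>simp_all add: hom_cells_def\<close>)
  then show ?thesis
    using mul_eq [OF assms(1)] d e by (simp add: hom_cells_def)
qed

text \<open>Associativity of composition at \<open>lmult\<close>, with the chain cut where \<chi>
  ends and \<psi> begins. It lets an identity between products of particular cells be substituted
  into.\<close>

lemma mul_ccomp:
  assumes "\<chi> \<in> hom_cells f ps g" "\<psi> \<in> hom_cells g qs h"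
    "chain_cells k \<xi>s l ps rs" "chain_cells l \<xi>s' m qs rs'" "tcod X k = tdom X f"
  shows "ccomp X (\<chi> \<star> \<psi>) k (\<xi>s @ \<xi>s') = ccomp X \<chi> k \<xi>s \<star> ccomp X \<psi> l \<xi>s'"
proof -
  note d = hom_cellsD [OF assms(1)]
  have A: "tcod X f \<in> Ob X" using d(1) by simp
  have \<psi>: "\<psi> \<in> cells g qs (lid X (tcod X f)) h"
    using assms(2) d(3) by (simp add: hom_cells_def)
  have "ccomp X (\<chi> \<star> \<psi>) k (\<xi>s @ \<xi>s') =
      ccomp X (lmult X (tcod X f)) (f \<cdot> k) [ccomp X \<chi> k \<xi>s, ccomp X \<psi> l \<xi>s']"
    unfolding mul_eq [OF assms(1)]
    by (rule ccomp_assoc_pair [OF lmult(1) [OF A] assms(1) [unfolded hom_cells_def] \<psi> assms(3-5)])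
  moreover have "tcod X (f \<cdot> k) = tcod X f"
    using d(1) chain_cells_Tight [OF assms(3)] assms(5) by simp
  ultimately show ?thesis
    using mul_eq [OF hom_cells_ccomp [OF assms(1,3,5)]] by simp
qed

lemma hone_hom: "f \<in> Tight X \<Longrightarrow> hone f \<in> hom_cells f [] f"
  unfolding hom_cells_def hone_def
  using ccomp_cells_Nil [OF lunit_lid(1), of "tcod X f" f] by simp

lemma hone_ccomp:
  assumes "f \<in> Tight X" "h \<in> Tight X" "tcod X h = tdom X f"
  shows "ccomp X (hone f) h [] = hone (f \<cdot> h)"
  using ccomp_assoc_Nil [OF lunit_lid(1), of "tcod X f" f h] assms by (simp add: hone_def)

lemma hone_tid: "A \<in> Ob X \<Longrightarrow> hone (tid X A) = lunit X A"
  using ccomp_map_cid [OF lunit_lid(1), of A] by (simp add: hone_def)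

text \<open>The identity 2-cell of \<open>A(1,1)\<close> serves as the generic arrow of
  \<open>A\<close>: every arrow arises from it by substitution (\<open>cid_lid_ccomp\<close>). Laws
  are proved for generic arrows, whose domains consist of loose-identities where units can be
  inserted, and are then substituted.\<close>

lemma cid_lid_hom: "A \<in> Ob X \<Longrightarrow> cid X (lid X A) \<in> hom_cells (tid X A) [lid X A] (tid X A)"
  using cid_cells [of "lid X A"] by (simp add: hom_cells_def)

lemma cid_lid_ccomp: "\<chi> \<in> hom_cells f ps g \<Longrightarrow> ccomp X (cid X (lid X (tcod X f))) f [\<chi>] = \<chi>"
  by (simp add: hom_cells_def)

lemma hom_cells_chain:
  assumes "\<chi> \<in> hom_cells f ps g"
  shows "chain_cells f [\<chi>] g [lid X (tcod X f)] ps"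
  using chain_cells_single assms by (simp add: hom_cells_def)

text \<open>For the generic arrow this is the defining equation of \<open>lmult\<close>;
  substituting \<chi> gives the general case.\<close>

lemma mul_hone_left:
  assumes "\<chi> \<in> hom_cells f ps g"
  shows "hone f \<star> \<chi> = \<chi>"
proof -
  note d = hom_cellsD [OF assms]
  let ?A = "tcod X f" and ?J = "cid X (lid X (tcod X f))"
  have A: "?A \<in> Ob X" using d(1) by simp
  have "hone f \<star> \<chi> = ccomp X (hone (tid X ?A)) f [] \<star> ccomp X ?J f [\<chi>]"
    using hone_ccomp [of "tid X ?A" f] d A cid_lid_ccomp [OF assms] by simp
  also have "\<dots> = ccomp X (hone (tid X ?A) \<star> ?J) f ([] @ [\<chi>])"
    using mul_ccomp [OF hone_hom cid_lid_hom [OF A] chain_cells_Nil hom_cells_chain [OF assms]] d A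
    by simp
  also have "hone (tid X ?A) \<star> ?J = ?J"
    using mul_eq [OF hone_hom, of "tid X ?A"] hone_tid [OF A] lmult(2) [OF A] A by simp
  finally show ?thesis using cid_lid_ccomp [OF assms] by simp
qed

text \<open>Both sides have one loose-identity as domain, so it suffices to insert a unit there. The
  left side becomes a product of two identity arrows, which the left unit law already
  evaluates.\<close>

lemma cid_lid_mul_hone:
  assumes A: "A \<in> Ob X"
  shows "cid X (lid X A) \<star> hone (tid X A) = cid X (lid X A)"
proof -
  let ?I = "tid X A" and ?J = "cid X (lid X A)"
  have t: "?I \<in> Tight X" "tdom X ?I = A" "tcod X ?I = A" using A by simp_all
  have J: "?J \<in> hom_cells ?I [lid X A] ?I" by (rule cid_lid_hom [OF A])
  have H: "hone ?I \<in> hom_cells ?I [] ?I" by (rule hone_hom [OF t(1)])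
  have HH: "chain_cells ?I [hone ?I] ?I [lid X A] []"
    using hom_cells_chain [OF H] t by simp
  have "ccomp X (?J \<star> hone ?I) ?I ([hone ?I] @ []) = ccomp X ?J ?I [hone ?I] \<star> ccomp X (hone ?I) ?I []"
    by (rule mul_ccomp [OF J H HH chain_cells_Nil]) (use t in simp_all)
  also have "\<dots> = hone ?I \<star> hone ?I"
    using hone_ccomp [OF t(1) t(1)] cid_lid_ccomp [OF H] t by simp
  also have "\<dots> = hone ?I" by (rule mul_hone_left [OF H])
  also have "\<dots> = ccomp X ?J ?I [hone ?I]"
    using cid_lid_ccomp [OF H] t by simp
  finally have *: "ccomp X (?J \<star> hone ?I) ?I [lunit X A] = ccomp X ?J ?I [lunit X A]"
    using hone_tid [OF A] by simp
  show ?thesis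
    using lunit_cancel [OF A, of "?J \<star> hone ?I" ?I "[]" "[]" "lid X A" ?I ?J] * mul_hom [OF J H] J t
    by (simp add: hom_cells_def)
qed

lemma mul_hone_right:
  assumes "\<chi> \<in> hom_cells f ps g"
  shows "\<chi> \<star> hone g = \<chi>"
proof -
  note d = hom_cellsD [OF assms]
  let ?A = "tcod X f" and ?J = "cid X (lid X (tcod X f))"
  have A: "?A \<in> Ob X" using d(1) by simp
  have "\<chi> \<star> hone g = ccomp X ?J f [\<chi>] \<star> ccomp X (hone (tid X ?A)) g []"
    using hone_ccomp [of "tid X ?A" g] d A cid_lid_ccomp [OF assms] by simp
  also have "\<dots> = ccomp X (?J \<star> hone (tid X ?A)) f ([\<chi>] @ [])"
    using mul_ccomp [OF cid_lid_hom [OF A] hone_hom hom_cells_chain [OF assms] chain_cells_Nil] d A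
    by simp
  also have "?J \<star> hone (tid X ?A) = ?J"
    by (rule cid_lid_mul_hone [OF A])
  finally show ?thesis using cid_lid_ccomp [OF assms] by simp
qed

lemma chain_cells_cid_lid:
  "A \<in> Ob X \<Longrightarrow> chain_cells (tid X A) [cid X (lid X A)] (tid X A) [lid X A] [lid X A]"
  using chain_cells_cid [of A "[lid X A]" A] by simp

text \<open>Inserting a unit into the leftmost of the three loose-identities reduces both
  bracketings to \<open>J \<star> J\<close> by the left unit law.\<close>

lemma cid_lid_mul_assoc:
  assumes A: "A \<in> Ob X"
  defines "J \<equiv> cid X (lid X A)"
  shows "(J \<star> J) \<star> J = J \<star> (J \<star> J)"
proof -
  let ?I = "tid X A" and ?L = "lid X A" and ?i = "lunit X A"
  have t: "?I \<in> Tight X" "tdom X ?I = A" "tcod X ?I = A" using A by simp_all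
  have J: "J \<in> hom_cells ?I [?L] ?I" unfolding J_def by (rule cid_lid_hom [OF A])
  have JJ: "J \<star> J \<in> hom_cells ?I [?L, ?L] ?I" using mul_hom [OF J J] by simp
  have H: "?i \<in> hom_cells ?I [] ?I" using hone_hom [OF t(1)] hone_tid [OF A] by simp
  have ci: "chain_cells ?I [?i] ?I [?L] []" using hom_cells_chain [OF H] t by simp
  have cJ: "chain_cells ?I [J] ?I [?L] [?L]"
    unfolding J_def by (rule chain_cells_cid_lid [OF A])
  have cJJ: "chain_cells ?I [J, J] ?I [?L, ?L] [?L, ?L]"
    using chain_cells_append [OF cJ cJ] by simp
  have Ji: "ccomp X J ?I [?i] = ?i" using cid_lid_ccomp [OF H] t J_def by simp
  have JcJ: "ccomp X J ?I [J] = J" using cid_lid_ccomp [OF J] t J_def by simp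
  have left: "?i \<star> \<chi> = \<chi>" if "\<chi> \<in> hom_cells ?I ps g" for \<chi> ps g
    using mul_hone_left [OF that] hone_tid [OF A] by simp
  have "ccomp X ((J \<star> J) \<star> J) ?I ([?i, J] @ [J]) = ccomp X (J \<star> J) ?I [?i, J] \<star> ccomp X J ?I [J]"
    by (rule mul_ccomp [OF JJ J _ cJ]) (use chain_cells_append [OF ci cJ] t in simp_all)
  moreover have "ccomp X (J \<star> J) ?I ([?i] @ [J]) = ccomp X J ?I [?i] \<star> ccomp X J ?I [J]"
    by (rule mul_ccomp [OF J J ci cJ]) (use t in simp_all)
  ultimately have 1: "ccomp X ((J \<star> J) \<star> J) ?I [?i, J, J] = J \<star> J"
    using Ji JcJ left [OF J] by simp
  have "ccomp X (J \<star> (J \<star> J)) ?I ([?i] @ [J, J]) = ccomp X J ?I [?i] \<star> ccomp X (J \<star> J) ?I [J, J]"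
    by (rule mul_ccomp [OF J JJ ci cJJ]) (use t in simp_all)
  moreover have "ccomp X (J \<star> J) ?I ([J] @ [J]) = ccomp X J ?I [J] \<star> ccomp X J ?I [J]"
    by (rule mul_ccomp [OF J J cJ cJ]) (use t in simp_all)
  ultimately have 2: "ccomp X (J \<star> (J \<star> J)) ?I [?i, J, J] = J \<star> J"
    using Ji JcJ left [OF JJ] by simp
  show ?thesis
    using lunit_cancel [OF A, of "(J \<star> J) \<star> J" ?I "[]" "[?L, ?L]" ?L ?I "J \<star> (J \<star> J)"]
      mul_hom [OF JJ J] mul_hom [OF J JJ] 1 2 t
    by (simp add: hom_cells_def J_def)
qed

lemma mul_assoc:
  assumes "\<chi> \<in> hom_cells f ps g" "\<psi> \<in> hom_cells g qs h" "\<omega> \<in> hom_cells h rs k"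
  shows "(\<chi> \<star> \<psi>) \<star> \<omega> = \<chi> \<star> (\<psi> \<star> \<omega>)"
proof -
  note d = hom_cellsD [OF assms(1)] and e = hom_cellsD [OF assms(2)]
  let ?A = "tcod X f"
  let ?J = "cid X (lid X ?A)" and ?I = "tid X ?A" and ?L = "lid X ?A"
  have A: "?A \<in> Ob X" using d(1) by simp
  have t: "?I \<in> Tight X" "tdom X ?I = ?A" "tcod X ?I = ?A" using A by simp_all
  have J: "?J \<in> hom_cells ?I [?L] ?I" by (rule cid_lid_hom [OF A])
  have JJ: "?J \<star> ?J \<in> hom_cells ?I [?L, ?L] ?I" using mul_hom [OF J J] by simp
  have c1: "chain_cells f [\<chi>] g [?L] ps" using hom_cells_chain [OF assms(1)] by simp
  have c2: "chain_cells g [\<psi>] h [?L] qs" using hom_cells_chain [OF assms(2)] d by simp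
  have c3: "chain_cells h [\<omega>] k [?L] rs" using hom_cells_chain [OF assms(3)] d e by simp
  have x: "ccomp X ?J f [\<chi>] = \<chi>" "ccomp X ?J g [\<psi>] = \<psi>" "ccomp X ?J h [\<omega>] = \<omega>"
    using cid_lid_ccomp [OF assms(1)] cid_lid_ccomp [OF assms(2)] cid_lid_ccomp [OF assms(3)] d e
    by simp_all
  have "(\<chi> \<star> \<psi>) \<star> \<omega> = ccomp X ((?J \<star> ?J) \<star> ?J) f ([\<chi>, \<psi>] @ [\<omega>])"
    using mul_ccomp [OF JJ J, of f "[\<chi>, \<psi>]" h _ "[\<omega>]"] mul_ccomp [OF J J c1 c2]
      chain_cells_append [OF c1 c2] c3 x t by simp
  also have "\<dots> = ccomp X (?J \<star> (?J \<star> ?J)) f ([\<chi>] @ [\<psi>, \<omega>])"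
    using cid_lid_mul_assoc [OF A] by simp
  also have "\<dots> = \<chi> \<star> (\<psi> \<star> \<omega>)"
    using mul_ccomp [OF J JJ, of f "[\<chi>]" g _ "[\<psi>, \<omega>]"] mul_ccomp [OF J J c2 c3]
      chain_cells_append [OF c2 c3] c1 x t d e by simp
  finally show ?thesis .
qed

section \<open>Functoriality of tight-cells on arrows\<close>

lemma hact_hom:
  assumes "\<chi> \<in> hom_cells f ps g" "c \<in> Tight X" "tdom X c = tcod X f"
  shows "hact c \<chi> \<in> hom_cells (c \<cdot> f) ps (c \<cdot> g)"
  using ccomp_cells_single [OF laction(1) [OF assms(2)], of \<chi> f ps g] assms hact_eq [OF assms(1)]
    hom_cellsD(1) [OF assms(1)]
  by (simp add: hom_cells_def)

lemma hact_ccomp: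
  assumes "\<chi> \<in> hom_cells f ps g" "c \<in> Tight X" "tdom X c = tcod X f"
    "chain_cells k \<xi>s l ps rs" "tcod X k = tdom X f"
  shows "ccomp X (hact c \<chi>) k \<xi>s = hact c (ccomp X \<chi> k \<xi>s)"
proof -
  have "\<chi> \<in> cells f ps (lid X (tdom X c)) g"
    using assms(1,3) by (simp add: hom_cells_def)
  then show ?thesis
    using ccomp_assoc_single [OF laction(1) [OF assms(2)] _ assms(4,5)] hact_eq [OF assms(1)]
      hact_eq [OF hom_cells_ccomp [OF assms(1,4,5)]] by simp
qed

text \<open>The defining equation of \<open>laction\<close>, precomposed with
  \<open>f\<close>.\<close>

lemma hact_hone:
  assumes "f \<in> Tight X" "c \<in> Tight X" "tdom X c = tcod X f"
  shows "hact c (hone f) = hone (c \<cdot> f)"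
proof -
  let ?A = "tcod X f"
  have A: "?A \<in> Ob X" using assms by simp
  have "hact c (hone f) = ccomp X (hact c (hone (tid X ?A))) f []"
    using hact_ccomp [OF hone_hom _ _ chain_cells_Nil, of "tid X ?A" c f] hone_ccomp [of "tid X ?A" f]
      assms A by simp
  also have "hact c (hone (tid X ?A)) = hone c"
    using laction(2) [OF assms(2)] hone_tid [OF A] assms hact_eq [OF hone_hom, of "tid X ?A" c] A
    by (simp add: hone_def)
  also have "ccomp X (hone c) f [] = hone (c \<cdot> f)"
    using hone_ccomp assms by simp
  finally show ?thesis .
qed

text \<open>For a generic pair of arrows, inserting a unit into the left slot turns both sides into
  \<open>hact c ?J\<close>, because \<open>c\<close> preserves identities. The general case follows
  by substitution.\<close>

lemma hact_mul:
  assumes "\<chi> \<in> hom_cells f ps g" "\<psi> \<in> hom_cells g qs h" "c \<in> Tight X" "tdom X c = tcod X f"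
  shows "hact c (\<chi> \<star> \<psi>) = hact c \<chi> \<star> hact c \<psi>"
proof -
  note d = hom_cellsD [OF assms(1)] and e = hom_cellsD [OF assms(2)]
  let ?A = "tcod X f"
  let ?J = "cid X (lid X ?A)" and ?I = "tid X ?A" and ?L = "lid X ?A" and ?i = "lunit X ?A"
  have A: "?A \<in> Ob X" using d(1) by simp
  have t: "?I \<in> Tight X" "tdom X ?I = ?A" "tcod X ?I = ?A" using A by simp_all
  have J: "?J \<in> hom_cells ?I [?L] ?I" by (rule cid_lid_hom [OF A])
  have JJ: "?J \<star> ?J \<in> hom_cells ?I [?L, ?L] ?I" using mul_hom [OF J J] by simp
  have cI: "c \<cdot> ?I = c" using assms by simp
  have cJ: "hact c ?J \<in> hom_cells c [?L] c" using hact_hom [OF J] assms t cI by simp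
  have cJJ: "hact c (?J \<star> ?J) \<in> hom_cells c [?L, ?L] c" using hact_hom [OF JJ] assms t cI by simp
  have H: "?i \<in> hom_cells ?I [] ?I" using hone_hom [OF t(1)] hone_tid [OF A] by simp
  have ci: "chain_cells ?I [?i] ?I [?L] []" using hom_cells_chain [OF H] t by simp
  have chJ: "chain_cells ?I [?J] ?I [?L] [?L]" by (rule chain_cells_cid_lid [OF A])
  have Ji: "ccomp X ?J ?I [?i] = ?i" using cid_lid_ccomp [OF H] t by simp
  have JcJ: "ccomp X ?J ?I [?J] = ?J" using cid_lid_ccomp [OF J] t by simp
  have hi: "hact c ?i = hone c" using hact_hone [OF t(1)] hone_tid [OF A] assms t cI by simp
  have "ccomp X (hact c (?J \<star> ?J)) ?I ([?i] @ [?J]) = hact c (ccomp X (?J \<star> ?J) ?I ([?i] @ [?J]))"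
    by (rule hact_ccomp [OF JJ]) (use assms t chain_cells_append [OF ci chJ] in simp_all)
  also have "ccomp X (?J \<star> ?J) ?I ([?i] @ [?J]) = ccomp X ?J ?I [?i] \<star> ccomp X ?J ?I [?J]"
    by (rule mul_ccomp [OF J J ci chJ]) (use t in simp_all)
  finally have 1: "ccomp X (hact c (?J \<star> ?J)) ?I [?i, ?J] = hact c ?J"
    using Ji JcJ mul_hone_left [OF J] hone_tid [OF A] by simp
  have "ccomp X (hact c ?J \<star> hact c ?J) ?I ([?i] @ [?J]) =
      ccomp X (hact c ?J) ?I [?i] \<star> ccomp X (hact c ?J) ?I [?J]"
    by (rule mul_ccomp [OF cJ cJ ci chJ]) (use assms t in simp_all)
  then have 2: "ccomp X (hact c ?J \<star> hact c ?J) ?I [?i, ?J] = hact c ?J"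
    using hact_ccomp [OF J _ _ ci] hact_ccomp [OF J _ _ chJ] assms t Ji JcJ hi mul_hone_left [OF cJ] by simp
  have eq: "hact c (?J \<star> ?J) = hact c ?J \<star> hact c ?J"
    using lunit_cancel [OF A, of "hact c (?J \<star> ?J)" c "[]" "[?L]" "lid X (tcod X c)" c "hact c ?J \<star> hact c ?J"]
      cJJ mul_hom [OF cJ cJ] 1 2 t assms
    by (simp add: hom_cells_def)
  have c1: "chain_cells f [\<chi>] g [?L] ps" using hom_cells_chain [OF assms(1)] by simp
  have c2: "chain_cells g [\<psi>] h [?L] qs" using hom_cells_chain [OF assms(2)] d by simp
  have x: "ccomp X ?J f [\<chi>] = \<chi>" "ccomp X ?J g [\<psi>] = \<psi>"
    using cid_lid_ccomp [OF assms(1)] cid_lid_ccomp [OF assms(2)] d e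
    by simp_all
  have "hact c (\<chi> \<star> \<psi>) = hact c (ccomp X (?J \<star> ?J) f ([\<chi>] @ [\<psi>]))"
    using mul_ccomp [OF J J c1 c2] x t by simp
  also have "\<dots> = ccomp X (hact c (?J \<star> ?J)) f ([\<chi>] @ [\<psi>])"
    using hact_ccomp [OF JJ, of c f "[\<chi>] @ [\<psi>]" h] chain_cells_append [OF c1 c2] assms t by simp
  also have "\<dots> = ccomp X (hact c ?J) f [\<chi>] \<star> ccomp X (hact c ?J) g [\<psi>]"
    unfolding eq by (rule mul_ccomp [OF cJ cJ c1 c2]) (use assms in simp)
  also have "\<dots> = hact c \<chi> \<star> hact c \<psi>"
    using hact_ccomp [OF J _ _ c1, of c] hact_ccomp [OF J _ _ c2, of c] x t assms d by simp
  finally show ?thesis .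
qed

text \<open>On the generic arrow with a unit inserted, both sides are the identity arrow of
  \<open>d \<cdot> c\<close>.\<close>

lemma hact_tcomp:
  assumes "\<chi> \<in> hom_cells f ps g" "c \<in> Tight X" "tdom X c = tcod X f" "d \<in> Tight X" "tdom X d = tcod X c"
  shows "hact (d \<cdot> c) \<chi> = hact d (hact c \<chi>)"
proof -
  note e = hom_cellsD [OF assms(1)]
  let ?A = "tcod X f"
  let ?J = "cid X (lid X ?A)" and ?I = "tid X ?A" and ?L = "lid X ?A" and ?i = "lunit X ?A"
  have A: "?A \<in> Ob X" using e(1) by simp
  have t: "?I \<in> Tight X" "tdom X ?I = ?A" "tcod X ?I = ?A" using A by simp_all
  have dc: "d \<cdot> c \<in> Tight X" "tdom X (d \<cdot> c) = ?A" "tcod X (d \<cdot> c) = tcod X d"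
    using assms by simp_all
  have I: "c \<cdot> ?I = c" "d \<cdot> c \<cdot> ?I = d \<cdot> c" "(d \<cdot> c) \<cdot> ?I = d \<cdot> c"
    using assms t by simp_all
  have J: "?J \<in> hom_cells ?I [?L] ?I" by (rule cid_lid_hom [OF A])
  have cJ: "hact c ?J \<in> hom_cells c [?L] c" using hact_hom [OF J] assms t I by simp
  have H: "?i \<in> hom_cells ?I [] ?I" using hone_hom [OF t(1)] hone_tid [OF A] by simp
  have ci: "chain_cells ?I [?i] ?I [?L] []" using hom_cells_chain [OF H] t by simp
  have Ji: "ccomp X ?J ?I [?i] = hone ?I" using cid_lid_ccomp [OF H] t hone_tid [OF A] by simp
  have 1: "ccomp X (hact (d \<cdot> c) ?J) ?I [?i] = hone (d \<cdot> c)"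
    using hact_ccomp [OF J dc(1) _ ci] hact_hone [OF t(1) dc(1)] Ji I t dc by simp
  have "ccomp X (hact d (hact c ?J)) ?I [?i] = hact d (ccomp X (hact c ?J) ?I [?i])"
    using hact_ccomp [OF cJ _ _ ci] assms t by simp
  also have "\<dots> = hone (d \<cdot> c)"
    using hact_ccomp [OF J _ _ ci] hact_hone [OF t(1)] hact_hone assms Ji I t by simp
  finally have 2: "ccomp X (hact d (hact c ?J)) ?I [?i] = hone (d \<cdot> c)" .
  have eq: "hact (d \<cdot> c) ?J = hact d (hact c ?J)"
    using lunit_cancel [OF A, of "hact (d \<cdot> c) ?J" "d \<cdot> c" "[]" "[]" "lid X (tcod X d)" "d \<cdot> c" "hact d (hact c ?J)"]
      hact_hom [OF J dc(1)] hact_hom [OF cJ assms(4,5)] 1 2 t dc assms I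
    by (simp add: hom_cells_def)
  have c1: "chain_cells f [\<chi>] g [?L] ps" using hom_cells_chain [OF assms(1)] by simp
  have x: "ccomp X ?J f [\<chi>] = \<chi>" using cid_lid_ccomp [OF assms(1)] by simp
  have "hact (d \<cdot> c) \<chi> = ccomp X (hact (d \<cdot> c) ?J) f [\<chi>]"
    using hact_ccomp [OF J dc(1) _ c1] x t dc by simp
  also have "\<dots> = hact d (ccomp X (hact c ?J) f [\<chi>])"
    unfolding eq using hact_ccomp [OF cJ _ _ c1] assms t by simp
  also have "\<dots> = hact d (hact c \<chi>)"
    using hact_ccomp [OF J _ _ c1] assms t x by simp
  finally show ?thesis .
qed

lemma hact_tid:
  assumes "\<chi> \<in> hom_cells f ps g" "A = tcod X f"
  shows "hact (tid X A) \<chi> = \<chi>"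
proof -
  note e = hom_cellsD [OF assms(1)]
  let ?J = "cid X (lid X A)" and ?I = "tid X A" and ?L = "lid X A" and ?i = "lunit X A"
  have A: "A \<in> Ob X" using e(1) assms by simp
  have t: "?I \<in> Tight X" "tdom X ?I = A" "tcod X ?I = A" using A by simp_all
  have J: "?J \<in> hom_cells ?I [?L] ?I" by (rule cid_lid_hom [OF A])
  have H: "?i \<in> hom_cells ?I [] ?I" using hone_hom [OF t(1)] hone_tid [OF A] by simp
  have ci: "chain_cells ?I [?i] ?I [?L] []" using hom_cells_chain [OF H] t by simp
  have Ji: "ccomp X ?J ?I [?i] = hone ?I" using cid_lid_ccomp [OF H] t hone_tid [OF A] by simp
  have 1: "ccomp X (hact ?I ?J) ?I [?i] = hone ?I"
    using hact_ccomp [OF J t(1) _ ci] hact_hone [OF t(1) t(1)] Ji t by simp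
  have eq: "hact ?I ?J = ?J"
    using lunit_cancel [OF A, of "hact ?I ?J" ?I "[]" "[]" ?L ?I ?J] hact_hom [OF J t(1)] J 1 Ji t
    by (simp add: hom_cells_def)
  have c1: "chain_cells f [\<chi>] g [?L] ps" using hom_cells_chain [OF assms(1)] assms by simp
  have x: "ccomp X ?J f [\<chi>] = \<chi>" using cid_lid_ccomp [OF assms(1)] assms by simp
  show ?thesis
    using hact_ccomp [OF J t(1) _ c1] x t(2,3) eq assms(2) [symmetric] by simp
qed

section \<open>2-cells between hom loose-cells as operations on arrows\<close>

definition cospan :: "'b \<Rightarrow> 'b \<Rightarrow> bool" where
  "cospan f g \<longleftrightarrow> f \<in> Tight X \<and> g \<in> Tight X \<and> tcod X f = tcod X g"

lemma cospanD:
  assumes "cospan f g"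
  shows "f \<in> Tight X" "g \<in> Tight X" "tcod X f = tcod X g"
  using assms by (auto simp: cospan_def)

lemma cospan_tcomp: "cospan f g \<Longrightarrow> y \<in> Tight X \<Longrightarrow> tcod X y = tdom X g \<Longrightarrow> cospan f (g \<cdot> y)"
  by (simp add: cospan_def)

lemma hcart_hom: "cospan f g \<Longrightarrow> hcart X f g \<in> hom_cells f [hom X f g] g"
  using hcart(2) by (simp add: cospan_def hom_cells_def)

lemma hlift_hom:
  assumes "cospan f g" "y \<in> Tight X" "tcod X y = tdom X g" "\<chi> \<in> hom_cells f ps (g \<cdot> y)"
  shows "hlift X f g (tid X (tdom X f)) y \<chi> \<in> cells (tid X (tdom X f)) ps (hom X f g) y"
    and "ccomp X (hcart X f g) (tid X (tdom X f)) [hlift X f g (tid X (tdom X f)) y \<chi>] = \<chi>"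
proof -
  note c = cospanD [OF assms(1)]
  have t: "tid X (tdom X f) \<in> Tight X" "tcod X (tid X (tdom X f)) = tdom X f"
    using c by simp_all
  have \<chi>: "\<chi> \<in> cells (f \<cdot> tid X (tdom X f)) ps (lid X (tcod X f)) (g \<cdot> y)"
    using assms(4) c(1) by (simp add: hom_cells_def)
  show "hlift X f g (tid X (tdom X f)) y \<chi> \<in> cells (tid X (tdom X f)) ps (hom X f g) y"
    and "ccomp X (hcart X f g) (tid X (tdom X f)) [hlift X f g (tid X (tdom X f)) y \<chi>] = \<chi>"
    by (rule hlift [OF c t assms(2,3) \<chi>])+
qed

text \<open>Factorisations through a cartesian 2-cell are unique, so they commute with substitution
  in the domain; the substituted chain may also extend the right tight-cell by
  \<open>k\<close>.\<close>

lemma hlift_ccomp: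
  assumes "cospan f g" "y \<in> Tight X" "tcod X y = tdom X g" "\<chi> \<in> hom_cells f ps (g \<cdot> y)"
    "chain_cells (tid X (tdom X f)) \<xi>s k ps rs"
  shows "ccomp X (hlift X f g (tid X (tdom X f)) y \<chi>) (tid X (tdom X f)) \<xi>s =
    hlift X f g (tid X (tdom X f)) (y \<cdot> k) (ccomp X \<chi> (tid X (tdom X f)) \<xi>s)"
proof -
  note c = cospanD [OF assms(1)] and h = hlift_hom [OF assms(1-4)]
  let ?I = "tid X (tdom X f)"
  have I: "?I \<in> Tight X" "tcod X ?I = tdom X f" "tdom X ?I = tdom X f" "?I \<cdot> ?I = ?I"
    using c by simp_all
  have "ccomp X (hlift X f g ?I y \<chi>) ?I \<xi>s \<in> cells ?I rs (hom X f g) (y \<cdot> k)"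
    using ccomp_cells [OF h(1) assms(5)] I by simp
  moreover have "ccomp X (hcart X f g) ?I [ccomp X (hlift X f g ?I y \<chi>) ?I \<xi>s] = ccomp X \<chi> ?I \<xi>s"
    using ccomp_assoc_single [OF hcart_hom [OF assms(1), unfolded hom_cells_def] h(1) assms(5)] I h(2)
    by simp
  ultimately show ?thesis
    using hlift_eqI [OF c] by metis
qed

text \<open>If \<open>\<Phi>\<close> encodes \<open>\<phi> : E(a,b) \<Rightarrow> E'(a',b')\<close> and \<open>\<chi>\<close> encodes a 2-cell \<open>\<psi>\<close> into \<open>E(a,by)\<close>, then
  \<open>app a b \<Phi> y \<chi>\<close> encodes \<open>\<phi>(1,y) \<circ> \<psi>\<close>.\<close>

definition app :: "'b \<Rightarrow> 'b \<Rightarrow> 'd \<Rightarrow> 'b \<Rightarrow> 'd \<Rightarrow> 'd" where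
  "app a b \<Phi> y \<chi> = ccomp X \<Phi> (tid X (tdom X a)) [hlift X a b (tid X (tdom X a)) y \<chi>]"

lemma hom_opD:
  assumes "cospan a b" "\<Phi> \<in> hom_cells a' [hom X a b] b'"
  shows "cospan a' b'" "tdom X a' = tdom X a" "tdom X b' = tdom X b"
  using hom_cellsD [OF assms(2)] cospanD [OF assms(1)] by (auto simp: cospan_def)

lemma app_hom:
  assumes "cospan a b" "\<Phi> \<in> hom_cells a' [hom X a b] b'"
    "y \<in> Tight X" "tcod X y = tdom X b" "\<chi> \<in> hom_cells a ps (b \<cdot> y)"
  shows "app a b \<Phi> y \<chi> \<in> hom_cells a' ps (b' \<cdot> y)"
  unfolding app_def
  using hom_cells_gcomp [OF assms(2), of _ y ps] chain_cells_single [OF hlift_hom(1) [OF assms(1,3-5)]]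
    hom_opD [OF assms(1,2)] by simp

lemma app_ccomp:
  assumes "cospan a b" "\<Phi> \<in> hom_cells a' [hom X a b] b'"
    "y \<in> Tight X" "tcod X y = tdom X b" "\<chi> \<in> hom_cells a ps (b \<cdot> y)"
    "chain_cells (tid X (tdom X a)) \<xi>s k ps rs"
  shows "ccomp X (app a b \<Phi> y \<chi>) (tid X (tdom X a)) \<xi>s =
    app a b \<Phi> (y \<cdot> k) (ccomp X \<chi> (tid X (tdom X a)) \<xi>s)"
proof -
  let ?I = "tid X (tdom X a)"
  have I: "?I \<in> Tight X" "tcod X ?I = tdom X a" "tdom X ?I = tdom X a" "?I \<cdot> ?I = ?I"
    using cospanD [OF assms(1)] by simp_all
  show ?thesis
    unfolding app_def hlift_ccomp [OF assms(1,3-6), symmetric]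
    using ccomp_assoc_single [OF assms(2) [unfolded hom_cells_def] hlift_hom(1) [OF assms(1,3-5)] assms(6)] I
    by simp
qed

lemma hlift_hcart:
  assumes "cospan a b"
  shows "hlift X a b (tid X (tdom X a)) (tid X (tdom X b)) (hcart X a b) = cid X (hom X a b)"
proof -
  note c = cospanD [OF assms]
  have "cid X (hom X a b) \<in> cells (tid X (tdom X a)) [hom X a b] (hom X a b) (tid X (tdom X b))"
    using cid_cells [of "hom X a b"] c by simp
  moreover have "ccomp X (hcart X a b) (tid X (tdom X a)) [cid X (hom X a b)] = hcart X a b"
    using ccomp_cid_single hcart(2) [OF c] by blast
  ultimately show ?thesis
    using hlift_eqI [OF c] by blast
qed

text \<open>The Yoneda principle for \<open>app\<close>: an operation is recovered from its value at
  the universal arrow \<open>hcart X a b\<close>.\<close>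

lemma app_hcart:
  assumes "cospan a b" "\<Phi> \<in> hom_cells a' [hom X a b] b'"
  shows "app a b \<Phi> (tid X (tdom X b)) (hcart X a b) = \<Phi>"
  unfolding app_def hlift_hcart [OF assms(1)]
  using ccomp_cid_single [OF assms(2) [unfolded hom_cells_def]] hom_opD [OF assms] by simp

text \<open>Compatibility with the right action comes for free: by the universal property of the
  loose-identity it suffices to compare both sides after inserting a unit.\<close>

lemma app_mul:
  assumes "cospan a b" "\<Phi> \<in> hom_cells a' [hom X a b] b'"
    "\<chi> \<in> hom_cells a ps (b \<cdot> y)" "\<beta> \<in> hom_cells y qs z" "tcod X y = tdom X b"
  shows "app a b \<Phi> z (\<chi> \<star> hact b \<beta>) = app a b \<Phi> y \<chi> \<star> hact b' \<beta>"
proof -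
  note c = cospanD [OF assms(1)] and o = hom_opD [OF assms(1,2)]
  note e = hom_cellsD [OF assms(4)] and c' = cospanD [OF o(1)]
  let ?B = "tdom X b" and ?H = "hom X a b" and ?K = "hcart X a b"
  let ?J = "cid X (lid X ?B)" and ?I = "tid X ?B" and ?L = "lid X ?B" and ?i = "lunit X ?B"
  let ?IA = "tid X (tdom X a)"
  have B: "?B \<in> Ob X" using c by simp
  have t: "?I \<in> Tight X" "tdom X ?I = ?B" "tcod X ?I = ?B" "?I \<cdot> ?I = ?I" using B by simp_all
  have tA: "?IA \<in> Tight X" "tdom X ?IA = tdom X a" "tcod X ?IA = tdom X a" using c by simp_all
  have bI: "b \<cdot> ?I = b" "b' \<cdot> ?I = b'" "a' \<cdot> ?IA = a'" using c c' o by simp_all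
  have J: "?J \<in> hom_cells ?I [?L] ?I" by (rule cid_lid_hom [OF B])
  have K: "?K \<in> hom_cells a [?H] b" by (rule hcart_hom [OF assms(1)])
  have bJ: "hact b ?J \<in> hom_cells b [?L] b" using hact_hom [OF J c(2)] t bI by simp
  have b'J: "hact b' ?J \<in> hom_cells b' [?L] b'" using hact_hom [OF J c'(2)] t bI o by simp
  have KJ: "?K \<star> hact b ?J \<in> hom_cells a [?H, ?L] (b \<cdot> ?I)" using mul_hom [OF K bJ] bI by simp
  have H: "?i \<in> hom_cells ?I [] ?I" using hone_hom [OF t(1)] hone_tid [OF B] by simp
  have ci: "chain_cells ?I [?i] ?I [?L] []" using hom_cells_chain [OF H] t by simp
  have cH: "chain_cells ?IA [cid X ?H] ?I [?H] [?H]"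
    using chain_cells_cid [of "tdom X a" "[?H]" ?B] c by simp
  have Ji: "ccomp X ?J ?I [?i] = hone ?I" using cid_lid_ccomp [OF H] t hone_tid [OF B] by simp
  have bJi: "ccomp X (hact b ?J) ?I [?i] = hone b"
    using hact_ccomp [OF J c(2) _ ci] Ji hact_hone [OF t(1) c(2)] t bI by simp
  have b'Ji: "ccomp X (hact b' ?J) ?I [?i] = hone b'"
    using hact_ccomp [OF J c'(2) _ ci] Ji hact_hone [OF t(1) c'(2)] t bI o by simp
  have KH: "ccomp X ?K ?IA [cid X ?H] = ?K"
    using ccomp_cid_single [OF K [unfolded hom_cells_def]] by simp
  have \<Phi>H: "ccomp X \<Phi> ?IA [cid X ?H] = \<Phi>"
    using ccomp_cid_single [OF assms(2) [unfolded hom_cells_def]] o by simp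
  have "ccomp X (?K \<star> hact b ?J) ?IA ([cid X ?H] @ [?i]) = ?K"
    using mul_ccomp [OF K bJ cH ci tA(3)] bJi KH mul_hone_right [OF K] by simp
  then have 1: "ccomp X (app a b \<Phi> ?I (?K \<star> hact b ?J)) ?IA ([cid X ?H] @ [?i]) = \<Phi>"
    using app_ccomp [OF assms(1,2) t(1,3) KJ, of "[cid X ?H] @ [?i]" ?I] chain_cells_append [OF cH ci]
      app_hcart [OF assms(1,2)] t by simp
  have 2: "ccomp X (\<Phi> \<star> hact b' ?J) ?IA ([cid X ?H] @ [?i]) = \<Phi>"
    using mul_ccomp [OF assms(2) b'J cH ci] b'Ji \<Phi>H mul_hone_right [OF assms(2)] tA o by simp
  \<comment> \<open>The universal case: \<open>?K\<close> is the universal arrow from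
    \<open>a\<close> to \<open>b\<close> and \<open>?J\<close> the generic arrow on the domain of
    \<open>b\<close>. The loose-identity stands to the right of \<open>?H\<close>, so the unit is
    cancelled behind a nonempty prefix.\<close>
  have eq: "app a b \<Phi> ?I (?K \<star> hact b ?J) = \<Phi> \<star> hact b' ?J"
    using lunit_cancel [OF B, of _ a' "[?H]" "[]" "lid X (tcod X a')" b'] 1 2 o bI
      app_hom [OF assms(1,2) t(1,3) KJ] mul_hom [OF assms(2) b'J]
    by (simp add: hom_cells_def)
  note h = hlift_hom [OF assms(1) e(1) assms(5) assms(3)]
  have c1: "chain_cells ?IA [hlift X a b ?IA y \<chi>] y [?H] ps"
    by (rule chain_cells_single [OF h(1)])
  have c2: "chain_cells y [\<beta>] z [?L] qs" using hom_cells_chain [OF assms(4)] assms(5) by simp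
  have x: "ccomp X ?J y [\<beta>] = \<beta>" using cid_lid_ccomp [OF assms(4)] assms(5) by simp
  have bx: "ccomp X (hact b ?J) y [\<beta>] = hact b \<beta>"
    using hact_ccomp [OF J c(2) _ c2] t assms(5) x by simp
  have b'x: "ccomp X (hact b' ?J) y [\<beta>] = hact b' \<beta>"
    using hact_ccomp [OF J c'(2) _ c2] t assms(5) x o by simp
  \<comment> \<open>The general equation is the universal one with the lift of \<chi> substituted
    for \<open>?H\<close> and \<beta> for the loose-identity.\<close>
  have "\<chi> \<star> hact b \<beta> = ccomp X (?K \<star> hact b ?J) ?IA ([hlift X a b ?IA y \<chi>] @ [\<beta>])"
    using mul_ccomp [OF K bJ c1 c2 tA(3)] bx h(2) by simp
  then have "app a b \<Phi> z (\<chi> \<star> hact b \<beta>) =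
      ccomp X (app a b \<Phi> ?I (?K \<star> hact b ?J)) ?IA ([hlift X a b ?IA y \<chi>] @ [\<beta>])"
    using app_ccomp [OF assms(1,2) t(1,3) KJ, of "[hlift X a b ?IA y \<chi>] @ [\<beta>]" z]
      chain_cells_append [OF c1 c2] e assms(5) by simp
  also have "\<dots> = app a b \<Phi> y \<chi> \<star> hact b' \<beta>"
    unfolding eq using mul_ccomp [OF assms(2) b'J c1 c2] tA o b'x app_def [of a b \<Phi> y \<chi>] by simp
  finally show ?thesis .
qed

text \<open>The inner \<open>app\<close> is the transpose of the restriction of \<Phi> along
  \<open>y\<close>. Restricting along \<open>y\<close> and then evaluating along \<open>z\<close> is
  an equality with evaluation along \<open>y \<cdot> z\<close>, with no comparison
  isomorphism.\<close>

lemma app_app_hcart: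
  assumes "cospan a b" "\<Phi> \<in> hom_cells a' [hom X a b] b'"
    "y \<in> Tight X" "tcod X y = tdom X b" "z \<in> Tight X" "tcod X z = tdom X y"
    "\<chi> \<in> hom_cells a ps (b \<cdot> y \<cdot> z)"
  shows "app a (b \<cdot> y) (app a b \<Phi> y (hcart X a (b \<cdot> y))) z \<chi> = app a b \<Phi> (y \<cdot> z) \<chi>"
proof -
  note c = cospanD [OF assms(1)]
  have co: "cospan a (b \<cdot> y)" using cospan_tcomp assms by blast
  have z: "tcod X z = tdom X (b \<cdot> y)" "(b \<cdot> y) \<cdot> z = b \<cdot> y \<cdot> z" using assms c by simp_all
  note h = hlift_hom [OF co assms(5) z(1) assms(7) [folded z(2)]]
  show ?thesis
    unfolding app_def [of a "b \<cdot> y" _ z]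
    using app_ccomp [OF assms(1-4) hcart_hom [OF co] chain_cells_single [OF h(1)]] h(2) by simp
qed

lemma app_mul_left:
  assumes "cospan a b" "\<omega> \<in> hom_cells a' [] a"
    "y \<in> Tight X" "tcod X y = tdom X b" "\<chi> \<in> hom_cells a ps (b \<cdot> y)"
  shows "app a b (\<omega> \<star> hcart X a b) y \<chi> = \<omega> \<star> \<chi>"
proof -
  let ?I = "tid X (tdom X a)"
  note h = hlift_hom [OF assms(1,3-5)]
  note d = hom_cellsD [OF assms(2)]
  have "ccomp X \<omega> ?I [] = \<omega>"
    using ccomp_map_cid [OF assms(2) [unfolded hom_cells_def]] d by simp
  then show ?thesis
    unfolding app_def
    using mul_ccomp [OF assms(2) hcart_hom [OF assms(1)] chain_cells_Nil chain_cells_single [OF h(1)]]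
      h(2) d cospanD [OF assms(1)] by simp
qed

text \<open>The operation of \<open>E(a,\<omega>)\<close> is postcomposition with \<omega>. Along a
  general right tight-cell \<open>y\<close> the factor would be \<omega> precomposed with
  \<open>y\<close>, hence the identity here.\<close>

lemma app_mul_right:
  assumes "cospan a b" "\<omega> \<in> hom_cells b [] b'" "\<chi> \<in> hom_cells a ps b"
  shows "app a b (hcart X a b \<star> \<omega>) (tid X (tdom X b)) \<chi> = \<chi> \<star> \<omega>"
proof -
  let ?I = "tid X (tdom X a)"
  note c = cospanD [OF assms(1)]
  have "\<chi> \<in> hom_cells a ps (b \<cdot> tid X (tdom X b))" using assms(3) c by simp
  note h = hlift_hom [OF assms(1) _ _ this]
  note d = hom_cellsD [OF assms(2)]
  have "ccomp X \<omega> (tid X (tdom X b)) [] = \<omega>"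
    using ccomp_map_cid [OF assms(2) [unfolded hom_cells_def]] by simp
  then show ?thesis
    unfolding app_def
    using mul_ccomp [OF hcart_hom [OF assms(1)] assms(2) chain_cells_single [OF h(1)] chain_cells_Nil]
      h(2) d c by simp
qed

lemma app_hact:
  assumes "cospan a b" "c \<in> Tight X" "tdom X c = tcod X a"
    "y \<in> Tight X" "tcod X y = tdom X b" "\<chi> \<in> hom_cells a ps (b \<cdot> y)"
  shows "app a b (hact c (hcart X a b)) y \<chi> = hact c \<chi>"
proof -
  note h = hlift_hom [OF assms(1,4-6)]
  show ?thesis
    unfolding app_def
    using hact_ccomp [OF hcart_hom [OF assms(1)] assms(2,3) chain_cells_single [OF h(1)]]
      h(2) cospanD [OF assms(1)] by simp
qed

section \<open>Transposition of globular 2-cells into arrows, and the transposes of the canonical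
  2-cells\<close>

definition htransp :: "'b \<Rightarrow> 'b \<Rightarrow> 'd \<Rightarrow> 'd" where
  "htransp f g \<phi> = ccomp X (hcart X f g) (tid X (tdom X f)) [\<phi>]"

lemma globular_hom:
  "cospan f g \<Longrightarrow>
    globular X ps (hom X f g) = cells (tid X (tdom X f)) ps (hom X f g) (tid X (tdom X g))"
  using cospanD by (simp add: globular_cells)

lemma htransp_hom:
  assumes "cospan f g" "\<phi> \<in> globular X ps (hom X f g)"
  shows "htransp f g \<phi> \<in> hom_cells f ps g"
  unfolding htransp_def
  using hom_cells_gcomp [OF hcart_hom [OF assms(1)]
      chain_cells_single [OF assms(2) [unfolded globular_hom [OF assms(1)]]]]
    cospanD [OF assms(1)] by simp

lemma hlift_transp:
  assumes "cospan f g" "\<phi> \<in> globular X ps (hom X f g)"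
  shows "hlift X f g (tid X (tdom X f)) (tid X (tdom X g)) (htransp f g \<phi>) = \<phi>"
  using hlift_eqI [OF cospanD [OF assms(1)]] assms(2) globular_hom [OF assms(1)] htransp_def by auto

lemma htransp_inj:
  assumes "cospan f g" "\<phi> \<in> globular X ps (hom X f g)" "\<psi> \<in> globular X qs (hom X f g)"
    "htransp f g \<phi> = htransp f g \<psi>"
  shows "\<phi> = \<psi>"
  using hlift_transp assms by metis

lemma htransp_hlift:
  assumes "cospan f g" "\<chi> \<in> hom_cells f ps g"
  shows "hlift X f g (tid X (tdom X f)) (tid X (tdom X g)) \<chi> \<in> globular X ps (hom X f g)"
    and "htransp f g (hlift X f g (tid X (tdom X f)) (tid X (tdom X g)) \<chi>) = \<chi>"
proof -
  note c = cospanD [OF assms(1)]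
  have \<chi>: "\<chi> \<in> hom_cells f ps (g \<cdot> tid X (tdom X g))" using assms(2) c by simp
  have t: "tid X (tdom X g) \<in> Tight X" "tcod X (tid X (tdom X g)) = tdom X g" using c by simp_all
  show "hlift X f g (tid X (tdom X f)) (tid X (tdom X g)) \<chi> \<in> globular X ps (hom X f g)"
    using hlift_hom(1) [OF assms(1) t \<chi>] globular_hom [OF assms(1)] by simp
  show "htransp f g (hlift X f g (tid X (tdom X f)) (tid X (tdom X g)) \<chi>) = \<chi>"
    unfolding htransp_def by (rule hlift_hom(2) [OF assms(1) t \<chi>])
qed

lemma htransp_cid: "cospan f g \<Longrightarrow> htransp f g (cid X (hom X f g)) = hcart X f g"
  unfolding htransp_def using ccomp_cid_single hcart_hom hom_cells_def by metis

lemma cid_globular: "cospan f g \<Longrightarrow> cid X (hom X f g) \<in> globular X [hom X f g] (hom X f g)"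
  using cid_cells [of "hom X f g"] cospanD [of f g] by (simp add: globular_cells)

lemma htransp_gcomp:
  assumes "cospan f g" "\<phi> \<in> globular X qs (hom X f g)"
    "chain_cells (tid X (tdom X f)) \<xi>s k qs rs"
  shows "htransp f g (\<phi> \<bullet> \<xi>s) = ccomp X (htransp f g \<phi>) (tid X (tdom X f)) \<xi>s"
proof -
  let ?I = "tid X (tdom X f)"
  have I: "tdom X ?I = tdom X f" "tcod X ?I = tdom X f" "?I \<cdot> ?I = ?I" using cospanD [OF assms(1)] by simp_all
  note \<phi> = assms(2) [unfolded globular_hom [OF assms(1)]]
  show ?thesis
    unfolding htransp_def gcomp_cells_eq [OF \<phi>]
    using ccomp_assoc_single [OF hcart_hom [OF assms(1), unfolded hom_cells_def] \<phi> assms(3)] I by simp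
qed

text \<open>The translation rule for composition after a unary 2-cell: it becomes application of the
  transpose. Together with \<open>smile_gcomp\<close>, \<open>frown_gcomp\<close> and
  \<open>hrestr_transp\<close> it handles the equations of monads, adjunctions and algebras; graded
  morphisms use the more general \<open>htransp_gcomp\<close>.\<close>

lemma htransp_gcomp_app:
  assumes "cospan a b" "cospan a' b'" "\<phi> \<in> globular X [hom X a b] (hom X a' b')"
    "\<psi> \<in> globular X ps (hom X a b)"
  shows "\<phi> \<bullet> [\<psi>] \<in> globular X ps (hom X a' b')"
    and "htransp a' b' (\<phi> \<bullet> [\<psi>]) = app a b (htransp a' b' \<phi>) (tid X (tdom X b)) (htransp a b \<psi>)"
proof -
  note o = hom_opD [OF assms(1) htransp_hom [OF assms(2,3)]]
  note \<psi> = assms(4) [unfolded globular_hom [OF assms(1)]]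
  have ch: "chain_cells (tid X (tdom X a')) [\<psi>] (tid X (tdom X b')) [hom X a b] ps"
    using chain_cells_single [OF \<psi>] o by simp
  show "\<phi> \<bullet> [\<psi>] \<in> globular X ps (hom X a' b')"
    using gcomp_globular [OF assms(3)] ch cospanD [OF assms(2)] by simp
  show "htransp a' b' (\<phi> \<bullet> [\<psi>]) = app a b (htransp a' b' \<phi>) (tid X (tdom X b)) (htransp a b \<psi>)"
    unfolding htransp_gcomp [OF assms(2,3) ch] app_def hlift_transp [OF assms(1,4)] o(2) ..
qed

text \<open>As an arrow, \<smile> is the product of two universal arrows, which is why composing
  with it becomes \<open>\<star>\<close>.\<close>

lemma smile_transp:
  assumes "cospan x t" "cospan t y"
  shows "smile X t x y \<in> globular X [hom X x t, hom X t y] (hom X x y)"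
    and "htransp x y (smile X t x y) = hcart X x t \<star> hcart X t y"
proof -
  note c = cospanD [OF assms(1)] and d = cospanD [OF assms(2)]
  have xy: "cospan x y" using c d by (simp add: cospan_def)
  have m: "hcart X x t \<star> hcart X t y \<in> hom_cells x [hom X x t, hom X t y] y"
    using mul_hom [OF hcart_hom [OF assms(1)] hcart_hom [OF assms(2)]] by simp
  have s: "smile X t x y = hlift X x y (tid X (tdom X x)) (tid X (tdom X y)) (hcart X x t \<star> hcart X t y)"
    using mul_eq [OF hcart_hom [OF assms(1)]] c by (simp add: smile_def)
  show "smile X t x y \<in> globular X [hom X x t, hom X t y] (hom X x y)"
    and "htransp x y (smile X t x y) = hcart X x t \<star> hcart X t y"
    unfolding s by (rule htransp_hlift [OF xy m])+
qed

lemma smile_gcomp: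
  assumes "cospan x t" "cospan t y" "\<phi> \<in> globular X ps (hom X x t)" "\<psi> \<in> globular X qs (hom X t y)"
  shows "smile X t x y \<bullet> [\<phi>, \<psi>] \<in> globular X (ps @ qs) (hom X x y)"
    and "htransp x y (smile X t x y \<bullet> [\<phi>, \<psi>]) = htransp x t \<phi> \<star> htransp t y \<psi>"
proof -
  note c = cospanD [OF assms(1)] and d = cospanD [OF assms(2)]
  have xy: "cospan x y" using c d by (simp add: cospan_def)
  have c1: "chain_cells (tid X (tdom X x)) [\<phi>] (tid X (tdom X t)) [hom X x t] ps"
    using chain_cells_single assms(3) globular_hom [OF assms(1)] by simp
  have c2: "chain_cells (tid X (tdom X t)) [\<psi>] (tid X (tdom X y)) [hom X t y] qs"
    using chain_cells_single assms(4) globular_hom [OF assms(2)] by simp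
  have ch: "chain_cells (tid X (tdom X x)) [\<phi>, \<psi>] (tid X (tdom X y)) [hom X x t, hom X t y] (ps @ qs)"
    using chain_cells_append [OF c1 c2] by simp
  show "smile X t x y \<bullet> [\<phi>, \<psi>] \<in> globular X (ps @ qs) (hom X x y)"
    using gcomp_globular [OF smile_transp(1) [OF assms(1,2)]] ch c d by simp
  show "htransp x y (smile X t x y \<bullet> [\<phi>, \<psi>]) = htransp x t \<phi> \<star> htransp t y \<psi>"
    unfolding htransp_gcomp [OF xy smile_transp(1) [OF assms(1,2)] ch] smile_transp(2) [OF assms(1,2)]
    using mul_ccomp [OF hcart_hom [OF assms(1)] hcart_hom [OF assms(2)] c1 c2] c
    by (simp add: htransp_def)
qed

lemma frown_transp:
  assumes "cospan x y" "c \<in> Tight X" "tdom X c = tcod X x"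
  shows "frown X c x y \<in> globular X [hom X x y] (hom X (c \<cdot> x) (c \<cdot> y))"
    and "htransp (c \<cdot> x) (c \<cdot> y) (frown X c x y) = hact c (hcart X x y)"
proof -
  note d = cospanD [OF assms(1)]
  have co: "cospan (c \<cdot> x) (c \<cdot> y)" using d assms by (simp add: cospan_def)
  note m = hact_hom [OF hcart_hom [OF assms(1)] assms(2,3)]
  have s: "frown X c x y =
      hlift X (c \<cdot> x) (c \<cdot> y) (tid X (tdom X (c \<cdot> x))) (tid X (tdom X (c \<cdot> y))) (hact c (hcart X x y))"
    using hact_eq [OF hcart_hom [OF assms(1)]] d assms by (simp add: frown_def)
  show "frown X c x y \<in> globular X [hom X x y] (hom X (c \<cdot> x) (c \<cdot> y))"
    and "htransp (c \<cdot> x) (c \<cdot> y) (frown X c x y) = hact c (hcart X x y)"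
    unfolding s by (rule htransp_hlift [OF co m])+
qed

lemma frown_gcomp:
  assumes "cospan x y" "c \<in> Tight X" "tdom X c = tcod X x" "\<sigma> \<in> globular X ps (hom X x y)"
  shows "frown X c x y \<bullet> [\<sigma>] \<in> globular X ps (hom X (c \<cdot> x) (c \<cdot> y))"
    and "htransp (c \<cdot> x) (c \<cdot> y) (frown X c x y \<bullet> [\<sigma>]) = hact c (htransp x y \<sigma>)"
proof -
  note d = cospanD [OF assms(1)]
  have co: "cospan (c \<cdot> x) (c \<cdot> y)" using d assms by (simp add: cospan_def)
  note g = htransp_gcomp_app [OF assms(1) co frown_transp(1) [OF assms(1-3)] assms(4)]
  show "frown X c x y \<bullet> [\<sigma>] \<in> globular X ps (hom X (c \<cdot> x) (c \<cdot> y))" by (rule g)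
  show "htransp (c \<cdot> x) (c \<cdot> y) (frown X c x y \<bullet> [\<sigma>]) = hact c (htransp x y \<sigma>)"
    using g(2) frown_transp(2) [OF assms(1-3)] app_hact [OF assms(1-3), of "tid X (tdom X y)"] d
      htransp_hom [OF assms(1,4)] by simp
qed

lemma tight2_id_transp:
  assumes "f \<in> Tight X"
  shows "tight2_id X f \<in> globular X [] (hom X f f)" and "htransp f f (tight2_id X f) = hone f"
proof -
  have co: "cospan f f" using assms by (simp add: cospan_def)
  show "tight2_id X f \<in> globular X [] (hom X f f)" and "htransp f f (tight2_id X f) = hone f"
    unfolding tight2_id_def using htransp_hlift [OF co hone_hom [OF assms]] by (simp_all add: hone_def)
qed

text \<open>\<open>A\<close> is kept apart from \<open>tdom X a\<close> because
  \<open>sharp_at\<close> restricts along the identity on the domain of \<open>j\<close>, while its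
  \<open>a\<close> is the left adjoint.\<close>

lemma hrestr_transp:
  assumes "cospan a b" "cospan a' b'" "\<phi> \<in> globular X [hom X a b] (hom X a' b')"
    "y \<in> Tight X" "tcod X y = tdom X b" "A = tdom X a"
  shows "hrestr X a b a' b' \<phi> (tid X A) y \<in> globular X [hom X a (b \<cdot> y)] (hom X a' (b' \<cdot> y))"
    and "htransp a' (b' \<cdot> y) (hrestr X a b a' b' \<phi> (tid X A) y) =
      app a b (htransp a' b' \<phi>) y (hcart X a (b \<cdot> y))"
proof -
  note c = cospanD [OF assms(1)] and d = cospanD [OF assms(2)]
  note \<Phi> = htransp_hom [OF assms(2,3)]
  note o = hom_opD [OF assms(1) \<Phi>]
  have co: "cospan a (b \<cdot> y)" using cospan_tcomp assms by blast
  have co': "cospan a' (b' \<cdot> y)" using cospan_tcomp assms o by auto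
  note h = hlift_hom [OF assms(1,4,5) hcart_hom [OF co]]
  note m = app_hom [OF assms(1) \<Phi> assms(4,5) hcart_hom [OF co]]
  let ?I = "tid X (tdom X a)"
  have I: "?I \<in> Tight X" "tdom X ?I = tdom X a" "tcod X ?I = tdom X a" "?I \<cdot> ?I = ?I" using c by simp_all
  have "ccomp X (hcart X a' b') ?I [ccomp X \<phi> ?I [hlift X a b ?I y (hcart X a (b \<cdot> y))]] =
      app a b (htransp a' b' \<phi>) y (hcart X a (b \<cdot> y))"
    unfolding app_def htransp_def
    using ccomp_assoc_single [OF hcart_hom [OF assms(2), unfolded hom_cells_def]
        assms(3) [unfolded globular_hom [OF assms(2)]], of ?I _ y] chain_cells_single [OF h(1)] o I
    by simp
  then have s: "hrestr X a b a' b' \<phi> (tid X A) y =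
      hlift X a' (b' \<cdot> y) (tid X (tdom X a')) (tid X (tdom X (b' \<cdot> y)))
        (app a b (htransp a' b' \<phi>) y (hcart X a (b \<cdot> y)))"
    unfolding hrestr_def using assms(4-6) c d o by simp
  show "hrestr X a b a' b' \<phi> (tid X A) y \<in> globular X [hom X a (b \<cdot> y)] (hom X a' (b' \<cdot> y))"
    and "htransp a' (b' \<cdot> y) (hrestr X a b a' b' \<phi> (tid X A) y) =
      app a b (htransp a' b' \<phi>) y (hcart X a (b \<cdot> y))"
    unfolding s by (rule htransp_hlift [OF co' m])+
qed

lemma hom_pre_transp:
  assumes "cospan f f'" "cospan f' g" "\<sigma> \<in> globular X [] (hom X f f')"
  shows "hom_pre X f f' \<sigma> g \<in> globular X [hom X f' g] (hom X f g)"
    and "htransp f g (hom_pre X f f' \<sigma> g) = htransp f f' \<sigma> \<star> hcart X f' g"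
  unfolding hom_pre_def
  using smile_gcomp [OF assms(1,2,3) cid_globular [OF assms(2)]] htransp_cid [OF assms(2)] by simp_all

lemma hom_post_transp:
  assumes "cospan g f" "cospan f f'" "\<sigma> \<in> globular X [] (hom X f f')"
  shows "hom_post X g f f' \<sigma> \<in> globular X [hom X g f] (hom X g f')"
    and "htransp g f' (hom_post X g f f' \<sigma>) = hcart X g f \<star> htransp f f' \<sigma>"
  unfolding hom_post_def
  using smile_gcomp [OF assms(1,2) cid_globular [OF assms(1)] assms(3)] htransp_cid [OF assms(1)] by simp_all

text \<open>Evaluation is composition with the lift of \<chi>, so by associativity whatever is done
  to \<Phi> afterwards can be done to its values. The same reason underlies
  \<open>app_hact_comm\<close> and \<open>app_mul_comm_left\<close>.\<close>

lemma app_app: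
  assumes "cospan a b" "\<Phi> \<in> hom_cells a' [hom X a b] b'" "\<Psi> \<in> hom_cells a'' [hom X a' b'] b''"
    "y \<in> Tight X" "tcod X y = tdom X b" "\<chi> \<in> hom_cells a ps (b \<cdot> y)"
  shows "app a' b' \<Psi> y (app a b \<Phi> y \<chi>) = app a b (app a' b' \<Psi> (tid X (tdom X b)) \<Phi>) y \<chi>"
proof -
  note o = hom_opD [OF assms(1,2)]
  note h = hlift_hom [OF assms(1,4-6)]
  have "\<Phi> \<in> hom_cells a' [hom X a b] (b' \<cdot> tid X (tdom X b))"
    using assms(2) o cospanD [OF o(1)] by simp
  then show ?thesis
    unfolding app_def [of a b]
    using app_ccomp [OF o(1) assms(3), of "tid X (tdom X b)" \<Phi> "[hom X a b]" _ y ps]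
      chain_cells_single [OF h(1)] o cospanD [OF assms(1)] assms(4,5) by simp
qed

lemma app_hact_comm:
  assumes "cospan a b" "\<Phi> \<in> hom_cells a' [hom X a b] b'" "c \<in> Tight X" "tdom X c = tcod X a'"
    "y \<in> Tight X" "tcod X y = tdom X b" "\<chi> \<in> hom_cells a ps (b \<cdot> y)"
  shows "app a b (hact c \<Phi>) y \<chi> = hact c (app a b \<Phi> y \<chi>)"
  unfolding app_def
  using hact_ccomp [OF assms(2-4) chain_cells_single [OF hlift_hom(1) [OF assms(1,5-7)]]]
    hom_opD [OF assms(1,2)] cospanD [OF assms(1)] by simp

lemma app_mul_comm_left:
  assumes "cospan a b" "\<Phi> \<in> hom_cells a' [hom X a b] b'" "\<omega> \<in> hom_cells a'' [] a'"
    "y \<in> Tight X" "tcod X y = tdom X b" "\<chi> \<in> hom_cells a ps (b \<cdot> y)"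
  shows "app a b (\<omega> \<star> \<Phi>) y \<chi> = \<omega> \<star> app a b \<Phi> y \<chi>"
proof -
  note h = hlift_hom [OF assms(1,4-6)] and o = hom_opD [OF assms(1,2)]
  note d = hom_cellsD [OF assms(3)]
  have "ccomp X \<omega> (tid X (tdom X a)) [] = \<omega>"
    using ccomp_map_cid [OF assms(3) [unfolded hom_cells_def]] d o by simp
  then show ?thesis
    unfolding app_def
    using mul_ccomp [OF assms(3,2) chain_cells_Nil chain_cells_single [OF h(1)]]
      d o cospanD [OF assms(1)] by simp
qed

lemma app_self:
  assumes "cospan a b" "y \<in> Tight X" "tcod X y = tdom X b" "\<chi> \<in> hom_cells a ps (b \<cdot> y)"
  shows "app a b (hcart X a b) y \<chi> = \<chi>"
  unfolding app_def using hlift_hom(2) [OF assms] .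

section \<open>Algebras and adjunctions in transposed form\<close>

text \<open>\<open>D\<close>, \<open>N\<close> and \<open>B\<close> are the transposes of \<open>\<dagger>\<close>, \<open>\<eta>\<close> and \<open>\<rtimes>\<close>.\<close>

definition hom_alg :: "'b \<Rightarrow> 'b \<Rightarrow> 'd \<Rightarrow> 'd \<Rightarrow> 'b \<Rightarrow> 'd \<Rightarrow> bool" where
  "hom_alg j t D N e B \<longleftrightarrow> cospan j t \<and> tdom X t = tdom X j \<and>
     D \<in> hom_cells t [hom X j t] t \<and> N \<in> hom_cells j [] t \<and>
     cospan j e \<and> B \<in> hom_cells t [hom X j e] e \<and>
     N \<star> B = hcart X j e \<and>
     D \<star> B = app j e B (tid X (tdom X e)) (hcart X j t \<star> B)"

lemma hom_algD:
  assumes "hom_alg j t D N e B"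
  shows "cospan j t" "tdom X t = tdom X j" "D \<in> hom_cells t [hom X j t] t" "N \<in> hom_cells j [] t"
    "cospan j e" "B \<in> hom_cells t [hom X j e] e"
  using assms by (auto simp: hom_alg_def)

lemma hom_alg_unit:
  assumes "hom_alg j t D N e B" "y \<in> Tight X" "tcod X y = tdom X e" "\<chi> \<in> hom_cells j ps (e \<cdot> y)"
  shows "N \<star> app j e B y \<chi> = \<chi>"
proof -
  note a = hom_algD [OF assms(1)]
  have "N \<star> app j e B y \<chi> = app j e (N \<star> B) y \<chi>"
    using app_mul_comm_left [OF a(5,6,4) assms(2-4)] by simp
  also have "N \<star> B = hcart X j e" using assms(1) by (simp add: hom_alg_def)
  finally show ?thesis using app_self [OF a(5) assms(2-4)] by simp
qed

text \<open>The algebra law concerns universal arrows only; substituting the lifts of \<chi> and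
  \<psi> extends it to all arrows. \<chi> ends exactly at \<open>t\<close>, since it is composed
  with an arrow out of \<open>t\<close>.\<close>

lemma hom_alg_mult:
  assumes "hom_alg j t D N e B" "\<chi> \<in> hom_cells j ps t"
    "z \<in> Tight X" "tcod X z = tdom X e" "\<psi> \<in> hom_cells j qs (e \<cdot> z)"
  shows "app j t D (tid X (tdom X t)) \<chi> \<star> app j e B z \<psi> = app j e B z (\<chi> \<star> app j e B z \<psi>)"
proof -
  note a = hom_algD [OF assms(1)]
  note c = cospanD [OF a(1)] and e = cospanD [OF a(5)]
  let ?I = "tid X (tdom X j)" and ?Ie = "tid X (tdom X e)"
  have I: "?I \<in> Tight X" "tdom X ?I = tdom X j" "tcod X ?I = tdom X j" using c by simp_all
  have Ie: "?Ie \<in> Tight X" "tdom X ?Ie = tdom X e" "tcod X ?Ie = tdom X e" "e \<cdot> ?Ie = e" using e by simp_all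
  have \<chi>: "\<chi> \<in> hom_cells j ps (t \<cdot> ?I)" using assms(2) c a(2) by simp
  have 1: "chain_cells ?I [hlift X j t ?I ?I \<chi>] ?I [hom X j t] ps"
    using chain_cells_single [OF hlift_hom(1) [OF a(1) _ _ \<chi>]] a(2) I by simp
  have 2: "chain_cells ?I [hlift X j e ?I z \<psi>] z [hom X j e] qs"
    using chain_cells_single [OF hlift_hom(1) [OF a(5) assms(3-5)]] by simp
  have K: "hcart X j t \<star> B \<in> hom_cells j [hom X j t, hom X j e] (e \<cdot> ?Ie)"
    using mul_hom [OF hcart_hom [OF a(1)] a(6)] Ie by simp
  have "app j t D (tid X (tdom X t)) \<chi> \<star> app j e B z \<psi> =
      ccomp X (D \<star> B) ?I ([hlift X j t ?I ?I \<chi>] @ [hlift X j e ?I z \<psi>])"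
    using mul_ccomp [OF a(3,6) 1 2] a(2) I by (simp add: app_def)
  also have "D \<star> B = app j e B ?Ie (hcart X j t \<star> B)"
    using assms(1) by (simp add: hom_alg_def)
  also have "ccomp X \<dots> ?I ([hlift X j t ?I ?I \<chi>] @ [hlift X j e ?I z \<psi>]) =
      app j e B z (ccomp X (hcart X j t \<star> B) ?I ([hlift X j t ?I ?I \<chi>] @ [hlift X j e ?I z \<psi>]))"
    using app_ccomp [OF a(5,6) Ie(1,3) K] chain_cells_append [OF 1 2] assms(3,4) by simp
  also have "ccomp X (hcart X j t \<star> B) ?I ([hlift X j t ?I ?I \<chi>] @ [hlift X j e ?I z \<psi>]) = \<chi> \<star> app j e B z \<psi>"
    using mul_ccomp [OF hcart_hom [OF a(1)] a(6) 1 2 I(3)] hlift_hom(2) [OF a(1) _ _ \<chi>] a(2) I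
    by (simp add: app_def)
  finally show ?thesis .
qed

text \<open>The laws on arrows hold along every right tight-cell, so evaluating them along
  \<open>y\<close> at the universal arrow from \<open>j\<close> to \<open>e \<cdot> y\<close> gives
  the laws of the restricted algebra.\<close>

lemma hom_alg_restrict:
  assumes "hom_alg j t D N e B" "y \<in> Tight X" "tcod X y = tdom X e"
  shows "hom_alg j t D N (e \<cdot> y) (app j e B y (hcart X j (e \<cdot> y)))"
proof -
  note a = hom_algD [OF assms(1)]
  note e = cospanD [OF a(5)]
  have co: "cospan j (e \<cdot> y)" using cospan_tcomp [OF a(5) assms(2,3)] .
  note K = hcart_hom [OF co]
  let ?B = "app j e B y (hcart X j (e \<cdot> y))"
  have B: "?B \<in> hom_cells t [hom X j (e \<cdot> y)] (e \<cdot> y)"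
    by (rule app_hom [OF a(5,6) assms(2,3) K])
  have KB: "hcart X j t \<star> ?B \<in> hom_cells j ([hom X j t] @ [hom X j (e \<cdot> y)]) (e \<cdot> y)"
    by (rule mul_hom [OF hcart_hom [OF a(1)] B])
  have "D \<star> ?B = app j e B y (hcart X j t \<star> ?B)"
    using hom_alg_mult [OF assms(1) hcart_hom [OF a(1)] assms(2,3) K] app_hcart [OF a(1,3)] by simp
  also have "\<dots> = app j (e \<cdot> y) ?B (tid X (tdom X (e \<cdot> y))) (hcart X j t \<star> ?B)"
    using app_app_hcart [OF a(5,6) assms(2,3), of "tid X (tdom X y)"] KB assms(2,3) e by simp
  finally show ?thesis
    unfolding hom_alg_def using a co B hom_alg_unit [OF assms(1-3) K] by simp
qed

end

section \<open>Relative adjunctions on arrows and their induced monads\<close>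

locale hom_adjunction = virtual_equipment +
  fixes j l r :: 'b and S F :: 'd
  assumes jr: "cospan j r"
    and l: "l \<in> Tight X" "tdom X l = tdom X j" "tcod X l = tdom X r"
    and S: "S \<in> hom_cells j [hom X l (tid X (tdom X r))] r"
    and F: "F \<in> hom_cells l [hom X j r] (tid X (tdom X r))"
    and FS: "app j r F (tid X (tdom X r)) S = hcart X l (tid X (tdom X r))"
    and SF: "app l (tid X (tdom X r)) S (tid X (tdom X r)) F = hcart X j r"
begin

abbreviation "I \<equiv> tid X (tdom X r)"

lemma I: "I \<in> Tight X" "tdom X I = tdom X r" "tcod X I = tdom X r"
  using cospanD [OF jr] by simp_all

lemma lI: "cospan l I"
  using l I by (simp add: cospan_def)

lemma j: "j \<in> Tight X"
  and r: "r \<in> Tight X" "tcod X r = tcod X j"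
  using cospanD [OF jr] by simp_all

text \<open>The transposed unit and extension operator of the induced monad.\<close>

definition N where "N = app l I S l (hone l)"
definition D where "D = hact r (app j r F l (hcart X j (r \<cdot> l)))"

lemma S_app_hom: "\<chi> \<in> hom_cells l ps y \<Longrightarrow> app l I S y \<chi> \<in> hom_cells j ps (r \<cdot> y)"
  using app_hom [OF lI S] hom_cellsD [of \<chi> l ps y] l I by simp

lemma F_app_hom:
  assumes "y \<in> Tight X" "tcod X y = tdom X r" "\<chi> \<in> hom_cells j ps (r \<cdot> y)"
  shows "app j r F y \<chi> \<in> hom_cells l ps y"
  using app_hom [OF jr F assms] assms by simp

lemma SF_at:
  assumes "y \<in> Tight X" "tcod X y = tdom X r" "\<chi> \<in> hom_cells j ps (r \<cdot> y)"
  shows "app l I S y (app j r F y \<chi>) = \<chi>"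
  using app_app [OF jr F S assms] SF app_self [OF jr assms] by simp

lemma FS_at:
  assumes "\<chi> \<in> hom_cells l ps y"
  shows "app j r F y (app l I S y \<chi>) = \<chi>"
proof -
  note d = hom_cellsD [OF assms]
  have y: "y \<in> Tight X" "tcod X y = tdom X I" "\<chi> \<in> hom_cells l ps (I \<cdot> y)"
    using d assms l I by simp_all
  show ?thesis
    using app_app [OF lI S F y] FS app_self [OF lI y] I by simp
qed

lemma S_mul:
  assumes "\<chi> \<in> hom_cells l ps y" "\<beta> \<in> hom_cells y qs z"
  shows "app l I S z (\<chi> \<star> \<beta>) = app l I S y \<chi> \<star> hact r \<beta>"
proof -
  note d = hom_cellsD [OF assms(1)]
  have y: "\<chi> \<in> hom_cells l ps (I \<cdot> y)" "tcod X y = tdom X I" using d assms l I by simp_all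
  have "hact I \<beta> = \<beta>" using hact_tid [OF assms(2)] d l by simp
  then show ?thesis
    using app_mul [OF lI S y(1) assms(2) y(2)] by simp
qed

lemma F_mul:
  assumes "\<chi> \<in> hom_cells j ps (r \<cdot> y)" "\<beta> \<in> hom_cells y qs z" "tcod X y = tdom X r"
  shows "app j r F z (\<chi> \<star> hact r \<beta>) = app j r F y \<chi> \<star> \<beta>"
  using app_mul [OF jr F assms] hact_tid [OF assms(2)] assms(3) by simp

lemma N: "N \<in> hom_cells j [] (r \<cdot> l)"
  unfolding N_def by (rule S_app_hom [OF hone_hom [OF l(1)]])

lemma j_rl: "cospan j (r \<cdot> l)"
  using cospan_tcomp [OF jr l(1,3)] .

lemma D: "D \<in> hom_cells (r \<cdot> l) [hom X j (r \<cdot> l)] (r \<cdot> l)"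
  unfolding D_def
  using hact_hom [OF F_app_hom [OF l(1,3) hcart_hom [OF j_rl]] r(1)] l by simp

text \<open>Naturality of \<sharp> at the identity arrow of \<open>l\<close>: the unit determines
  \<sharp>.\<close>

lemma S_eq:
  assumes "\<chi> \<in> hom_cells l ps y"
  shows "app l I S y \<chi> = N \<star> hact r \<chi>"
  using S_mul [OF hone_hom [OF l(1)] assms] mul_hone_left [OF assms] by (simp add: N_def)

text \<open>On arrows, the induced extension operator sends \<chi> to \<open>r\<close> applied to
  \<flat>\<chi>, because evaluation commutes with \<open>hact r\<close>.\<close>

lemma D_app:
  assumes "y \<in> Tight X" "tcod X y = tdom X l" "\<chi> \<in> hom_cells j ps (r \<cdot> l \<cdot> y)"
  shows "app j (r \<cdot> l) D y \<chi> = hact r (app j r F (l \<cdot> y) \<chi>)"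
proof -
  note h = app_hom [OF jr F l(1,3) hcart_hom [OF j_rl]]
  have y: "tcod X y = tdom X (r \<cdot> l)" "\<chi> \<in> hom_cells j ps ((r \<cdot> l) \<cdot> y)"
    using assms l r by simp_all
  have "app j (r \<cdot> l) D y \<chi> = hact r (app j (r \<cdot> l) (app j r F l (hcart X j (r \<cdot> l))) y \<chi>)"
    unfolding D_def by (rule app_hact_comm [OF j_rl h r(1) _ assms(1) y]) (use l in simp)
  then show ?thesis
    using app_app_hcart [OF jr F l(1,3) assms] by simp
qed

lemma D_app_tid:
  assumes "\<chi> \<in> hom_cells j ps (r \<cdot> l)"
  shows "app j (r \<cdot> l) D (tid X (tdom X l)) \<chi> = hact r (app j r F l \<chi>)"
proof -
  have "tid X (tdom X l) \<in> Tight X" "tcod X (tid X (tdom X l)) = tdom X l" "l \<cdot> tid X (tdom X l) = l"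
    using tdom_Ob [OF l(1)] l(1) by simp_all
  then show ?thesis
    using D_app [of "tid X (tdom X l)" \<chi> ps] assms by simp
qed

lemma hact_F: "hact r F \<in> hom_cells (r \<cdot> l) [hom X j r] r"
  using hact_hom [OF F r(1)] l I r by simp

lemma alg_along_app:
  assumes "\<tau> \<in> hom_cells t' [] (r \<cdot> l)" "y \<in> Tight X" "tcod X y = tdom X r" "\<chi> \<in> hom_cells j ps (r \<cdot> y)"
  shows "app j r (\<tau> \<star> hact r F) y \<chi> = \<tau> \<star> hact r (app j r F y \<chi>)"
  using app_mul_comm_left [OF jr hact_F assms] app_hact_comm [OF jr F r(1) _ assms(2-4)] l by simp

text \<open>The unit law reduces to \<open>unit\<close> and the fact that \<sharp> undoes \<flat>.
  For the other law, \<open>ext\<close> moves \<open>D'\<close> past \<tau>, after which naturality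
  of \<flat> collects everything under a single \<flat>. It is used for a monad morphism \<tau>, and
  with \<tau> an identity to obtain the laws of the induced monad.\<close>

lemma alg_along:
  assumes "cospan j t'" "tdom X t' = tdom X j" "D' \<in> hom_cells t' [hom X j t'] t'" "N' \<in> hom_cells j [] t'"
    and \<tau>: "\<tau> \<in> hom_cells t' [] (r \<cdot> l)" and unit: "N' \<star> \<tau> = N"
    and ext: "D' \<star> \<tau> = \<tau> \<star> app j (r \<cdot> l) D (tid X (tdom X l)) (hcart X j t' \<star> \<tau>)"
  shows "hom_alg j t' D' N' r (\<tau> \<star> hact r F)"
proof -
  let ?X = "hcart X j t' \<star> \<tau>"
  have B: "\<tau> \<star> hact r F \<in> hom_cells t' [hom X j r] r"
    using mul_hom [OF \<tau> hact_F] by simp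
  have "N' \<star> (\<tau> \<star> hact r F) = N \<star> hact r F"
    using mul_assoc [OF assms(4) \<tau> hact_F] unit by simp
  also have "\<dots> = hcart X j r" using S_eq [OF F] SF by simp
  finally have 1: "N' \<star> (\<tau> \<star> hact r F) = hcart X j r" .
  have X: "?X \<in> hom_cells j [hom X j t'] (r \<cdot> l)"
    using mul_hom [OF hcart_hom [OF assms(1)] \<tau>] by simp
  note FX = F_app_hom [OF l(1,3) X]
  have rFX: "hact r (app j r F l ?X) \<in> hom_cells (r \<cdot> l) [hom X j t'] (r \<cdot> l)"
    using hact_hom [OF FX r(1)] l by simp
  have "D' \<star> (\<tau> \<star> hact r F) = (D' \<star> \<tau>) \<star> hact r F"
    using mul_assoc [OF assms(3) \<tau> hact_F] by simp
  also have "\<dots> = (\<tau> \<star> hact r (app j r F l ?X)) \<star> hact r F"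
    unfolding ext D_app_tid [OF X] ..
  also have "\<dots> = \<tau> \<star> (hact r (app j r F l ?X) \<star> hact r F)"
    by (rule mul_assoc [OF \<tau> rFX hact_F])
  also have "hact r (app j r F l ?X) \<star> hact r F = hact r (app j r F l ?X \<star> F)"
    using hact_mul [OF FX F r(1)] l by simp
  \<comment> \<open>Naturality of \<flat> is what reassembles the two applications of \<flat> into
    one.\<close>
  also have "app j r F l ?X \<star> F = app j r F I (?X \<star> hact r F)"
    using F_mul [OF X F l(3)] by simp
  also have "?X \<star> hact r F = hcart X j t' \<star> (\<tau> \<star> hact r F)"
    by (rule mul_assoc [OF hcart_hom [OF assms(1)] \<tau> hact_F])
  also have "\<tau> \<star> hact r (app j r F I (hcart X j t' \<star> (\<tau> \<star> hact r F))) =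
      app j r (\<tau> \<star> hact r F) I (hcart X j t' \<star> (\<tau> \<star> hact r F))"
    using alg_along_app [OF \<tau> I(1,3)] mul_hom [OF hcart_hom [OF assms(1)] B] r by simp
  finally show ?thesis
    unfolding hom_alg_def using assms(1-4) jr B 1 by simp
qed

text \<open>With \<tau> the identity, \<open>alg_along\<close> makes \<open>r\<close> an algebra for
  the induced data. Restricting it along \<open>l\<close> yields the algebra on
  \<open>r \<cdot> l\<close> with action \<open>D\<close>, so associativity of the induced monad is
  a special case of an algebra law.\<close>

lemma induced_hom_alg: "hom_alg j (r \<cdot> l) D N (r \<cdot> l) D"
  and induced_unit: "app j (r \<cdot> l) D (tid X (tdom X l)) N = hone (r \<cdot> l)"
proof -
  have rl: "r \<cdot> l \<in> Tight X" "tdom X (r \<cdot> l) = tdom X j" using l r by simp_all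
  note h = hone_hom [OF rl(1)]
  have "D \<star> hone (r \<cdot> l) = hone (r \<cdot> l) \<star> app j (r \<cdot> l) D (tid X (tdom X l)) (hcart X j (r \<cdot> l) \<star> hone (r \<cdot> l))"
    using mul_hone_right [OF D] mul_hone_right [OF hcart_hom [OF j_rl]] app_hcart [OF j_rl D]
      mul_hone_left [OF D] rl l by simp
  from alg_along [OF j_rl rl(2) D N h mul_hone_right [OF N] this]
  have "hom_alg j (r \<cdot> l) D N r (hact r F)"
    using mul_hone_left [OF hact_F] by simp
  from hom_alg_restrict [OF this l(1,3)]
  show "hom_alg j (r \<cdot> l) D N (r \<cdot> l) D"
    using app_hact_comm [OF jr F r(1) _ l(1,3) hcart_hom [OF j_rl]] l by (simp add: D_def)
  show "app j (r \<cdot> l) D (tid X (tdom X l)) N = hone (r \<cdot> l)"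
    unfolding D_app_tid [OF N]
    using FS_at [OF hone_hom [OF l(1)]] hact_hone [OF l(1) r(1)] l by (simp add: N_def)
qed

end

section \<open>The relative adjunction given by an algebra object\<close>

text \<open>\<open>lift\<close> and \<open>faithful\<close> are condition (2) on algebra objects after the Yoneda-style
  reduction of a graded morphism \<open>E(1,e), ps \<Rightarrow> E(1,e')\<close> to a cell \<open>ps \<Rightarrow> E(e,e')\<close>.\<close>

locale hom_algebra_object = virtual_equipment +
  fixes j t :: 'b and D N :: 'd and v :: 'b and B :: 'd
  assumes monad: "hom_alg j t D N t D" "app j t D (tid X (tdom X t)) N = hone t"
    and alg: "hom_alg j t D N v B"
    and lift: "\<lbrakk>d \<in> Tight X; tcod X d = tdom X v; d' \<in> Tight X; tcod X d' = tdom X v;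
      \<epsilon> \<in> hom_cells (v \<cdot> d) ps (v \<cdot> d');
      app j v B d (hcart X j (v \<cdot> d)) \<star> \<epsilon> = app j v B d' (hcart X j (v \<cdot> d) \<star> \<epsilon>)\<rbrakk>
      \<Longrightarrow> \<exists>\<psi> \<in> hom_cells d ps d'. hact v \<psi> = \<epsilon>"
    and faithful: "\<lbrakk>tcod X d = tdom X v; \<psi> \<in> hom_cells d ps d'; \<psi>' \<in> hom_cells d ps d';
      hact v \<psi> = hact v \<psi>'\<rbrakk> \<Longrightarrow> \<psi> = \<psi>'"
    and mediate: "hom_alg j t D N e Be
      \<Longrightarrow> \<exists>!d. d \<in> Tight X \<and> tcod X d = tdom X v \<and> v \<cdot> d = e \<and> app j v B d (hcart X j e) = Be"
begin

abbreviation "V \<equiv> tid X (tdom X v)"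

definition f where
  "f = (THE d. d \<in> Tight X \<and> tcod X d = tdom X v \<and> v \<cdot> d = t \<and> app j v B d (hcart X j t) = D)"

lemma f: "f \<in> Tight X" "tcod X f = tdom X v" "v \<cdot> f = t" "app j v B f (hcart X j t) = D"
  using theI' [OF mediate [OF monad(1)]] unfolding f_def by auto

lemma f_eqI:
  "\<lbrakk>d \<in> Tight X; tcod X d = tdom X v; v \<cdot> d = t; app j v B d (hcart X j t) = D\<rbrakk> \<Longrightarrow> d = f"
  using mediate [OF monad(1)] f by blast

lemmas jt = hom_algD(1) [OF alg] and tdom_t = hom_algD(2) [OF alg] and D = hom_algD(3) [OF alg]
  and N = hom_algD(4) [OF alg] and jv = hom_algD(5) [OF alg] and B = hom_algD(6) [OF alg]

lemma v: "v \<in> Tight X" "tcod X v = tcod X j"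
  and j: "j \<in> Tight X"
  and t: "t \<in> Tight X" "tcod X t = tcod X j"
  using cospanD [OF jv] cospanD [OF jt] by auto

lemma V: "V \<in> Tight X" "tdom X V = tdom X v" "tcod X V = tdom X v"
  using v by simp_all

lemma tdom_f: "tdom X f = tdom X j"
  using f v tdom_t by (metis tcomp_simps(2))

lemma fV: "cospan f V"
  using f V by (simp add: cospan_def)

text \<open>By naturality in \<beta> it suffices to take the identity arrow of \<open>f\<close>,
  where the action is the extension operator and the claim is the monad law that extending the unit
  gives the identity. This is the injectivity behind \<open>FS\<close> and the rigidity behind
  \<open>left_mor_act\<close>.\<close>

lemma B_unit:
  assumes "\<beta> \<in> hom_cells f ps z"
  shows "app j v B z (N \<star> hact v \<beta>) = hact v \<beta>"
proof -
  have N': "N \<in> hom_cells j [] (v \<cdot> f)" "N \<in> hom_cells j [] (v \<cdot> f \<cdot> tid X (tdom X f))"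
    using N f by simp_all
  have "app j v B f N = app j t D (tid X (tdom X f)) N"
    using app_app_hcart [OF jv B f(1,2) _ _ N'(2)] f by simp
  also have "\<dots> = hone t" using monad(2) tdom_f tdom_t by simp
  finally have "app j v B f N = hone t" .
  moreover have "hact v \<beta> \<in> hom_cells t ps (v \<cdot> z)"
    using hact_hom [OF assms v(1)] f by simp
  ultimately show ?thesis
    using app_mul [OF jv B N'(1) assms f(2)] mul_hone_left by simp
qed

text \<open>The value of \<sharp> at the universal arrow from \<open>f\<close> to the identity; by
  \<open>S_eq\<close>, no other choice is compatible with the unit \<open>N\<close>.\<close>

definition S where "S = N \<star> hact v (hcart X f V)"

lemma hact_hcart: "hact v (hcart X f V) \<in> hom_cells t [hom X f V] v"
  using hact_hom [OF hcart_hom [OF fV] v(1)] f V v by simp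

lemma S: "S \<in> hom_cells j [hom X f V] v"
  unfolding S_def using mul_hom [OF N hact_hcart] by simp

lemma S_app:
  assumes "\<chi> \<in> hom_cells f ps y"
  shows "app f V S y \<chi> = N \<star> hact v \<chi>"
proof -
  note d = hom_cellsD [OF assms]
  have y: "y \<in> Tight X" "tcod X y = tdom X V" "\<chi> \<in> hom_cells f ps (V \<cdot> y)"
    using d assms f V by simp_all
  show ?thesis
    unfolding S_def
    using app_mul_comm_left [OF fV hact_hcart N y]
      app_hact_comm [OF fV hcart_hom [OF fV] v(1) _ y] app_self [OF fV y] f by simp
qed

text \<open>The algebra law for \<open>\<rtimes>\<close> says that \<open>\<rtimes>\<close> is itself a graded morphism from the free algebra to
  the universal one; its lift is \<open>\<flat>\<close>.\<close>

lemma flat_exists: "\<exists>F \<in> hom_cells f [hom X j v] V. hact v F = B"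
proof (rule lift [OF f(1,2) V(1,3)])
  show "B \<in> hom_cells (v \<cdot> f) [hom X j v] (v \<cdot> V)"
    using B f v by simp
  show "app j v B f (hcart X j (v \<cdot> f)) \<star> B = app j v B V (hcart X j (v \<cdot> f) \<star> B)"
    using f(3,4) alg by (simp add: hom_alg_def)
qed

definition F where "F = (SOME F. F \<in> hom_cells f [hom X j v] V \<and> hact v F = B)"

lemma F: "F \<in> hom_cells f [hom X j v] V" "hact v F = B"
proof -
  have "\<exists>F. F \<in> hom_cells f [hom X j v] V \<and> hact v F = B" using flat_exists by blast
  from someI_ex [OF this] show "F \<in> hom_cells f [hom X j v] V" "hact v F = B"
    unfolding F_def by auto
qed

text \<open>Since \<open>F\<close> lifts the action, this inverse law is exactly the unit law of the
  algebra.\<close>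

lemma SF: "app f V S V F = hcart X j v"
  using S_app [OF F(1)] F(2) alg by (simp add: hom_alg_def)

lemma F_app:
  assumes "y \<in> Tight X" "tcod X y = tdom X v" "\<chi> \<in> hom_cells j ps (v \<cdot> y)"
  shows "hact v (app j v F y \<chi>) = app j v B y \<chi>"
  using app_hact_comm [OF jv F(1) v(1) _ assms] F(2) f by simp

text \<open>The other inverse law is tested after applying \<open>v\<close>, which is faithful on
  graded arrows. There \<flat> becomes the action, and \<open>B_unit\<close> applies.\<close>

lemma FS: "app j v F V S = hcart X f V"
proof (rule faithful [OF f(2)])
  have S': "S \<in> hom_cells j [hom X f V] (v \<cdot> V)" using S v by simp
  show "app j v F V S \<in> hom_cells f [hom X f V] V"
    using app_hom [OF jv F(1) V(1,3) S'] V by simp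
  show "hcart X f V \<in> hom_cells f [hom X f V] V"
    by (rule hcart_hom [OF fV])
  show "hact v (app j v F V S) = hact v (hcart X f V)"
    unfolding F_app [OF V(1,3) S'] unfolding S_def by (rule B_unit [OF hcart_hom [OF fV]])
qed

sublocale free: hom_adjunction X j f v S F
proof unfold_locales
  show "cospan j v" by (rule jv)
  show "f \<in> Tight X" "tdom X f = tdom X j" "tcod X f = tdom X v" using f tdom_f by auto
  show "S \<in> hom_cells j [hom X f V] v" by (rule S)
  show "F \<in> hom_cells f [hom X j v] V" by (rule F)
  show "app j v F V S = hcart X f V" by (rule FS)
  show "app f V S V F = hcart X j v" by (rule SF)
qed

lemma free_N: "free.N = N"
  unfolding free.N_def
  using S_app [OF hone_hom [OF f(1)]] hact_hone [OF f(1) v(1)] f mul_hone_right [OF N] by simp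

text \<open>As \<open>v\<close> sends \<open>F\<close> to the action, the induced extension operator
  is the action restricted along \<open>f\<close>, which is \<open>D\<close> by the choice of
  \<open>f\<close>.\<close>

lemma free_D: "free.D = D"
  unfolding free.D_def using F_app [OF f(1,2)] hcart_hom [OF jt] f by simp

end

section \<open>Left-morphisms into the free adjunction and monad morphisms\<close>

locale hom_algebra_object_adjunction =
  hom_algebra_object X j t D N v B + adj: hom_adjunction X j l r Sr Fr
  for X :: "('a, 'b, 'c, 'd, 'e) vdc_scheme" (structure)
    and j t :: 'b and D N :: 'd and v :: 'b and B :: 'd and l r :: 'b and Sr Fr :: 'd
begin

text \<open>\<sigma> is the transpose of the 2-cell of a left-morphism. The last conjunct stands for
  the compatibility with \<sharp> required in \<open>RAdj_L_hom\<close>;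
  \<open>left_mor_sharp\<close> shows that the two are equivalent.\<close>

definition left_mor where
  "left_mor c \<sigma> \<longleftrightarrow> c \<in> Tight X \<and> tdom X c = tdom X r \<and> tcod X c = tdom X v \<and> v \<cdot> c = r \<and>
     \<sigma> \<in> hom_cells f [] (c \<cdot> l) \<and> N \<star> hact v \<sigma> = adj.N"

definition monad_mor where
  "monad_mor \<tau> \<longleftrightarrow> \<tau> \<in> hom_cells t [] (r \<cdot> l) \<and> N \<star> \<tau> = adj.N \<and>
     D \<star> \<tau> = \<tau> \<star> app j (r \<cdot> l) adj.D (tid X (tdom X l)) (hcart X j t \<star> \<tau>)"

text \<open>Both sides are obtained by multiplying the same arrow, \<open>r\<close> applied to the
  universal arrow out of \<open>l\<close>, on the left: by \<open>adj.N\<close> in one case, by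
  \<open>N \<star> hact v \<sigma>\<close> in the other. Such a product determines its left
  factor.\<close>

lemma left_mor_sharp:
  assumes "c \<in> Tight X" "tdom X c = tdom X r" "tcod X c = tdom X v" "v \<cdot> c = r" "\<sigma> \<in> hom_cells f [] (c \<cdot> l)"
  shows "Sr = app f V S c (\<sigma> \<star> hact c (hcart X l adj.I)) \<longleftrightarrow> N \<star> hact v \<sigma> = adj.N"
proof -
  note L = hcart_hom [OF adj.lI]
  have cL: "hact c (hcart X l adj.I) \<in> hom_cells (c \<cdot> l) [hom X l adj.I] c"
    using hact_hom [OF L assms(1)] assms adj.l adj.I by simp
  have rl: "v \<cdot> c \<cdot> l = r \<cdot> l" using assms adj.l v by (metis tcomp_assoc_simp)
  have v\<sigma>: "hact v \<sigma> \<in> hom_cells t [] (r \<cdot> l)"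
    using hact_hom [OF assms(5) v(1)] f rl by simp
  have rL: "hact r (hcart X l adj.I) \<in> hom_cells (r \<cdot> l) [hom X l adj.I] r"
    using hact_hom [OF L adj.r(1)] adj.l adj.I adj.r by simp
  have "hact v (\<sigma> \<star> hact c (hcart X l adj.I)) = hact v \<sigma> \<star> hact r (hcart X l adj.I)"
    using hact_mul [OF assms(5) cL v(1)] hact_tcomp [OF L assms(1) _ v(1)] assms f adj.l by simp
  then have eq: "app f V S c (\<sigma> \<star> hact c (hcart X l adj.I)) = (N \<star> hact v \<sigma>) \<star> hact r (hcart X l adj.I)"
    using S_app [OF mul_hom [OF assms(5) cL]] mul_assoc [OF N v\<sigma> rL] by simp
  have Sr: "Sr = adj.N \<star> hact r (hcart X l adj.I)"
    using adj.S_eq [OF L] app_hcart [OF adj.lI adj.S] adj.I by simp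
  have Nv: "N \<star> hact v \<sigma> \<in> hom_cells j [] (r \<cdot> l)" using mul_hom [OF N v\<sigma>] by simp
  show ?thesis
  proof
    assume "Sr = app f V S c (\<sigma> \<star> hact c (hcart X l adj.I))"
    then have "Sr = (N \<star> hact v \<sigma>) \<star> hact r (hcart X l adj.I)" using eq by simp
    \<comment> \<open>Evaluating at the identity arrow of \<open>l\<close> recovers the left
      factor.\<close>
    then have "adj.N = app l adj.I ((N \<star> hact v \<sigma>) \<star> hact r (hcart X l adj.I)) l (hone l)"
      unfolding adj.N_def by (rule arg_cong)
    also have "\<dots> = (N \<star> hact v \<sigma>) \<star> hact r (hone l)"
      using app_mul_comm_left [OF adj.lI rL Nv adj.l(1), of "hone l" "[]"]
        app_hact_comm [OF adj.lI L adj.r(1) _ adj.l(1), of "hone l" "[]"]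
        app_self [OF adj.lI adj.l(1), of "hone l" "[]"] hone_hom [OF adj.l(1)] adj.l adj.I by simp
    also have "\<dots> = N \<star> hact v \<sigma>"
      using hact_hone [OF adj.l(1) adj.r(1)] adj.l mul_hone_right [OF Nv] by simp
    finally show "N \<star> hact v \<sigma> = adj.N" by simp
  next
    assume "N \<star> hact v \<sigma> = adj.N"
    then show "Sr = app f V S c (\<sigma> \<star> hact c (hcart X l adj.I))" using eq Sr by simp
  qed
qed

text \<open>The mediating tight-cell \<open>c\<close> of a left-morphism is forced: its algebra is determined by the
  transposed monad morphism.\<close>

lemma left_mor_act:
  assumes "left_mor c \<sigma>" "y \<in> Tight X" "tcod X y = tdom X r" "\<chi> \<in> hom_cells j ps (r \<cdot> y)"
  shows "app j v B (c \<cdot> y) \<chi> = hact v \<sigma> \<star> hact r (app j r Fr y \<chi>)"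
proof -
  have c: "c \<in> Tight X" "tdom X c = tdom X r" "tcod X c = tdom X v" "v \<cdot> c = r"
    and \<sigma>: "\<sigma> \<in> hom_cells f [] (c \<cdot> l)" and N\<sigma>: "N \<star> hact v \<sigma> = adj.N"
    using assms(1) by (auto simp: left_mor_def)
  note F\<chi> = adj.F_app_hom [OF assms(2-4)]
  have rl: "v \<cdot> c \<cdot> l = r \<cdot> l" using c adj.l v by (metis tcomp_assoc_simp)
  have v\<sigma>: "hact v \<sigma> \<in> hom_cells t [] (r \<cdot> l)"
    using hact_hom [OF \<sigma> v(1)] f rl by simp
  have cF: "hact c (app j r Fr y \<chi>) \<in> hom_cells (c \<cdot> l) ps (c \<cdot> y)"
    using hact_hom [OF F\<chi> c(1)] c adj.l by simp
  have rF: "hact r (app j r Fr y \<chi>) \<in> hom_cells (r \<cdot> l) ps (r \<cdot> y)"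
    using hact_hom [OF F\<chi> adj.r(1)] adj.l by simp
  have \<xi>: "hact v (\<sigma> \<star> hact c (app j r Fr y \<chi>)) = hact v \<sigma> \<star> hact r (app j r Fr y \<chi>)"
    using hact_mul [OF \<sigma> cF v(1)] hact_tcomp [OF F\<chi> c(1) _ v(1)] c f adj.l by simp
  have "N \<star> (hact v \<sigma> \<star> hact r (app j r Fr y \<chi>)) = adj.N \<star> hact r (app j r Fr y \<chi>)"
    using mul_assoc [OF N v\<sigma> rF] N\<sigma> by simp
  also have "\<dots> = \<chi>"
    using adj.S_eq [OF F\<chi>] adj.SF_at [OF assms(2-4)] by simp
  \<comment> \<open>This presents \<chi> as the unit followed by \<open>v\<close> of an arrow out of
    \<open>f\<close>, and on such arrows \<open>B_unit\<close> computes the action.\<close>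
  finally have "N \<star> hact v (\<sigma> \<star> hact c (app j r Fr y \<chi>)) = \<chi>" using \<xi> by simp
  then show ?thesis
    using B_unit [OF mul_hom [OF \<sigma> cF]] \<xi> by simp
qed

text \<open>\<open>D\<close> is the action restricted along \<open>f\<close>, so naturality carries
  \<open>hact v \<sigma>\<close> inside the action, now taken along \<open>c \<cdot> l\<close>.
  There \<open>left_mor_act\<close> rewrites it with \<flat>, which gives the induced extension
  operator.\<close>

lemma left_mor_monad_mor:
  assumes "left_mor c \<sigma>"
  shows "monad_mor (hact v \<sigma>)"
proof -
  have c: "c \<in> Tight X" "tdom X c = tdom X r" "tcod X c = tdom X v" "v \<cdot> c = r"
    and \<sigma>: "\<sigma> \<in> hom_cells f [] (c \<cdot> l)" and N\<sigma>: "N \<star> hact v \<sigma> = adj.N"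
    using assms by (auto simp: left_mor_def)
  have rl: "v \<cdot> c \<cdot> l = r \<cdot> l" using c adj.l v by (metis tcomp_assoc_simp)
  have v\<sigma>: "hact v \<sigma> \<in> hom_cells t [] (r \<cdot> l)"
    using hact_hom [OF \<sigma> v(1)] f rl by simp
  have X: "hcart X j t \<star> hact v \<sigma> \<in> hom_cells j [hom X j t] (r \<cdot> l)"
    using mul_hom [OF hcart_hom [OF jt] v\<sigma>] by simp
  have "D \<star> hact v \<sigma> = app j v B (c \<cdot> l) (hcart X j t \<star> hact v \<sigma>)"
    using app_mul [OF jv B, of "hcart X j t" "[hom X j t]" f \<sigma>] hcart_hom [OF jt] \<sigma> f by simp
  also have "\<dots> = hact v \<sigma> \<star> hact r (app j r Fr l (hcart X j t \<star> hact v \<sigma>))"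
    by (rule left_mor_act [OF assms adj.l(1,3) X])
  also have "hact r (app j r Fr l (hcart X j t \<star> hact v \<sigma>)) =
      app j (r \<cdot> l) adj.D (tid X (tdom X l)) (hcart X j t \<star> hact v \<sigma>)"
    by (rule adj.D_app_tid [OF X, symmetric])
  finally show ?thesis
    unfolding monad_mor_def using v\<sigma> N\<sigma> by simp
qed

lemma monad_mor_alg:
  assumes "monad_mor \<tau>"
  shows "hom_alg j t D N r (\<tau> \<star> hact r Fr)"
  using adj.alg_along [OF jt tdom_t D N] assms by (simp add: monad_mor_def)

text \<open>\<open>c\<close> mediates the algebra that \<tau> puts on \<open>r\<close>. In terms of
  this algebra the extension equation of \<tau> says precisely that \<tau>, as an arrow from
  \<open>v \<cdot> f\<close> to \<open>v \<cdot> c \<cdot> l\<close>, is compatible with the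
  actions, so it lifts.\<close>

lemma monad_mor_left_mor:
  assumes "monad_mor \<tau>"
  obtains c \<sigma> where "left_mor c \<sigma>" "hact v \<sigma> = \<tau>"
proof -
  have \<tau>: "\<tau> \<in> hom_cells t [] (r \<cdot> l)" and N\<tau>: "N \<star> \<tau> = adj.N"
    and D\<tau>: "D \<star> \<tau> = \<tau> \<star> app j (r \<cdot> l) adj.D (tid X (tdom X l)) (hcart X j t \<star> \<tau>)"
    using assms by (auto simp: monad_mor_def)
  obtain c where c: "c \<in> Tight X" "tcod X c = tdom X v" "v \<cdot> c = r"
      and Bc: "app j v B c (hcart X j r) = \<tau> \<star> hact r Fr"
    using mediate [OF monad_mor_alg [OF assms]] by blast
  have dc: "tdom X c = tdom X r" using c v by (metis tcomp_simps(2))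
  have rl: "v \<cdot> c \<cdot> l = r \<cdot> l" using c dc adj.l v by (metis tcomp_assoc_simp)
  have X: "hcart X j t \<star> \<tau> \<in> hom_cells j [hom X j t] (r \<cdot> l)"
    using mul_hom [OF hcart_hom [OF jt] \<tau>] by simp
  have "D \<star> \<tau> = \<tau> \<star> hact r (app j r Fr l (hcart X j t \<star> \<tau>))"
    unfolding D\<tau> adj.D_app_tid [OF X] ..
  also have "\<dots> = app j r (\<tau> \<star> hact r Fr) l (hcart X j t \<star> \<tau>)"
    using adj.alg_along_app [OF \<tau> adj.l(1,3) X] by simp
  also have "\<dots> = app j v B (c \<cdot> l) (hcart X j t \<star> \<tau>)"
    using app_app_hcart [OF jv B c(1,2) adj.l(1), of "hcart X j t \<star> \<tau>" "[hom X j t]"] X rl c dc adj.l Bc by simp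
  finally have eq: "D \<star> \<tau> = app j v B (c \<cdot> l) (hcart X j t \<star> \<tau>)" .
  have "\<exists>\<sigma> \<in> hom_cells f [] (c \<cdot> l). hact v \<sigma> = \<tau>"
    by (rule lift [OF f(1,2)]) (use c dc adj.l \<tau> f rl eq in simp_all)
  then obtain \<sigma> where \<sigma>: "\<sigma> \<in> hom_cells f [] (c \<cdot> l)" "hact v \<sigma> = \<tau>" by blast
  have "left_mor c \<sigma>" unfolding left_mor_def using c dc \<sigma> N\<tau> by simp
  then show ?thesis using that \<sigma>(2) by blast
qed

text \<open>At the universal arrow, \<open>left_mor_act\<close> expresses the algebra mediated by
  \<open>c\<close> through \<open>hact v \<sigma>\<close> alone. Uniqueness of mediating tight-cells
  gives \<open>c\<close>, and faithfulness then gives \<sigma>.\<close>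

lemma left_mor_inj:
  assumes "left_mor c \<sigma>" "left_mor c' \<sigma>'" "hact v \<sigma> = hact v \<sigma>'"
  shows "c = c' \<and> \<sigma> = \<sigma>'"
proof -
  have Bc: "app j v B d (hcart X j r) = hact v \<rho> \<star> hact r Fr"
    if m: "left_mor d \<rho>" for d \<rho>
    using left_mor_act [OF m adj.I(1,3), of "hcart X j r" "[hom X j r]"] hcart_hom [OF adj.jr]
      app_hcart [OF adj.jr adj.F] m adj.r by (simp add: left_mor_def)
  have cc: "c = c'"
    using mediate [OF monad_mor_alg [OF left_mor_monad_mor [OF assms(1)]]] Bc [OF assms(1)] Bc [OF assms(2)]
      assms by (auto simp: left_mor_def)
  then show ?thesis
    using faithful [OF f(2), of \<sigma> "[]" "c \<cdot> l" \<sigma>'] assms by (auto simp: left_mor_def)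
qed

text \<open>The universal action restricted along \<open>c \<cdot> l\<close> is
  \<open>hact v \<sigma> \<star> adj.D\<close>. When \<open>hact v \<sigma>\<close> is an identity
  and the monads agree, \<open>c \<cdot> l\<close> mediates the free algebra, so it is
  \<open>f\<close>; faithfulness then identifies \<sigma>.\<close>

lemma left_mor_strict:
  assumes "left_mor c \<sigma>"
  shows "c \<cdot> l = f \<and> \<sigma> = hone f \<longleftrightarrow> r \<cdot> l = t \<and> adj.D = D \<and> adj.N = N \<and> hact v \<sigma> = hone t"
proof -
  have c: "c \<in> Tight X" "tdom X c = tdom X r" "tcod X c = tdom X v" "v \<cdot> c = r"
    and \<sigma>: "\<sigma> \<in> hom_cells f [] (c \<cdot> l)" and N\<sigma>: "N \<star> hact v \<sigma> = adj.N"
    using assms by (auto simp: left_mor_def)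
  have cl: "c \<cdot> l \<in> Tight X" "tcod X (c \<cdot> l) = tdom X v" using c adj.l by simp_all
  have rl: "v \<cdot> c \<cdot> l = r \<cdot> l" using c adj.l v by (metis tcomp_assoc_simp)
  have hf: "hact v (hone f) = hone t" using hact_hone [OF f(1) v(1)] f by simp
  have Bcl: "app j v B (c \<cdot> l) (hcart X j (r \<cdot> l)) = hact v \<sigma> \<star> adj.D"
    using left_mor_act [OF assms adj.l(1,3) hcart_hom [OF adj.j_rl]] by (simp add: adj.D_def)
  show ?thesis
  proof
    assume s: "c \<cdot> l = f \<and> \<sigma> = hone f"
    then have rlt: "r \<cdot> l = t" using rl f by simp
    moreover have "adj.N = N" using N\<sigma> s hf mul_hone_right [OF N] by simp
    moreover have "adj.D = D"
      using Bcl s hf rlt f(4) mul_hone_left [OF adj.D] by simp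
    ultimately show "r \<cdot> l = t \<and> adj.D = D \<and> adj.N = N \<and> hact v \<sigma> = hone t"
      using s hf by simp
  next
    assume s: "r \<cdot> l = t \<and> adj.D = D \<and> adj.N = N \<and> hact v \<sigma> = hone t"
    then have "c \<cdot> l = f"
      using f_eqI [OF cl] rl Bcl mul_hone_left [OF D] by simp
    then show "c \<cdot> l = f \<and> \<sigma> = hone f"
      using faithful [OF f(2), of \<sigma> "[]" f "hone f"] \<sigma> hone_hom [OF f(1)] s hf by simp
  qed
qed

end

context virtual_equipment
begin

section \<open>Translation of the definitions\<close>

text \<open>The typing part of a relative monad without its equations, so that the equations can be
  translated for data not yet known to satisfy them, such as those induced by an adjunction.\<close>

definition monad_data :: "'b \<Rightarrow> ('b, 'd) rel_monad \<Rightarrow> bool" where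
  "monad_data j T \<longleftrightarrow> cospan j (rm_tight T) \<and> tdom X (rm_tight T) = tdom X j \<and>
     rm_ext T \<in> globular X [hom X j (rm_tight T)] (hom X (rm_tight T) (rm_tight T)) \<and>
     rm_unit T \<in> globular X [] (hom X j (rm_tight T))"

abbreviation "ext_transp T \<equiv> htransp (rm_tight T) (rm_tight T) (rm_ext T)"
abbreviation "unit_transp j T \<equiv> htransp j (rm_tight T) (rm_unit T)"
abbreviation "act_transp T a \<equiv> htransp (rm_tight T) (alg_tight a) (alg_act a)"

lemma monad_dataD:
  assumes "monad_data j T"
  shows "cospan j (rm_tight T)" "cospan (rm_tight T) (rm_tight T)" "tdom X (rm_tight T) = tdom X j"
    "rm_ext T \<in> globular X [hom X j (rm_tight T)] (hom X (rm_tight T) (rm_tight T))"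
    "rm_unit T \<in> globular X [] (hom X j (rm_tight T))"
    "ext_transp T \<in> hom_cells (rm_tight T) [hom X j (rm_tight T)] (rm_tight T)"
    "unit_transp j T \<in> hom_cells j [] (rm_tight T)"
proof -
  note a = assms [unfolded monad_data_def]
  show c: "cospan j (rm_tight T)" using a by simp
  then show tt: "cospan (rm_tight T) (rm_tight T)" by (simp add: cospan_def)
  show "tdom X (rm_tight T) = tdom X j" using a by simp
  show e: "rm_ext T \<in> globular X [hom X j (rm_tight T)] (hom X (rm_tight T) (rm_tight T))" using a by simp
  show u: "rm_unit T \<in> globular X [] (hom X j (rm_tight T))" using a by simp
  show "ext_transp T \<in> hom_cells (rm_tight T) [hom X j (rm_tight T)] (rm_tight T)"
    by (rule htransp_hom [OF tt e])
  show "unit_transp j T \<in> hom_cells j [] (rm_tight T)"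
    by (rule htransp_hom [OF c u])
qed

lemma htransp_eq_iff:
  assumes "cospan f g" "\<phi> \<in> globular X ps (hom X f g)" "\<psi> \<in> globular X qs (hom X f g)"
  shows "\<phi> = \<psi> \<longleftrightarrow> htransp f g \<phi> = htransp f g \<psi>"
  using htransp_inj [OF assms] by blast

text \<open>The assumption on \<open>T\<close> is only its typing, so the translation already
  applies to the free algebra when the monad laws themselves are being translated.\<close>

lemma relative_algebra_iff:
  assumes m: "monad_data j T"
  shows "relative_algebra X j T a \<longleftrightarrow>
    alg_act a \<in> globular X [hom X j (alg_tight a)] (hom X (rm_tight T) (alg_tight a)) \<and>
    hom_alg j (rm_tight T) (ext_transp T) (unit_transp j T) (alg_tight a) (act_transp T a)"
proof -
  obtain t ext \<eta> e act where defs: "t = rm_tight T" "ext = rm_ext T" "\<eta> = rm_unit T"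
      "e = alg_tight a" "act = alg_act a"
    by blast
  note md = monad_dataD [OF m, folded defs]
  note jt = cospanD [OF md(1)]
  show ?thesis
  proof (cases "cospan j e \<and> act \<in> globular X [hom X j e] (hom X t e)")
    case False
    then show ?thesis
      using jt by (auto simp: relative_algebra_def hom_alg_def Let_def thom_iff cospan_def defs)
  next
    case True
    then have je: "cospan j e" and act: "act \<in> globular X [hom X j e] (hom X t e)" by auto
    note c = cospanD [OF je]
    have te: "cospan t e" using c jt by (simp add: cospan_def)
    note B = htransp_hom [OF te act]
    have Ie: "tid X (tdom X e) \<in> Tight X" "tcod X (tid X (tdom X e)) = tdom X e" "e \<cdot> tid X (tdom X e) = e"
      using c by simp_all
    note pre = hom_pre_transp [OF md(1) te md(5)]
    note g1 = htransp_gcomp_app [OF te je pre(1) act]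
    have 1: "hom_pre X j t \<eta> e \<bullet> [act] = cid X (hom X j e) \<longleftrightarrow> htransp j t \<eta> \<star> htransp t e act = hcart X j e"
      unfolding htransp_eq_iff [OF je g1(1) cid_globular [OF je]] htransp_cid [OF je] g1(2) pre(2)
      using app_mul_left [OF te md(7) Ie(1,2)] B Ie(3) by simp
    note s1 = smile_gcomp [OF md(2) te md(4) act]
    note s2 = smile_gcomp [OF md(1) te cid_globular [OF md(1)] act]
    note g2 = htransp_gcomp_app [OF je te act s2(1)]
    have 2: "smile X t t e \<bullet> [ext, act] = act \<bullet> [smile X t j e \<bullet> [cid X (hom X j t), act]] \<longleftrightarrow>
        htransp t t ext \<star> htransp t e act =
          app j e (htransp t e act) (tid X (tdom X e)) (hcart X j t \<star> htransp t e act)"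
      unfolding htransp_eq_iff [OF te s1(1) g2(1)] s1(2) g2(2) s2(2) htransp_cid [OF md(1)] ..
    have t: "e \<in> thom X (tdom X e) (tcod X j)"
      using c by (simp add: thom_iff)
    have "relative_algebra X j T a \<longleftrightarrow> hom_pre X j t \<eta> e \<bullet> [act] = cid X (hom X j e) \<and>
        smile X t t e \<bullet> [ext, act] = act \<bullet> [smile X t j e \<bullet> [cid X (hom X j t), act]]"
      unfolding relative_algebra_def Let_def defs [symmetric] using t act by blast
    also have "\<dots> \<longleftrightarrow> hom_alg j t (htransp t t ext) (htransp j t \<eta>) e (htransp t e act)"
      unfolding 1 2 hom_alg_def using md(1,3,6,7) je B by blast
    finally show ?thesis using act unfolding defs by blast
  qed
qed

lemma relative_monad_data: "j \<in> Tight X \<Longrightarrow> relative_monad X j T \<Longrightarrow> monad_data j T"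
  by (simp add: relative_monad_def Let_def monad_data_def cospan_def thom_iff tight2_def)

lemma relative_monad_iff:
  assumes m: "monad_data j T"
  shows "relative_monad X j T \<longleftrightarrow>
    hom_alg j (rm_tight T) (ext_transp T) (unit_transp j T) (rm_tight T) (ext_transp T) \<and>
    app j (rm_tight T) (ext_transp T) (tid X (tdom X (rm_tight T))) (unit_transp j T) = hone (rm_tight T)"
proof -
  obtain t ext \<eta> where defs: "t = rm_tight T" "ext = rm_ext T" "\<eta> = rm_unit T" by blast
  note md = monad_dataD [OF m, folded defs]
  note jt = cospanD [OF md(1)]
  have jj: "cospan j j" using jt by (simp add: cospan_def)
  \<comment> \<open>Two of the three monad laws are the algebra laws of the free algebra; only the
    law about extending the unit remains.\<close>
  have 1: "relative_monad X j T \<longleftrightarrow> relative_algebra X j T (free_alg T) \<and>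
      ext \<bullet> [hom_post X j j t \<eta> \<bullet> [tight2_id X j]] = tight2_id X t"
    using md jt
    by (auto simp: relative_monad_def relative_algebra_def free_alg_def Let_def thom_iff tight2_def defs)
  note po = hom_post_transp [OF jj md(1,5)] and ij = tight2_id_transp [OF jt(1)] and it = tight2_id_transp [OF jt(2)]
  note g1 = htransp_gcomp_app [OF jj md(1) po(1) ij(1)]
  note g2 = htransp_gcomp_app [OF md(1,2,4) g1(1)]
  have 2: "ext \<bullet> [hom_post X j j t \<eta> \<bullet> [tight2_id X j]] = tight2_id X t \<longleftrightarrow>
      app j t (htransp t t ext) (tid X (tdom X t)) (htransp j t \<eta>) = hone t"
    unfolding htransp_eq_iff [OF md(2) g2(1) it(1)] g2(2) g1(2) it(2) ij(2) po(2)
    using app_mul_right [OF jj md(7) hone_hom [OF jt(1)]] mul_hone_left [OF md(7)] by simp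
  show ?thesis
    unfolding 1 2 [unfolded defs] relative_algebra_iff [OF m] defs
    using md(4) by (simp add: free_alg_def defs)
qed

lemma RMnd_hom_iff:
  assumes m: "monad_data j T" and m1: "monad_data j T1"
  shows "\<tau> \<in> RMnd_hom X j T T1 \<longleftrightarrow> \<tau> \<in> globular X [] (hom X (rm_tight T) (rm_tight T1)) \<and>
    unit_transp j T \<star> htransp (rm_tight T) (rm_tight T1) \<tau> = unit_transp j T1 \<and>
    ext_transp T \<star> htransp (rm_tight T) (rm_tight T1) \<tau> =
      htransp (rm_tight T) (rm_tight T1) \<tau> \<star>
        app j (rm_tight T1) (ext_transp T1) (tid X (tdom X (rm_tight T1)))
          (hcart X j (rm_tight T) \<star> htransp (rm_tight T) (rm_tight T1) \<tau>)"
proof -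
  obtain t ext \<eta> where defs: "t = rm_tight T" "ext = rm_ext T" "\<eta> = rm_unit T" by blast
  obtain t1 ext1 \<eta>1 where defs1: "t1 = rm_tight T1" "ext1 = rm_ext T1" "\<eta>1 = rm_unit T1" by blast
  note md = monad_dataD [OF m, folded defs] and md1 = monad_dataD [OF m1, folded defs1]
  note jt = cospanD [OF md(1)] and jt1 = cospanD [OF md1(1)]
  have tt1: "cospan t t1" using jt jt1 by (simp add: cospan_def)
  show ?thesis
  proof (cases "\<tau> \<in> globular X [] (hom X t t1)")
    case False
    then show ?thesis by (simp add: RMnd_hom_def tight2_def Let_def defs defs1)
  next
    case True
    note \<tau> = htransp_hom [OF tt1 True]
    note s = smile_gcomp [OF md(1) tt1 md(5) True]
    have 1: "tight2_comp X j t t1 \<tau> \<eta> = \<eta>1 \<longleftrightarrow> htransp j t \<eta> \<star> htransp t t1 \<tau> = htransp j t1 \<eta>1"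
      unfolding tight2_comp_def htransp_eq_iff [OF md1(1) s(1) md1(5)] s(2) ..
    note po = hom_post_transp [OF md(2) tt1 True]
    note g1 = htransp_gcomp_app [OF md(2) tt1 po(1) md(4)]
    note po1 = hom_post_transp [OF md(1) tt1 True]
    note g2 = htransp_gcomp_app [OF md1(1,2,4) po1(1)]
    note pr = hom_pre_transp [OF tt1 md1(2) True]
    note g3 = htransp_gcomp_app [OF md1(2) tt1 pr(1) g2(1)]
    have X: "hcart X j t \<star> htransp t t1 \<tau> \<in> hom_cells j [hom X j t] (t1 \<cdot> tid X (tdom X t1))"
      using mul_hom [OF hcart_hom [OF md(1)] \<tau>] jt1 by simp
    have It: "tid X (tdom X t1) \<in> Tight X" "tcod X (tid X (tdom X t1)) = tdom X t1"
      using jt1 by simp_all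
    have 2: "hom_post X t t t1 \<tau> \<bullet> [ext] = hom_pre X t t1 \<tau> t1 \<bullet> [ext1 \<bullet> [hom_post X j t t1 \<tau>]] \<longleftrightarrow>
      htransp t t ext \<star> htransp t t1 \<tau> =
      htransp t t1 \<tau> \<star> app j t1 (htransp t1 t1 ext1) (tid X (tdom X t1)) (hcart X j t \<star> htransp t t1 \<tau>)"
      unfolding htransp_eq_iff [OF tt1 g1(1) g3(1)] g1(2) g3(2) g2(2) po(2) po1(2) pr(2)
        app_mul_right [OF md(2) \<tau> md(6)]
        app_mul_left [OF md1(2) \<tau> It app_hom [OF md1(1,6) It X]] ..
    show ?thesis
      using True 1 2 by (simp add: RMnd_hom_def tight2_def Let_def defs defs1)
  qed
qed

abbreviation "sharp_transp j R \<equiv> htransp j (radj R) (sharp R)"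
abbreviation "flat_transp R \<equiv> htransp (ladj R) (tid X (tdom X (radj R))) (flat R)"

text \<open>The typing part of a relative adjunction. Its middle object is written as the domain of
  \<open>radj R\<close>, to match \<open>hom_adjunction\<close>, rather than as the codomain of
  \<open>ladj R\<close>.\<close>

definition adj_data :: "'b \<Rightarrow> ('b, 'd) rel_adj \<Rightarrow> bool" where
  "adj_data j R \<longleftrightarrow> cospan j (radj R) \<and> ladj R \<in> Tight X \<and> tdom X (ladj R) = tdom X j \<and>
     tcod X (ladj R) = tdom X (radj R) \<and>
     sharp R \<in> globular X [hom X (ladj R) (tid X (tdom X (radj R)))] (hom X j (radj R)) \<and>
     flat R \<in> globular X [hom X j (radj R)] (hom X (ladj R) (tid X (tdom X (radj R))))"

lemma relative_adjunction_iff: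
  assumes j: "j \<in> Tight X"
  shows "relative_adjunction X j R \<longleftrightarrow> adj_data j R \<and>
    hom_adjunction X j (ladj R) (radj R) (sharp_transp j R) (flat_transp R)"
proof -
  obtain l r where defs: "l = ladj R" "r = radj R" by blast
  let ?I = "tid X (tdom X r)"
  show ?thesis
  proof (cases "adj_data j R")
    case False
    have "adj_data j R" if R: "relative_adjunction X j R"
    proof -
      note d = R [unfolded relative_adjunction_def Let_def thom_iff]
      have "tdom X (radj R) = tcod X (ladj R)" using d by simp
      then show ?thesis
        unfolding adj_data_def cospan_def using d j by simp
    qed
    then show ?thesis using False by blast
  next
    case True
    note a = True [unfolded adj_data_def, folded defs]
    have jr: "cospan j r" and l: "l \<in> Tight X" "tdom X l = tdom X j" "tcod X l = tdom X r"
      and s: "sharp R \<in> globular X [hom X l ?I] (hom X j r)"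
      and f: "flat R \<in> globular X [hom X j r] (hom X l ?I)"
      using a by auto
    note c = cospanD [OF jr]
    have lI: "cospan l ?I" using l c by (simp add: cospan_def)
    have I: "tdom X ?I = tdom X r" using c by simp
    note g1 = htransp_gcomp_app [OF jr lI f s] and g2 = htransp_gcomp_app [OF lI jr s f]
    have 1: "flat R \<bullet> [sharp R] = cid X (hom X l ?I) \<longleftrightarrow>
        app j r (htransp l ?I (flat R)) ?I (htransp j r (sharp R)) = hcart X l ?I"
      unfolding htransp_eq_iff [OF lI g1(1) cid_globular [OF lI]] g1(2) htransp_cid [OF lI] ..
    have 2: "sharp R \<bullet> [flat R] = cid X (hom X j r) \<longleftrightarrow>
        app l ?I (htransp j r (sharp R)) ?I (htransp l ?I (flat R)) = hcart X j r"
      unfolding htransp_eq_iff [OF jr g2(1) cid_globular [OF jr]] g2(2) htransp_cid [OF jr] I ..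
    have "relative_adjunction X j R \<longleftrightarrow> flat R \<bullet> [sharp R] = cid X (hom X l ?I) \<and>
        sharp R \<bullet> [flat R] = cid X (hom X j r)"
      unfolding relative_adjunction_def Let_def thom_iff defs [symmetric] l(3)
      using l c s f by simp
    also have "\<dots> \<longleftrightarrow> hom_adjunction X j l r (htransp j r (sharp R)) (htransp l ?I (flat R))"
      unfolding 1 2 hom_adjunction_def hom_adjunction_axioms_def
      using jr l htransp_hom [OF jr s] htransp_hom [OF lI f] virtual_equipment_axioms by blast
    finally show ?thesis using True unfolding defs by blast
  qed
qed

lemma adj_dataD:
  assumes "adj_data j R"
  shows "cospan j (radj R)" "cospan (ladj R) (tid X (tdom X (radj R)))"
    "ladj R \<in> Tight X" "tdom X (ladj R) = tdom X j" "tcod X (ladj R) = tdom X (radj R)"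
    "sharp R \<in> globular X [hom X (ladj R) (tid X (tdom X (radj R)))] (hom X j (radj R))"
    "flat R \<in> globular X [hom X j (radj R)] (hom X (ladj R) (tid X (tdom X (radj R))))"
  using assms by (auto simp: adj_data_def cospan_def)

lemma sharp_at_transp:
  assumes "adj_data j R" "y \<in> Tight X" "tcod X y = tdom X (radj R)"
  shows "sharp_at X j R y \<in> globular X [hom X (ladj R) y] (hom X j (radj R \<cdot> y))"
    and "htransp j (radj R \<cdot> y) (sharp_at X j R y) =
      app (ladj R) (tid X (tdom X (radj R))) (sharp_transp j R) y (hcart X (ladj R) y)"
proof -
  note a = adj_dataD [OF assms(1)]
  have y: "tcod X y = tdom X (tid X (tdom X (radj R)))" "tdom X j = tdom X (ladj R)"
    "tid X (tdom X (radj R)) \<cdot> y = y"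
    using assms a cospanD [OF a(1)] by simp_all
  note h = hrestr_transp [OF a(2,1,6) assms(2) y(1,2), unfolded y(3)]
  show "sharp_at X j R y \<in> globular X [hom X (ladj R) y] (hom X j (radj R \<cdot> y))"
    and "htransp j (radj R \<cdot> y) (sharp_at X j R y) =
      app (ladj R) (tid X (tdom X (radj R))) (sharp_transp j R) y (hcart X (ladj R) y)"
    using h a(5) by (simp_all add: sharp_at_def)
qed

lemma flat_at_transp:
  assumes "adj_data j R" "y \<in> Tight X" "tcod X y = tdom X (radj R)"
  shows "flat_at X j R y \<in> globular X [hom X j (radj R \<cdot> y)] (hom X (ladj R) y)"
    and "htransp (ladj R) y (flat_at X j R y) =
      app j (radj R) (flat_transp R) y (hcart X j (radj R \<cdot> y))"
proof -
  note a = adj_dataD [OF assms(1)]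
  have y: "tid X (tdom X (radj R)) \<cdot> y = y"
    using assms a cospanD [OF a(1)] by simp_all
  note h = hrestr_transp [OF a(1,2,7) assms(2,3) refl, unfolded y]
  show "flat_at X j R y \<in> globular X [hom X j (radj R \<cdot> y)] (hom X (ladj R) y)"
    and "htransp (ladj R) y (flat_at X j R y) =
      app j (radj R) (flat_transp R) y (hcart X j (radj R \<cdot> y))"
    using h a(5) by (simp_all add: flat_at_def)
qed

lemma induced_monad_data:
  assumes "adj_data j R" "hom_adjunction X j (ladj R) (radj R) (sharp_transp j R) (flat_transp R)"
  shows "monad_data j (induced_monad X j R)"
    and "unit_transp j (induced_monad X j R) = hom_adjunction.N X (ladj R) (radj R) (sharp_transp j R)"
    and "ext_transp (induced_monad X j R) = hom_adjunction.D X j (ladj R) (radj R) (flat_transp R)"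
proof -
  interpret hom_adjunction X j "ladj R" "radj R" "sharp_transp j R" "flat_transp R" by fact
  note a = adj_dataD [OF assms(1)]
  note sa = sharp_at_transp [OF assms(1) a(3,5)] and fa = flat_at_transp [OF assms(1) a(3,5)]
  have ll: "cospan (ladj R) (ladj R)" using a by (simp add: cospan_def)
  note iu = tight2_id_transp [OF a(3)]
  note g = htransp_gcomp_app [OF ll j_rl sa(1) iu(1)]
  have u: "adj_unit X j R \<in> globular X [] (hom X j (radj R \<cdot> ladj R))"
    using g(1) by (simp add: adj_unit_def)
  have "htransp j (radj R \<cdot> ladj R) (adj_unit X j R) =
      app (ladj R) (ladj R) (app (ladj R) I (sharp_transp j R) (ladj R) (hcart X (ladj R) (ladj R)))
        (tid X (tdom X (ladj R))) (hone (ladj R))"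
    using g(2) sa(2) iu(2) by (simp add: adj_unit_def)
  also have "\<dots> = app (ladj R) I (sharp_transp j R) (ladj R) (hone (ladj R))"
    using app_app_hcart [OF lI S a(3), of "tid X (tdom X (ladj R))" "hone (ladj R)" "[]"]
      hone_hom [OF a(3)] tdom_Ob [OF a(3)] a(3,5) I by simp
  finally have N: "htransp j (radj R \<cdot> ladj R) (adj_unit X j R) = N" by (simp add: N_def)
  have rl: "tdom X (radj R) = tcod X (ladj R)" using a by simp
  note fr = frown_gcomp [OF ll r(1) rl fa(1)]
  show "monad_data j (induced_monad X j R)"
    unfolding monad_data_def induced_monad_def using j_rl u fr(1) a r by simp
  show "unit_transp j (induced_monad X j R) = N"
    using N by (simp add: induced_monad_def)
  show "ext_transp (induced_monad X j R) = D"
    using fr(2) fa(2) by (simp add: induced_monad_def D_def)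
qed

lemma RAdj_L_hom_iff:
  assumes "adj_data j R" "adj_data j R'"
  shows "(c, \<sigma>) \<in> RAdj_L_hom X j R R' \<longleftrightarrow> c \<in> thom X (tdom X (radj R)) (tdom X (radj R')) \<and>
    \<sigma> \<in> globular X [] (hom X (ladj R') (c \<cdot> ladj R)) \<and> radj R = radj R' \<cdot> c \<and>
    sharp_transp j R = app (ladj R') (tid X (tdom X (radj R'))) (sharp_transp j R') c
      (htransp (ladj R') (c \<cdot> ladj R) \<sigma> \<star> hact c (hcart X (ladj R) (tid X (tdom X (radj R)))))"
proof -
  note a = adj_dataD [OF assms(1)] and a' = adj_dataD [OF assms(2)]
  let ?l = "ladj R" and ?l' = "ladj R'" and ?r = "radj R" and ?r' = "radj R'"
  let ?I = "tid X (tdom X (radj R))" and ?I' = "tid X (tdom X (radj R'))"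
  show ?thesis
  proof (cases "c \<in> thom X (tdom X ?r) (tdom X ?r') \<and> \<sigma> \<in> globular X [] (hom X ?l' (c \<cdot> ?l)) \<and> ?r = ?r' \<cdot> c")
    case False
    then show ?thesis using a a' by (auto simp: RAdj_L_hom_def Let_def tight2_def)
  next
    case True
    then have c: "c \<in> Tight X" "tdom X c = tdom X ?r" "tcod X c = tdom X ?r'"
      and \<sigma>: "\<sigma> \<in> globular X [] (hom X ?l' (c \<cdot> ?l))" and r: "?r = ?r' \<cdot> c"
      by (auto simp: thom_iff)
    note C = cospanD [OF a(1)] and C' = cospanD [OF a'(1)]
    have co: "cospan ?l' (c \<cdot> ?l)" "cospan (c \<cdot> ?l) c" "cospan ?l' c"
      using a a' c by (simp_all add: cospan_def)
    have cI: "c \<cdot> ?I = c" using c C by simp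
    have tI: "tdom X c = tcod X ?l" using c a by simp
    note fr = frown_transp [OF a(2) c(1) tI, unfolded cI]
    note pr = hom_pre_transp [OF co(1,2) \<sigma>]
    note g1 = htransp_gcomp_app [OF co(2,3) pr(1) fr(1)]
    note sa = sharp_at_transp [OF assms(2) c(1,3)]
    note g2 = htransp_gcomp_app [OF co(3) a(1) [unfolded r] sa(1) g1(1)]
    have dc: "tid X (tdom X c) \<in> Tight X" "tcod X (tid X (tdom X c)) = tdom X c"
      "c \<cdot> tid X (tdom X c) = c" using c C by simp_all
    have hc: "hact c (hcart X ?l ?I) \<in> hom_cells (c \<cdot> ?l) [hom X ?l ?I] c"
      using hact_hom [OF hcart_hom [OF a(2)] c(1) tI] cI by simp
    note \<Sigma> = htransp_hom [OF co(1) \<sigma>]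
    have m: "htransp ?l' (c \<cdot> ?l) \<sigma> \<star> hact c (hcart X ?l ?I) \<in> hom_cells ?l' [hom X ?l ?I] c"
      using mul_hom [OF \<Sigma> hc] by simp
    have 1: "htransp ?l' c (hom_pre X ?l' (c \<cdot> ?l) \<sigma> c \<bullet> [frown X c ?l ?I]) =
        htransp ?l' (c \<cdot> ?l) \<sigma> \<star> hact c (hcart X ?l ?I)"
      unfolding g1(2) pr(2) fr(2) using app_mul_left [OF co(2) \<Sigma> dc(1,2)] hc dc(3) by simp
    have cI': "?I' \<cdot> c = c" "tcod X c = tdom X ?I'" using c C' by simp_all
    have "app ?l' c (app ?l' ?I' (sharp_transp j R') c (hcart X ?l' c)) (tid X (tdom X c))
          (htransp ?l' (c \<cdot> ?l) \<sigma> \<star> hact c (hcart X ?l ?I)) =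
        app ?l' ?I' (sharp_transp j R') c (htransp ?l' (c \<cdot> ?l) \<sigma> \<star> hact c (hcart X ?l ?I))"
      using app_app_hcart [OF a'(2) htransp_hom [OF a'(1,6)] c(1) cI'(2) dc(1,2)] m cI'(1) dc(3) by simp
    then have 2: "htransp j ?r (sharp_at X j R' c \<bullet> [hom_pre X ?l' (c \<cdot> ?l) \<sigma> c \<bullet> [frown X c ?l ?I]]) =
        app ?l' ?I' (sharp_transp j R') c (htransp ?l' (c \<cdot> ?l) \<sigma> \<star> hact c (hcart X ?l ?I))"
      using g2(2) 1 sa(2) r by simp
    have "(c, \<sigma>) \<in> RAdj_L_hom X j R R' \<longleftrightarrow>
        sharp R = sharp_at X j R' c \<bullet> [hom_pre X ?l' (c \<cdot> ?l) \<sigma> c \<bullet> [frown X c ?l ?I]]"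
      unfolding RAdj_L_hom_def Let_def tight2_def a(5) a'(5) mem_Collect_eq case_prod_conv
      using True by blast
    also have "\<dots> \<longleftrightarrow> sharp_transp j R = htransp j ?r (sharp_at X j R' c \<bullet> [hom_pre X ?l' (c \<cdot> ?l) \<sigma> c \<bullet> [frown X c ?l ?I]])"
      by (rule htransp_eq_iff [OF a(1) a(6) g2(1) [folded r]])
    finally show ?thesis unfolding 2 using True by blast
  qed
qed

lemma mediating_iff:
  assumes m: "monad_data j T" and u: "relative_algebra X j T u" and a: "relative_algebra X j T a"
  shows "mediating X j T u a d \<longleftrightarrow> d \<in> Tight X \<and> tcod X d = tdom X (alg_tight u) \<and>
    alg_tight u \<cdot> d = alg_tight a \<and>
    app j (alg_tight u) (act_transp T u) d (hcart X j (alg_tight a)) = act_transp T a"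
proof -
  let ?t = "rm_tight T" and ?v = "alg_tight u"
  note md = monad_dataD [OF m]
  have uact: "alg_act u \<in> globular X [hom X j ?v] (hom X ?t ?v)"
    and ju: "cospan j ?v"
    using u [unfolded relative_algebra_iff [OF m]] hom_algD by auto
  have aact: "alg_act a \<in> globular X [hom X j (alg_tight a)] (hom X ?t (alg_tight a))"
    and ja: "cospan j (alg_tight a)"
    using a [unfolded relative_algebra_iff [OF m]] hom_algD by auto
  have tu: "cospan ?t ?v" "cospan ?t (alg_tight a)"
    using md(1) ju ja by (simp_all add: cospan_def)
  note v = cospanD [OF ju]
  show ?thesis
  proof (cases "d \<in> Tight X \<and> tcod X d = tdom X ?v \<and> ?v \<cdot> d = alg_tight a")
    case False
    then show ?thesis by (auto simp: mediating_def thom_iff alg_precomp_def)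
  next
    case True
    then have d: "d \<in> Tight X" "tcod X d = tdom X ?v" "?v \<cdot> d = alg_tight a" by auto
    note h = hrestr_transp [OF ju tu(1) uact d(1,2) refl, unfolded d(3)]
    have "mediating X j T u a d \<longleftrightarrow> hrestr X j ?v ?t ?v (alg_act u) (tid X (tdom X j)) d = alg_act a"
      using d v tcomp_simps(2) [OF d(1) v(2) d(2)]
      by (cases a) (auto simp: mediating_def alg_precomp_def thom_iff)
    also have "\<dots> \<longleftrightarrow> app j ?v (act_transp T u) d (hcart X j (alg_tight a)) = act_transp T a"
      unfolding htransp_eq_iff [OF tu(2) h(1) aact] h(2) ..
    finally show ?thesis using d by simp
  qed
qed

text \<open>Condition (2) speaks of algebras together with mediating tight-cells. Restricting the
  universal algebra along an arbitrary \<open>d\<close> supplies both, so the condition becomes one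
  about tight-cells into the algebra object.\<close>

lemma alg_precomp_algebra:
  assumes m: "monad_data j T" and u: "relative_algebra X j T u"
    and d: "d \<in> Tight X" "tcod X d = tdom X (alg_tight u)"
  shows "relative_algebra X j T (alg_precomp X j T u d)"
    and "act_transp T (alg_precomp X j T u d) =
      app j (alg_tight u) (act_transp T u) d (hcart X j (alg_tight u \<cdot> d))"
    and "mediating X j T u (alg_precomp X j T u d) d"
proof -
  let ?t = "rm_tight T" and ?v = "alg_tight u"
  note md = monad_dataD [OF m]
  have uact: "alg_act u \<in> globular X [hom X j ?v] (hom X ?t ?v)"
    and ju: "cospan j ?v"
    and ua: "hom_alg j (rm_tight T) (ext_transp T) (unit_transp j T) ?v (act_transp T u)"
    using u [unfolded relative_algebra_iff [OF m]] hom_algD by auto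
  have tu: "cospan ?t ?v"
    using md(1) ju by (simp add: cospan_def)
  note h = hrestr_transp [OF ju tu uact d refl]
  show 1: "act_transp T (alg_precomp X j T u d) = app j ?v (act_transp T u) d (hcart X j (?v \<cdot> d))"
    using h(2) by (simp add: alg_precomp_def)
  show "relative_algebra X j T (alg_precomp X j T u d)"
    unfolding relative_algebra_iff [OF m] 1
    using h(1) hom_alg_restrict [OF ua d] by (simp add: alg_precomp_def)
  show "mediating X j T u (alg_precomp X j T u d) d"
    using d cospanD [OF ju] by (simp add: mediating_def alg_precomp_def thom_iff)
qed

section \<open>Graded morphisms and condition (2) on arrows\<close>

lemma alg_lambda_transp:
  assumes m: "monad_data j T" and a: "relative_algebra X j T a"
  defines "i \<equiv> tid X (tcod X j)"
  shows "alg_lambda X j T a \<in> globular X [hom X i (rm_tight T), hom X j i, hom X i (alg_tight a)] (hom X i (alg_tight a))"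
    and "htransp i (alg_tight a) (alg_lambda X j T a) = hcart X i (rm_tight T) \<star>
      app j (alg_tight a) (act_transp T a) (tid X (tdom X (alg_tight a))) (hcart X j i \<star> hcart X i (alg_tight a))"
proof -
  let ?t = "rm_tight T" and ?e = "alg_tight a"
  note md = monad_dataD [OF m]
  have act: "alg_act a \<in> globular X [hom X j ?e] (hom X ?t ?e)" and je: "cospan j ?e"
    using a [unfolded relative_algebra_iff [OF m]] hom_algD by auto
  have co: "cospan i ?t" "cospan ?t ?e" "cospan j i" "cospan i ?e"
    using md(1) je by (simp_all add: cospan_def i_def)
  note s = smile_transp [OF co(3,4)]
  note g = htransp_gcomp_app [OF je co(2) act s(1)]
  note s2 = smile_gcomp [OF co(1,2) cid_globular [OF co(1)] g(1)]
  show "alg_lambda X j T a \<in> globular X [hom X i ?t, hom X j i, hom X i ?e] (hom X i ?e)"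
    using s2(1) by (simp add: alg_lambda_def Let_def i_def)
  show "htransp i ?e (alg_lambda X j T a) = hcart X i ?t \<star>
      app j ?e (act_transp T a) (tid X (tdom X ?e)) (hcart X j i \<star> hcart X i ?e)"
    using s2(2) g(2) s(2) htransp_cid [OF co(1)] by (simp add: alg_lambda_def Let_def i_def)
qed

text \<open>Precomposing a graded morphism with the unit of \<open>E(1,e)\<close> turns it into a cell
  \<open>ps \<Rightarrow> E(1,1)\<close> with left \<open>e\<close>; the lemma inverts this correspondence.\<close>

lemma graded_morphism_hlift:
  assumes m: "monad_data j T" and a: "relative_algebra X j T a" and a': "relative_algebra X j T a'"
    and \<epsilon>: "\<epsilon> \<in> hom_cells (alg_tight a) ps (alg_tight a')"
    and eq: "act_transp T a \<star> \<epsilon> =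
      app j (alg_tight a') (act_transp T a') (tid X (tdom X (alg_tight a'))) (hcart X j (alg_tight a) \<star> \<epsilon>)"
  defines "i \<equiv> tid X (tcod X j)"
  defines "\<epsilon>' \<equiv> hlift X i (alg_tight a') (tid X (tdom X i)) (tid X (tdom X (alg_tight a'))) (hcart X i (alg_tight a) \<star> \<epsilon>)"
  shows "\<epsilon>' \<in> graded_morphisms X j T ps a a'"
    and "htransp i (alg_tight a') \<epsilon>' = hcart X i (alg_tight a) \<star> \<epsilon>"
proof -
  let ?t = "rm_tight T" and ?e = "alg_tight a" and ?e' = "alg_tight a'"
  let ?B = "act_transp T a" and ?B' = "act_transp T a'"
  let ?I = "tid X (tdom X i)"
  note md = monad_dataD [OF m]
  have A: "hom_alg j ?t (ext_transp T) (unit_transp j T) ?e ?B"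
    using a [unfolded relative_algebra_iff [OF m]] by auto
  have A': "hom_alg j ?t (ext_transp T) (unit_transp j T) ?e' ?B'"
    using a' [unfolded relative_algebra_iff [OF m]] by auto
  have je: "cospan j ?e" "cospan j ?e'" and B: "?B \<in> hom_cells ?t [hom X j ?e] ?e"
    and B': "?B' \<in> hom_cells ?t [hom X j ?e'] ?e'"
    using hom_algD [OF A] hom_algD [OF A'] by auto
  have i: "i \<in> Tight X" "tdom X i = tcod X j" "tcod X i = tcod X j"
    using cospanD [OF md(1)] by (simp_all add: i_def)
  have Ii: "?I = i" using i(2) by (simp add: i_def)
  have ti: "tdom X ?I = tdom X i" "tcod X ?I = tdom X i" unfolding Ii using i by simp_all
  have co: "cospan i ?t" "cospan j i" "cospan i ?e" "cospan i ?e'"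
    using md(1) je i by (simp_all add: cospan_def)
  note K = hcart_hom [OF co(3)]
  have K\<epsilon>: "hcart X i ?e \<star> \<epsilon> \<in> hom_cells i (hom X i ?e # ps) ?e'"
    using mul_hom [OF K \<epsilon>] by simp
  have g: "\<epsilon>' \<in> globular X (hom X i ?e # ps) (hom X i ?e')" and tr: "htransp i ?e' \<epsilon>' = hcart X i ?e \<star> \<epsilon>"
    unfolding \<epsilon>'_def using htransp_hlift [OF co(4) K\<epsilon>] by auto
  show "htransp i (alg_tight a') \<epsilon>' = hcart X i (alg_tight a) \<star> \<epsilon>" by (rule tr)
  note la = alg_lambda_transp [OF m a, folded i_def] and la' = alg_lambda_transp [OF m a', folded i_def]
  have ps: "loose_chain X (tdom X ?e) ps (tdom X ?e')" using hom_cellsD(4) [OF \<epsilon>] .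
  have c1: "chain_cells ?I [alg_lambda X j T a] (tid X (tdom X ?e)) [hom X i ?e]
      [hom X i ?t, hom X j i, hom X i ?e]"
    using chain_cells_single la(1) globular_hom [OF co(3)] by simp
  note c2 = chain_cells_cid [OF ps]
  have c12: "chain_cells ?I (alg_lambda X j T a # map (cid X) ps) (tid X (tdom X ?e')) (hom X i ?e # ps)
      (hom X i ?t # hom X j i # hom X i ?e # ps)"
    using chain_cells_append [OF c1 c2] by simp
  have d1: "chain_cells ?I [cid X (hom X i ?t)] (tid X (tdom X ?t)) [hom X i ?t] [hom X i ?t]"
    using chain_cells_cid [of "tdom X i" "[hom X i ?t]" "tdom X ?t"] cospanD [OF co(1)] by simp
  have d2: "chain_cells (tid X (tdom X j)) [cid X (hom X j i)] ?I [hom X j i] [hom X j i]"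
    using chain_cells_cid [of "tdom X j" "[hom X j i]" "tdom X i"] cospanD [OF co(2)] by simp
  have d3: "chain_cells ?I [\<epsilon>'] (tid X (tdom X ?e')) [hom X i ?e'] (hom X i ?e # ps)"
    using chain_cells_single g globular_hom [OF co(4)] by simp
  have d23: "chain_cells (tid X (tdom X j)) [cid X (hom X j i), \<epsilon>'] (tid X (tdom X ?e'))
      [hom X j i, hom X i ?e'] (hom X j i # hom X i ?e # ps)"
    using chain_cells_append [OF d2 d3] by simp
  have d123: "chain_cells ?I [cid X (hom X i ?t), cid X (hom X j i), \<epsilon>'] (tid X (tdom X ?e'))
      [hom X i ?t, hom X j i, hom X i ?e'] (hom X i ?t # hom X j i # hom X i ?e # ps)"
    using chain_cells_append [OF d1, of "[cid X (hom X j i), \<epsilon>']"] d23 md(3) by simp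
  have LHS: "\<epsilon>' \<bullet> (alg_lambda X j T a # map (cid X) ps) \<in> globular X (hom X i ?t # hom X j i # hom X i ?e # ps) (hom X i ?e')"
    using gcomp_globular [OF g] c12 cospanD [OF co(4)] by simp
  have RHS: "alg_lambda X j T a' \<bullet> [cid X (hom X i ?t), cid X (hom X j i), \<epsilon>']
      \<in> globular X (hom X i ?t # hom X j i # hom X i ?e # ps) (hom X i ?e')"
    using gcomp_globular [OF la'(1)] d123 cospanD [OF co(4)] by simp
  \<comment> \<open>\<open>?X\<close> transposes the 2-cell from \<open>E(j,1), E(1,e)\<close> to
    \<open>E(j,e)\<close> implicit in the definition of \<lambda>. Both sides of the graded morphism
    law will reduce to the action of \<open>a'\<close> on
    \<open>?X \<star> \<epsilon>\<close>.\<close>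
  let ?X = "hcart X j i \<star> hcart X i ?e" and ?X' = "hcart X j i \<star> hcart X i ?e'"
  have Ie: "tid X (tdom X ?e) \<in> Tight X" "tcod X (tid X (tdom X ?e)) = tdom X ?e" "?e \<cdot> tid X (tdom X ?e) = ?e"
    using cospanD [OF je(1)] by simp_all
  have Ie': "tid X (tdom X ?e') \<in> Tight X" "tcod X (tid X (tdom X ?e')) = tdom X ?e'"
      "?e' \<cdot> tid X (tdom X ?e') = ?e'" "tid X (tdom X ?e') \<cdot> tid X (tdom X ?e') = tid X (tdom X ?e')"
    using cospanD [OF je(2)] by simp_all
  have X: "?X \<in> hom_cells j [hom X j i, hom X i ?e] ?e"
    using mul_hom [OF hcart_hom [OF co(2)] K] by simp
  have X': "?X' \<in> hom_cells j [hom X j i, hom X i ?e'] (?e' \<cdot> tid X (tdom X ?e'))"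
    using mul_hom [OF hcart_hom [OF co(2)] hcart_hom [OF co(4)]] Ie'(3) by simp
  have BX: "app j ?e ?B (tid X (tdom X ?e)) ?X \<in> hom_cells ?t [hom X j i, hom X i ?e] ?e"
    using app_hom [OF je(1) B Ie(1,2)] X Ie(3) by simp
  have B'X': "app j ?e' ?B' (tid X (tdom X ?e')) ?X' \<in> hom_cells ?t [hom X j i, hom X i ?e'] ?e'"
    using app_hom [OF je(2) B' Ie'(1,2) X'] Ie' by simp
  \<comment> \<open>The hypothesis \<open>eq\<close> is stated at the universal arrow from
    \<open>j\<close> to \<open>?e\<close>. Substituting the lift of \<chi> extends it to all arrows,
    in particular to \<open>?X\<close>.\<close>
  have ext: "app j ?e ?B (tid X (tdom X ?e)) \<chi> \<star> \<epsilon> = app j ?e' ?B' (tid X (tdom X ?e')) (\<chi> \<star> \<epsilon>)"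
    if \<chi>: "\<chi> \<in> hom_cells j qs ?e" for \<chi> qs
  proof -
    have \<chi>': "\<chi> \<in> hom_cells j qs (?e \<cdot> tid X (tdom X ?e))" using \<chi> Ie(3) by simp
    note h = hlift_hom [OF je(1) Ie(1,2) \<chi>']
    let ?h = "hlift X j ?e (tid X (tdom X j)) (tid X (tdom X ?e)) \<chi>"
    note ch = chain_cells_single [OF h(1)]
    have j: "tcod X (tid X (tdom X j)) = tdom X j" "tcod X (tid X (tdom X j)) = tdom X ?t"
      using cospanD [OF je(1)] md(3) by simp_all
    have \<epsilon>c: "ccomp X \<epsilon> (tid X (tdom X ?e)) (map (cid X) ps) = \<epsilon>"
      using ccomp_map_cid \<epsilon> by (simp add: hom_cells_def)
    have Kj: "hcart X j ?e \<star> \<epsilon> \<in> hom_cells j ([hom X j ?e] @ ps) (?e' \<cdot> tid X (tdom X ?e'))"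
      using mul_hom [OF hcart_hom [OF je(1)] \<epsilon>] Ie'(3) by simp
    have "app j ?e ?B (tid X (tdom X ?e)) \<chi> \<star> \<epsilon> = ccomp X (?B \<star> \<epsilon>) (tid X (tdom X j)) ([?h] @ map (cid X) ps)"
      using mul_ccomp [OF B \<epsilon> ch c2 j(2)] \<epsilon>c by (simp add: app_def)
    also have "\<dots> = app j ?e' ?B' (tid X (tdom X ?e'))
        (ccomp X (hcart X j ?e \<star> \<epsilon>) (tid X (tdom X j)) ([?h] @ map (cid X) ps))"
      unfolding eq
      using app_ccomp [OF je(2) B' Ie'(1,2) Kj chain_cells_append [OF ch c2]] Ie'(4) by simp
    also have "ccomp X (hcart X j ?e \<star> \<epsilon>) (tid X (tdom X j)) ([?h] @ map (cid X) ps) = \<chi> \<star> \<epsilon>"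
      using mul_ccomp [OF hcart_hom [OF je(1)] \<epsilon> ch c2 j(1)] \<epsilon>c h(2) by simp
    finally show ?thesis .
  qed
  have "htransp i ?e' (\<epsilon>' \<bullet> (alg_lambda X j T a # map (cid X) ps)) =
      ccomp X (hcart X i ?e \<star> \<epsilon>) ?I ([alg_lambda X j T a] @ map (cid X) ps)"
    using htransp_gcomp [OF co(4) g c12] tr by simp
  also have "\<dots> = ccomp X (hcart X i ?e) ?I [alg_lambda X j T a] \<star> ccomp X \<epsilon> (tid X (tdom X ?e)) (map (cid X) ps)"
    by (rule mul_ccomp [OF K \<epsilon> c1 c2 ti(2)])
  also have "ccomp X \<epsilon> (tid X (tdom X ?e)) (map (cid X) ps) = \<epsilon>"
    using ccomp_map_cid \<epsilon> by (simp add: hom_cells_def)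
  also have "ccomp X (hcart X i ?e) ?I [alg_lambda X j T a] = hcart X i ?t \<star> app j ?e ?B (tid X (tdom X ?e)) ?X"
    using la(2) by (simp add: htransp_def)
  also have "(hcart X i ?t \<star> app j ?e ?B (tid X (tdom X ?e)) ?X) \<star> \<epsilon> =
      hcart X i ?t \<star> (app j ?e ?B (tid X (tdom X ?e)) ?X \<star> \<epsilon>)"
    by (rule mul_assoc [OF hcart_hom [OF co(1)] BX \<epsilon>])
  also have "app j ?e ?B (tid X (tdom X ?e)) ?X \<star> \<epsilon> = app j ?e' ?B' (tid X (tdom X ?e')) (?X \<star> \<epsilon>)"
    by (rule ext [OF X])
  finally have L: "htransp i ?e' (\<epsilon>' \<bullet> (alg_lambda X j T a # map (cid X) ps)) =
      hcart X i ?t \<star> app j ?e' ?B' (tid X (tdom X ?e')) (?X \<star> \<epsilon>)" .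
  have "htransp i ?e' (alg_lambda X j T a' \<bullet> [cid X (hom X i ?t), cid X (hom X j i), \<epsilon>']) =
      ccomp X (hcart X i ?t \<star> app j ?e' ?B' (tid X (tdom X ?e')) ?X') ?I
        ([cid X (hom X i ?t)] @ [cid X (hom X j i), \<epsilon>'])"
    using htransp_gcomp [OF co(4) la'(1) d123] la'(2) by simp
  also have "\<dots> = ccomp X (hcart X i ?t) ?I [cid X (hom X i ?t)] \<star>
      ccomp X (app j ?e' ?B' (tid X (tdom X ?e')) ?X') (tid X (tdom X ?t)) [cid X (hom X j i), \<epsilon>']"
    by (rule mul_ccomp [OF hcart_hom [OF co(1)] B'X' d1 _ ti(2)]) (use d23 md(3) in simp)
  also have "ccomp X (hcart X i ?t) ?I [cid X (hom X i ?t)] = hcart X i ?t"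
    using ccomp_cid_single [OF hcart_hom [OF co(1), unfolded hom_cells_def]] .
  also have "ccomp X (app j ?e' ?B' (tid X (tdom X ?e')) ?X') (tid X (tdom X ?t)) [cid X (hom X j i), \<epsilon>'] =
      app j ?e' ?B' (tid X (tdom X ?e')) (ccomp X ?X' (tid X (tdom X j)) ([cid X (hom X j i)] @ [\<epsilon>']))"
    using app_ccomp [OF je(2) B' Ie'(1,2) X' d23] md(3) Ie'(4) by simp
  also have "ccomp X ?X' (tid X (tdom X j)) ([cid X (hom X j i)] @ [\<epsilon>']) =
      ccomp X (hcart X j i) (tid X (tdom X j)) [cid X (hom X j i)] \<star> ccomp X (hcart X i ?e') ?I [\<epsilon>']"
    by (rule mul_ccomp [OF hcart_hom [OF co(2)] hcart_hom [OF co(4)] d2 d3])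
      (use cospanD [OF je(1)] in simp)
  also have "ccomp X (hcart X j i) (tid X (tdom X j)) [cid X (hom X j i)] = hcart X j i"
    using ccomp_cid_single [OF hcart_hom [OF co(2), unfolded hom_cells_def]] .
  also have "ccomp X (hcart X i ?e') ?I [\<epsilon>'] = hcart X i ?e \<star> \<epsilon>"
    using tr by (simp add: htransp_def)
  also have "hcart X j i \<star> (hcart X i ?e \<star> \<epsilon>) = ?X \<star> \<epsilon>"
    using mul_assoc [OF hcart_hom [OF co(2)] K \<epsilon>] by simp
  finally have "htransp i ?e' (alg_lambda X j T a' \<bullet> [cid X (hom X i ?t), cid X (hom X j i), \<epsilon>']) =
      hcart X i ?t \<star> app j ?e' ?B' (tid X (tdom X ?e')) (?X \<star> \<epsilon>)" .
  then have "\<epsilon>' \<bullet> (alg_lambda X j T a # map (cid X) ps) =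
      alg_lambda X j T a' \<bullet> [cid X (hom X i ?t), cid X (hom X j i), \<epsilon>']"
    using htransp_inj [OF co(4) LHS RHS] L by simp
  then show "\<epsilon>' \<in> graded_morphisms X j T ps a a'"
    using g by (simp add: graded_morphisms_def Let_def i_def)
qed

lemma comp_conj_transp:
  assumes "v \<in> Tight X" "d \<in> Tight X" "tcod X d = tdom X v"
    and i: "i = tid X (tcod X v)" and k: "k = tid X (tdom X v)"
  shows "comp_conj X v d \<in> globular X [hom X i v, hom X k d] (hom X i (v \<cdot> d))"
    and "htransp i (v \<cdot> d) (comp_conj X v d) = hcart X i v \<star> hact v (hcart X k d)"
proof -
  have co: "cospan i v" "cospan k d" "cospan v (v \<cdot> d)"
    using assms by (simp_all add: cospan_def)
  have vk: "v \<cdot> k = v" "tdom X v = tcod X k" using assms by simp_all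
  note fr = frown_transp [OF co(2) assms(1) vk(2), unfolded vk(1)]
  note s = smile_gcomp [OF co(1,3) cid_globular [OF co(1)] fr(1)]
  show "comp_conj X v d \<in> globular X [hom X i v, hom X k d] (hom X i (v \<cdot> d))"
    and "htransp i (v \<cdot> d) (comp_conj X v d) = hcart X i v \<star> hact v (hcart X k d)"
    using s fr(2) htransp_cid [OF co(1)] i k by (simp_all add: comp_conj_def Let_def)
qed

text \<open>The factorisation equation of the universal property, in transposed form.\<close>

lemma comp_conj_factor_iff:
  assumes v: "v \<in> Tight X" and d: "d \<in> Tight X" "tcod X d = tdom X v"
    and d': "d' \<in> Tight X" "tcod X d' = tdom X v"
    and i: "i = tid X (tcod X v)" and k: "k = tid X (tdom X v)"
    and \<epsilon>: "\<epsilon> \<in> hom_cells (v \<cdot> d) ps (v \<cdot> d')"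
    and \<epsilon>': "\<epsilon>' \<in> globular X (hom X i (v \<cdot> d) # ps) (hom X i (v \<cdot> d'))"
      "htransp i (v \<cdot> d') \<epsilon>' = hcart X i (v \<cdot> d) \<star> \<epsilon>"
    and \<psi>: "\<psi> \<in> globular X (hom X k d # ps) (hom X k d')"
  shows "\<epsilon>' \<bullet> (comp_conj X v d # map (cid X) ps) = comp_conj X v d' \<bullet> [cid X (hom X i v), \<psi>] \<longleftrightarrow>
    (hcart X i v \<star> hact v (hcart X k d)) \<star> \<epsilon> = hcart X i v \<star> hact v (htransp k d' \<psi>)"
proof -
  have co: "cospan i v" "cospan k d" "cospan k d'" "cospan i (v \<cdot> d)" "cospan i (v \<cdot> d')"
    using v d d' i k by (simp_all add: cospan_def)
  have ti: "tdom X i = tcod X v" "tcod X i = tcod X v" "tid X (tdom X i) = i"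
    and tk: "tdom X k = tdom X v" "tcod X k = tdom X v" "tid X (tdom X k) = k" "v \<cdot> k = v"
    using v i k by simp_all
  have vd: "tdom X (v \<cdot> d) = tdom X d" "tdom X (v \<cdot> d') = tdom X d'" using v d d' by simp_all
  note cc = comp_conj_transp [OF v d i k] and cc' = comp_conj_transp [OF v d' i k]
  have ps: "loose_chain X (tdom X d) ps (tdom X d')"
    using hom_cellsD(4) [OF \<epsilon>] vd by simp
  note c2 = chain_cells_cid [OF ps]
  have c1: "chain_cells i [comp_conj X v d] (tid X (tdom X d)) [hom X i (v \<cdot> d)] [hom X i v, hom X k d]"
    using chain_cells_single cc(1) globular_hom [OF co(4)] ti vd by simp
  have c12: "chain_cells i (comp_conj X v d # map (cid X) ps) (tid X (tdom X d')) (hom X i (v \<cdot> d) # ps)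
      (hom X i v # hom X k d # ps)"
    using chain_cells_append [OF c1 c2] by simp
  have e1: "chain_cells i [cid X (hom X i v)] k [hom X i v] [hom X i v]"
    using chain_cells_cid [of "tdom X i" "[hom X i v]" "tdom X v"] cospanD [OF co(1)] ti k by simp
  have e2: "chain_cells k [\<psi>] (tid X (tdom X d')) [hom X k d'] (hom X k d # ps)"
    using chain_cells_single \<psi> globular_hom [OF co(3)] tk by simp
  have e12: "chain_cells i [cid X (hom X i v), \<psi>] (tid X (tdom X d')) [hom X i v, hom X k d'] (hom X i v # hom X k d # ps)"
    using chain_cells_append [OF e1 e2] by simp
  have L: "\<epsilon>' \<bullet> (comp_conj X v d # map (cid X) ps) \<in> globular X (hom X i v # hom X k d # ps) (hom X i (v \<cdot> d'))"
    using gcomp_globular [OF \<epsilon>'(1)] c12 cospanD [OF co(5)] ti vd by simp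
  have R: "comp_conj X v d' \<bullet> [cid X (hom X i v), \<psi>] \<in> globular X (hom X i v # hom X k d # ps) (hom X i (v \<cdot> d'))"
    using gcomp_globular [OF cc'(1)] e12 cospanD [OF co(5)] ti vd by simp
  have "htransp i (v \<cdot> d') (\<epsilon>' \<bullet> (comp_conj X v d # map (cid X) ps)) =
      ccomp X (hcart X i (v \<cdot> d) \<star> \<epsilon>) i ([comp_conj X v d] @ map (cid X) ps)"
    using htransp_gcomp [OF co(5) \<epsilon>'(1), unfolded ti(3), OF c12] \<epsilon>'(2) by simp
  also have "\<dots> = ccomp X (hcart X i (v \<cdot> d)) i [comp_conj X v d] \<star> ccomp X \<epsilon> (tid X (tdom X d)) (map (cid X) ps)"
    by (rule mul_ccomp [OF hcart_hom [OF co(4)] \<epsilon> c1 c2]) (simp add: ti)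
  also have "ccomp X (hcart X i (v \<cdot> d)) i [comp_conj X v d] = hcart X i v \<star> hact v (hcart X k d)"
    using cc(2) ti(3) by (simp add: htransp_def)
  also have "ccomp X \<epsilon> (tid X (tdom X d)) (map (cid X) ps) = \<epsilon>"
    using ccomp_map_cid [OF \<epsilon> [unfolded hom_cells_def]] vd by simp
  finally have 1: "htransp i (v \<cdot> d') (\<epsilon>' \<bullet> (comp_conj X v d # map (cid X) ps)) =
      (hcart X i v \<star> hact v (hcart X k d)) \<star> \<epsilon>" .
  have K: "hcart X k d' \<in> hom_cells k [hom X k d'] d'" by (rule hcart_hom [OF co(3)])
  have vK: "hact v (hcart X k d') \<in> hom_cells v [hom X k d'] (v \<cdot> d')"
    using hact_hom [OF K v] tk by simp
  have "htransp i (v \<cdot> d') (comp_conj X v d' \<bullet> [cid X (hom X i v), \<psi>]) =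
      ccomp X (hcart X i v \<star> hact v (hcart X k d')) i ([cid X (hom X i v)] @ [\<psi>])"
    using htransp_gcomp [OF co(5) cc'(1), unfolded ti(3), OF e12] cc'(2) by simp
  also have "\<dots> = ccomp X (hcart X i v) i [cid X (hom X i v)] \<star> ccomp X (hact v (hcart X k d')) k [\<psi>]"
    by (rule mul_ccomp [OF hcart_hom [OF co(1)] vK e1 e2]) (simp add: ti)
  also have "ccomp X (hcart X i v) i [cid X (hom X i v)] = hcart X i v"
    using ccomp_cid_single [OF hcart_hom [OF co(1), unfolded hom_cells_def]] ti(3) by simp
  also have "ccomp X (hact v (hcart X k d')) k [\<psi>] = hact v (htransp k d' \<psi>)"
    using hact_ccomp [OF K v _ e2] tk by (simp add: htransp_def)
  finally have 2: "htransp i (v \<cdot> d') (comp_conj X v d' \<bullet> [cid X (hom X i v), \<psi>]) =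
      hcart X i v \<star> hact v (htransp k d' \<psi>)" .
  show ?thesis
    unfolding htransp_eq_iff [OF co(5) L R] 1 2 ..
qed

text \<open>The identity arrow of \<open>g \<cdot> y\<close>, factored through
  \<open>E(1,g)\<close>, is the unit of this companion along \<open>y\<close>. Inserting it into a
  cell whose domain starts with \<open>E(1,g)\<close> undoes multiplication by
  \<open>hcart X i g\<close>.\<close>

lemma hone_hlift:
  assumes "g \<in> Tight X" "i = tid X (tcod X g)" "y \<in> Tight X" "tcod X y = tdom X g"
  shows "hlift X i g (g \<cdot> y) y (hone (g \<cdot> y)) \<in> cells (g \<cdot> y) [] (hom X i g) y"
    and "ccomp X (hcart X i g) (g \<cdot> y) [hlift X i g (g \<cdot> y) y (hone (g \<cdot> y))] = hone (g \<cdot> y)"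
proof -
  have i: "i \<in> Tight X" "tcod X i = tcod X g" "tdom X i = tcod X g" "i \<cdot> (g \<cdot> y) = g \<cdot> y"
    using assms by simp_all
  have gy: "g \<cdot> y \<in> Tight X" "tcod X (g \<cdot> y) = tdom X i" using assms i by simp_all
  have h: "hone (g \<cdot> y) \<in> cells (i \<cdot> (g \<cdot> y)) [] (lid X (tcod X i)) (g \<cdot> y)"
    using hone_hom [OF gy(1)] i gy(2) unfolding hom_cells_def by simp
  show "hlift X i g (g \<cdot> y) y (hone (g \<cdot> y)) \<in> cells (g \<cdot> y) [] (hom X i g) y"
    and "ccomp X (hcart X i g) (g \<cdot> y) [hlift X i g (g \<cdot> y) y (hone (g \<cdot> y))] = hone (g \<cdot> y)"
    by (rule hlift [OF i(1) assms(1) i(2) gy assms(3,4) h])+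
qed

text \<open>An arrow becomes a graded morphism by multiplication with a universal arrow, and the
  factorisation supplied by condition (2) becomes an arrow again by insertion of companion
  units.\<close>

lemma algebra_object_hom:
  assumes m: "relative_monad X j T" and j: "j \<in> Tight X" and u: "algebra_object X j T u"
  shows "hom_algebra_object X j (rm_tight T) (ext_transp T) (unit_transp j T) (alg_tight u) (act_transp T u)"
proof -
  let ?t = "rm_tight T" and ?v = "alg_tight u" and ?B = "act_transp T u"
  let ?D = "ext_transp T" and ?N = "unit_transp j T"
  let ?i = "tid X (tcod X ?v)" and ?k = "tid X (tdom X ?v)"
  have md: "monad_data j T" by (rule relative_monad_data [OF j m])
  have ua: "relative_algebra X j T u"
    using u by (simp add: algebra_object_def)
  have alg: "hom_alg j ?t ?D ?N ?v ?B"
    using ua [unfolded relative_algebra_iff [OF md]] by simp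
  note jv = hom_algD(5) [OF alg] and B = hom_algD(6) [OF alg]
  have v: "?v \<in> Tight X" "tcod X ?v = tcod X j" using cospanD [OF jv] by auto
  have i: "?i = tid X (tcod X j)" using v by simp
  \<comment> \<open>Condition (2) for the restrictions of the universal algebra along
    \<open>d\<close> and \<open>d'\<close>, whose mediating tight-cells are \<open>d\<close> and
    \<open>d'\<close>. Its existence half gives \<open>lift\<close>, its uniqueness half
    \<open>faithful\<close>.\<close>
  have factor: "\<exists>!\<psi>. \<psi> \<in> globular X (hom X ?k d # ps) (hom X ?k d') \<and>
      (hcart X ?i ?v \<star> hact ?v (hcart X ?k d)) \<star> \<epsilon> = hcart X ?i ?v \<star> hact ?v (htransp ?k d' \<psi>)"
    if d: "d \<in> Tight X" "tcod X d = tdom X ?v" and d': "d' \<in> Tight X" "tcod X d' = tdom X ?v"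
      and \<epsilon>: "\<epsilon> \<in> hom_cells (?v \<cdot> d) ps (?v \<cdot> d')"
      and eq: "app j ?v ?B d (hcart X j (?v \<cdot> d)) \<star> \<epsilon> = app j ?v ?B d' (hcart X j (?v \<cdot> d) \<star> \<epsilon>)"
    for d d' \<epsilon> ps
  proof -
    let ?a = "alg_precomp X j T u d" and ?a' = "alg_precomp X j T u d'"
    note a = alg_precomp_algebra [OF md ua d] and a' = alg_precomp_algebra [OF md ua d']
    have at: "alg_tight ?a = ?v \<cdot> d" "alg_tight ?a' = ?v \<cdot> d'" by (simp_all add: alg_precomp_def)
    have jvd: "cospan j (?v \<cdot> d)" by (rule cospan_tcomp [OF jv d])
    have I: "tid X (tdom X (?v \<cdot> d')) \<in> Tight X" "tcod X (tid X (tdom X (?v \<cdot> d'))) = tdom X d'"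
      "d' \<cdot> tid X (tdom X (?v \<cdot> d')) = d'"
      using d' v by simp_all
    have "hcart X j (?v \<cdot> d) \<star> \<epsilon> \<in> hom_cells j ([hom X j (?v \<cdot> d)] @ ps) (?v \<cdot> d' \<cdot> tid X (tdom X (?v \<cdot> d')))"
      unfolding I(3) by (rule mul_hom [OF hcart_hom [OF jvd] \<epsilon>])
    from app_app_hcart [OF jv B d' I(1,2) this]
    have eq': "act_transp T ?a \<star> \<epsilon> = app j (alg_tight ?a') (act_transp T ?a')
        (tid X (tdom X (alg_tight ?a'))) (hcart X j (alg_tight ?a) \<star> \<epsilon>)"
      unfolding at a(2) [unfolded at] a'(2) [unfolded at] eq I(3) by (rule sym)
    note g = graded_morphism_hlift [OF md a(1) a'(1) \<epsilon> [folded at] eq', unfolded at, folded i]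
    let ?\<epsilon>' = "hlift X ?i (?v \<cdot> d') (tid X (tdom X ?i)) (tid X (tdom X (?v \<cdot> d'))) (hcart X ?i (?v \<cdot> d) \<star> \<epsilon>)"
    have gg: "?\<epsilon>' \<in> globular X (hom X ?i (?v \<cdot> d) # ps) (hom X ?i (?v \<cdot> d'))"
      using g(1) unfolding graded_morphisms_def Let_def at i by simp
    have ch: "loose_chain X (tdom X (alg_tight ?a)) ps (tdom X (alg_tight ?a'))"
      using hom_cellsD(4) [OF \<epsilon>] at by simp
    have "\<exists>!\<psi>. \<psi> \<in> globular X (hom X ?k d # ps) (hom X ?k d') \<and>
        ?\<epsilon>' \<bullet> (comp_conj X ?v d # map (cid X) ps) = comp_conj X ?v d' \<bullet> [cid X (hom X ?i ?v), \<psi>]"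
      using u [unfolded algebra_object_def Let_def] a(1,3) a'(1,3) ch g(1) by blast
    then show ?thesis
      using comp_conj_factor_iff [OF v(1) d d' refl refl \<epsilon> gg g(2)] by (simp cong: conj_cong)
  qed
  \<comment> \<open>The unit of the companion of \<open>d\<close>, which converts cells with domain
    \<open>E(1,d), ps\<close> into arrows out of \<open>d\<close>.\<close>
  let ?h = "\<lambda>d. hlift X ?k d d (tid X (tdom X d)) (hone d)"
  have h: "?h d \<in> cells d [] (hom X ?k d) (tid X (tdom X d))" "ccomp X (hcart X ?k d) d [?h d] = hone d"
    if d: "d \<in> Tight X" "tcod X d = tdom X ?v" for d
    using hone_hlift [of d ?k "tid X (tdom X d)"] d by simp_all
  have ch: "chain_cells d (?h d # map (cid X) ps) (tid X (tdom X d')) (hom X ?k d # ps) ps"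
    if d: "d \<in> Tight X" "tcod X d = tdom X ?v" and ps: "loose_chain X (tdom X d) ps (tdom X d')" for d d' ps
    using chain_cells_Cons [OF h(1) [OF d] chain_cells_cid [OF ps]] by simp
  have restrict: "ccomp X (hcart X ?k d \<star> \<psi>) d (?h d # map (cid X) ps) = \<psi>"
    if d: "d \<in> Tight X" "tcod X d = tdom X ?v" and \<psi>: "\<psi> \<in> hom_cells d ps d'" for d d' ps \<psi>
  proof -
    have kd: "cospan ?k d" "tcod X d = tdom X ?k" using d v by (simp_all add: cospan_def)
    have "ccomp X (hcart X ?k d \<star> \<psi>) d ([?h d] @ map (cid X) ps) =
        ccomp X (hcart X ?k d) d [?h d] \<star> ccomp X \<psi> (tid X (tdom X d)) (map (cid X) ps)"
      by (rule mul_ccomp [OF hcart_hom [OF kd(1)] \<psi> chain_cells_single [OF h(1) [OF d]]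
            chain_cells_cid [OF hom_cellsD(4) [OF \<psi>]] kd(2)])
    also have "\<dots> = hone d \<star> \<psi>"
      using ccomp_map_cid [OF \<psi> [unfolded hom_cells_def]] h(2) [OF d] by simp
    finally show ?thesis using mul_hone_left [OF \<psi>] by simp
  qed
  show ?thesis
  proof unfold_locales
    show "hom_alg j ?t ?D ?N ?t ?D" "app j ?t ?D (tid X (tdom X ?t)) ?N = hone ?t"
      using m [unfolded relative_monad_iff [OF md]] by auto
    show "hom_alg j ?t ?D ?N ?v ?B" by (rule alg)
    show "\<exists>\<psi>\<in>hom_cells d ps d'. hact ?v \<psi> = \<epsilon>"
      if d: "d \<in> Tight X" "tcod X d = tdom X ?v" and d': "d' \<in> Tight X" "tcod X d' = tdom X ?v"
        and \<epsilon>: "\<epsilon> \<in> hom_cells (?v \<cdot> d) ps (?v \<cdot> d')"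
        and eq: "app j ?v ?B d (hcart X j (?v \<cdot> d)) \<star> \<epsilon> = app j ?v ?B d' (hcart X j (?v \<cdot> d) \<star> \<epsilon>)"
      for d d' \<epsilon> ps
    proof -
      obtain \<psi> where \<psi>: "\<psi> \<in> globular X (hom X ?k d # ps) (hom X ?k d')"
        and fac: "(hcart X ?i ?v \<star> hact ?v (hcart X ?k d)) \<star> \<epsilon> = hcart X ?i ?v \<star> hact ?v (htransp ?k d' \<psi>)"
        using factor [OF d d' \<epsilon> eq] by blast
      let ?\<Psi> = "htransp ?k d' \<psi>" and ?w = "hlift X ?i ?v (?v \<cdot> d) d (hone (?v \<cdot> d))"
      let ?c = "?h d # map (cid X) ps"
      have co: "cospan ?k d" "cospan ?k d'" "cospan ?i ?v" using d d' v j by (simp_all add: cospan_def)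
      have k: "tdom X ?k = tdom X ?v" "tcod X ?k = tdom X ?v" "?k \<cdot> d = d" "?v \<cdot> ?k = ?v" using v d j by simp_all
      have vd: "?v \<cdot> d \<in> Tight X" "tdom X (?v \<cdot> d) = tdom X d" "tdom X (?v \<cdot> d') = tdom X d'"
          "tcod X (?v \<cdot> d) = tdom X ?i"
        using d d' v j by simp_all
      have ps: "loose_chain X (tdom X d) ps (tdom X d')" using hom_cellsD(4) [OF \<epsilon>] vd by simp
      note \<Psi> = htransp_hom [OF co(2) \<psi>]
      note w = hone_hlift [OF v(1) refl d]
      note c = ch [OF d ps]
      have R0: "ccomp X ?\<Psi> d ?c \<in> hom_cells d ps d'"
        using hom_cells_ccomp [OF \<Psi> c] k d d' by simp
      \<comment> \<open>Both sides of \<open>fac\<close> are composed with the units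
        \<open>?w\<close> and \<open>?h d\<close>: the universal arrows become identities, leaving
        \<epsilon> on one side and the image of the candidate lift on the other.\<close>
      have "hact ?v (ccomp X ?\<Psi> d ?c) = \<epsilon>"
      proof -
        have vK: "hact ?v (hcart X ?k d) \<in> hom_cells ?v [hom X ?k d] (?v \<cdot> d)"
          using hact_hom [OF hcart_hom [OF co(1)] v(1)] k by simp
        have v\<Psi>: "hact ?v ?\<Psi> \<in> hom_cells ?v (hom X ?k d # ps) (?v \<cdot> d')"
          using hact_hom [OF \<Psi> v(1)] k by simp
        note cw = chain_cells_single [OF w(1)] and cd = chain_cells_single [OF h(1) [OF d]]
        have "ccomp X ((hcart X ?i ?v \<star> hact ?v (hcart X ?k d)) \<star> \<epsilon>) (?v \<cdot> d) (([?w] @ [?h d]) @ map (cid X) ps) =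
            ccomp X (hcart X ?i ?v \<star> hact ?v (hcart X ?k d)) (?v \<cdot> d) ([?w] @ [?h d]) \<star>
            ccomp X \<epsilon> (tid X (tdom X d)) (map (cid X) ps)"
          by (rule mul_ccomp [OF mul_hom [OF hcart_hom [OF co(3)] vK] \<epsilon> chain_cells_append [OF cw cd]
                chain_cells_cid [OF ps] vd(4)])
        also have "ccomp X (hcart X ?i ?v \<star> hact ?v (hcart X ?k d)) (?v \<cdot> d) ([?w] @ [?h d]) =
            ccomp X (hcart X ?i ?v) (?v \<cdot> d) [?w] \<star> ccomp X (hact ?v (hcart X ?k d)) d [?h d]"
          by (rule mul_ccomp [OF hcart_hom [OF co(3)] vK cw cd vd(4)])
        also have "ccomp X (hcart X ?i ?v) (?v \<cdot> d) [?w] = hone (?v \<cdot> d)" by (rule w(2))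
        also have "ccomp X (hact ?v (hcart X ?k d)) d [?h d] = hone (?v \<cdot> d)"
          using hact_ccomp [OF hcart_hom [OF co(1)] v(1) _ cd] h(2) [OF d] hact_hone [OF d(1) v(1)] d k by simp
        also have "ccomp X \<epsilon> (tid X (tdom X d)) (map (cid X) ps) = \<epsilon>"
          using ccomp_map_cid [OF \<epsilon> [unfolded hom_cells_def]] vd by simp
        also have "(hone (?v \<cdot> d) \<star> hone (?v \<cdot> d)) \<star> \<epsilon> = \<epsilon>"
          using mul_hone_left [OF hone_hom [OF vd(1)]] mul_hone_left [OF \<epsilon>] by simp
        finally have L: "ccomp X ((hcart X ?i ?v \<star> hact ?v (hcart X ?k d)) \<star> \<epsilon>) (?v \<cdot> d)
            (?w # ?h d # map (cid X) ps) = \<epsilon>" by simp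
        have v\<Psi>c: "ccomp X (hact ?v ?\<Psi>) d ?c = hact ?v (ccomp X ?\<Psi> d ?c)"
          using hact_ccomp [OF \<Psi> v(1) _ c] d k by simp
        have "ccomp X (hcart X ?i ?v \<star> hact ?v ?\<Psi>) (?v \<cdot> d) ([?w] @ ?c) =
            ccomp X (hcart X ?i ?v) (?v \<cdot> d) [?w] \<star> ccomp X (hact ?v ?\<Psi>) d ?c"
          by (rule mul_ccomp [OF hcart_hom [OF co(3)] v\<Psi> cw c vd(4)])
        also have "\<dots> = hone (?v \<cdot> d) \<star> hact ?v (ccomp X ?\<Psi> d ?c)"
          unfolding w(2) v\<Psi>c ..
        also have "\<dots> = hact ?v (ccomp X ?\<Psi> d ?c)"
          using mul_hone_left [of "hact ?v (ccomp X ?\<Psi> d ?c)" "?v \<cdot> d" ps "?v \<cdot> d'"]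
            hact_hom [OF R0 v(1)] d by simp
        finally show ?thesis using L fac by simp
      qed
      then show ?thesis using R0 by blast
    qed
    show "\<psi> = \<psi>'"
      if tc: "tcod X d = tdom X ?v" and \<psi>: "\<psi> \<in> hom_cells d ps d'" and \<psi>': "\<psi>' \<in> hom_cells d ps d'"
        and eq: "hact ?v \<psi> = hact ?v \<psi>'"
      for d d' ps \<psi> \<psi>'
    proof -
      note e = hom_cellsD [OF \<psi>]
      have d: "d \<in> Tight X" "tcod X d = tdom X ?v" and d': "d' \<in> Tight X" "tcod X d' = tdom X ?v"
        using e tc by auto
      have co: "cospan ?k d" "cospan ?k d'" "cospan ?i ?v" "cospan j (?v \<cdot> d)"
        using d d' v cospanD(1) [OF jv] by (simp_all add: cospan_def)
      have k: "tdom X ?k = tdom X ?v" "tcod X ?k = tdom X ?v" "?v \<cdot> ?k = ?v" using v j by simp_all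
      have \<epsilon>: "hact ?v \<psi> \<in> hom_cells (?v \<cdot> d) ps (?v \<cdot> d')"
        using hact_hom [OF \<psi> v(1)] d by simp
      \<comment> \<open>An arrow in the image of \<open>v\<close> is compatible with the actions by
        naturality, so \<open>factor\<close> applies to it.\<close>
      have "app j ?v ?B d (hcart X j (?v \<cdot> d)) \<star> hact ?v \<psi> = app j ?v ?B d' (hcart X j (?v \<cdot> d) \<star> hact ?v \<psi>)"
        using app_mul [OF jv B hcart_hom [OF co(4)] \<psi> d(2)] by simp
      note fac = factor [OF d d' \<epsilon> this]
      have vK: "hact ?v (hcart X ?k d) \<in> hom_cells ?v [hom X ?k d] (?v \<cdot> d)"
        using hact_hom [OF hcart_hom [OF co(1)] v(1)] k by simp
      let ?c = "\<lambda>\<psi>. hlift X ?k d' (tid X (tdom X ?k)) (tid X (tdom X d')) (hcart X ?k d \<star> \<psi>)"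
      \<comment> \<open>Both \<psi> and \<psi>' give factorisations \<open>?c \<rho>\<close> of the
        same arrow, so uniqueness identifies them.\<close>
      have *: "?c \<rho> \<in> globular X (hom X ?k d # ps) (hom X ?k d') \<and> htransp ?k d' (?c \<rho>) = hcart X ?k d \<star> \<rho> \<and>
          (hcart X ?i ?v \<star> hact ?v (hcart X ?k d)) \<star> hact ?v \<psi> = hcart X ?i ?v \<star> hact ?v (htransp ?k d' (?c \<rho>))"
        if \<rho>: "\<rho> \<in> hom_cells d ps d'" "hact ?v \<rho> = hact ?v \<psi>" for \<rho>
      proof -
        have m: "hcart X ?k d \<star> \<rho> \<in> hom_cells ?k (hom X ?k d # ps) d'"
          using mul_hom [OF hcart_hom [OF co(1)] \<rho>(1)] by simp
        note tr = htransp_hlift [OF co(2) m]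
        have "hact ?v (hcart X ?k d \<star> \<rho>) = hact ?v (hcart X ?k d) \<star> hact ?v \<psi>"
          using hact_mul [OF hcart_hom [OF co(1)] \<rho>(1) v(1)] k \<rho>(2) by simp
        then show ?thesis
          using tr mul_assoc [OF hcart_hom [OF co(3)] vK \<epsilon>] by simp
      qed
      have "?c \<psi> = ?c \<psi>'"
        using fac * [OF \<psi> refl] * [OF \<psi>' eq [symmetric]] by blast
      then have eqK: "hcart X ?k d \<star> \<psi> = hcart X ?k d \<star> \<psi>'"
        using * [OF \<psi> refl] * [OF \<psi>' eq [symmetric]] by metis
      show ?thesis
        using restrict [OF d \<psi>, unfolded eqK] restrict [OF d \<psi>'] by (rule trans [OF sym])
    qed
    show "\<exists>!d. d \<in> Tight X \<and> tcod X d = tdom X ?v \<and> ?v \<cdot> d = e \<and> app j ?v ?B d (hcart X j e) = Be"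
      if e: "hom_alg j ?t ?D ?N e Be" for e Be
    proof -
      note ed = hom_algD [OF e]
      let ?a = "\<lparr>alg_tight = e, alg_act = hlift X ?t e (tid X (tdom X ?t)) (tid X (tdom X e)) Be\<rparr>"
      have te: "cospan ?t e" using ed(1,5) by (simp add: cospan_def)
      note tr = htransp_hlift [OF te ed(6)]
      have a: "relative_algebra X j T ?a"
        unfolding relative_algebra_iff [OF md] using tr e by simp
      have "\<exists>!d. mediating X j T u ?a d"
        using u a by (simp add: algebra_object_def)
      then show ?thesis
        unfolding mediating_iff [OF md ua a] using tr(2) by simp
    qed
  qed
qed

section \<open>Return from arrows to the original monads and adjunctions\<close>

lemma monad_eqI:
  fixes T T1 :: "('b, 'd) rel_monad"
  assumes "monad_data j T" "monad_data j T1" "rm_tight T = rm_tight T1"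
    "ext_transp T = ext_transp T1" "unit_transp j T = unit_transp j T1"
  shows "T = T1"
proof -
  note a = monad_dataD [OF assms(1)] and b = monad_dataD [OF assms(2), folded assms(3)]
  have "rm_ext T = rm_ext T1"
    using htransp_inj [OF a(2,4) b(4)] assms(3,4) by simp
  moreover have "rm_unit T = rm_unit T1"
    using htransp_inj [OF a(1,5) b(5)] assms(3,5) by simp
  ultimately show ?thesis using assms(3) by (auto intro: rel_monad.equality)
qed

lemma free_tight_eq:
  assumes "relative_monad X j T" "j \<in> Tight X" "algebra_object X j T u"
  shows "free_tight X j T u = hom_algebra_object.f X j (rm_tight T) (ext_transp T) (alg_tight u) (act_transp T u)"
proof -
  interpret H: hom_algebra_object X j "rm_tight T" "ext_transp T" "unit_transp j T" "alg_tight u" "act_transp T u"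
    by (rule algebra_object_hom [OF assms])
  have md: "monad_data j T" by (rule relative_monad_data [OF assms(2,1)])
  have u: "relative_algebra X j T u" using assms(3) by (simp add: algebra_object_def)
  have fr: "relative_algebra X j T (free_alg T)"
    unfolding relative_algebra_iff [OF md] using H.monad(1) monad_dataD(4) [OF md] by (simp add: free_alg_def)
  show ?thesis
    unfolding free_tight_def H.f_def mediating_iff [OF md u fr] by (simp add: free_alg_def)
qed

lemma induced_relative_monad:
  assumes "j \<in> Tight X" "relative_adjunction X j R"
  shows "relative_monad X j (induced_monad X j R)"
proof -
  have ad: "adj_data j R" and ha: "hom_adjunction X j (ladj R) (radj R) (sharp_transp j R) (flat_transp R)"
    using assms(2) [unfolded relative_adjunction_iff [OF assms(1)]] by auto
  interpret hom_adjunction X j "ladj R" "radj R" "sharp_transp j R" "flat_transp R" by (rule ha)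
  note i = induced_monad_data [OF ad ha]
  have t: "rm_tight (induced_monad X j R) = radj R \<cdot> ladj R" by (simp add: induced_monad_def)
  have "tdom X (radj R \<cdot> ladj R) = tdom X (ladj R)" using l r by simp
  then show ?thesis
    unfolding relative_monad_iff [OF i(1)] i(2,3) unfolding t
    using induced_hom_alg induced_unit by simp
qed

text \<open>The last conclusion records which \<sharp> was constructed.
  \<open>left_morphisms_bij\<close> needs it to replace the condition on left-morphisms by
  \<open>left_mor\<close>.\<close>

lemma free_adjunction:
  assumes m: "relative_monad X j T" and j: "j \<in> Tight X" and u: "algebra_object X j T u"
  obtains R :: "('b, 'd) rel_adj" where "relative_adjunction X j R" "ladj R = free_tight X j T u"
    "radj R = alg_tight u" "induced_monad X j R = T"
    "sharp_transp j R =
      hom_algebra_object.S X j (rm_tight T) (ext_transp T) (unit_transp j T) (alg_tight u) (act_transp T u)"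
proof -
  let ?v = "alg_tight u"
  interpret H: hom_algebra_object X j "rm_tight T" "ext_transp T" "unit_transp j T" ?v "act_transp T u"
    by (rule algebra_object_hom [OF m j u])
  have md: "monad_data j T" by (rule relative_monad_data [OF j m])
  let ?R = "\<lparr>ladj = H.f, radj = ?v,
    sharp = hlift X j ?v (tid X (tdom X j)) (tid X (tdom X ?v)) H.S,
    flat = hlift X H.f H.V (tid X (tdom X H.f)) (tid X (tdom X H.V)) H.F\<rparr> :: ('b, 'd) rel_adj"
  note s = htransp_hlift [OF H.jv H.S] and f = htransp_hlift [OF H.fV H.F(1)]
  have st: "sharp_transp j ?R = H.S" and ft: "flat_transp ?R = H.F"
    using s(2) f(2) by simp_all
  have ad: "adj_data j ?R"
    unfolding adj_data_def using H.jv H.f H.tdom_f s(1) f(1) by simp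
  have ha: "hom_adjunction X j (ladj ?R) (radj ?R) (sharp_transp j ?R) (flat_transp ?R)"
    unfolding st ft using H.free.hom_adjunction_axioms by simp
  have ra: "relative_adjunction X j ?R"
    unfolding relative_adjunction_iff [OF j] using ad ha by blast
  note i = induced_monad_data [OF ad ha, unfolded st ft]
  have t: "rm_tight (induced_monad X j ?R) = rm_tight T"
    using H.f(3) by (simp add: induced_monad_def)
  have "induced_monad X j ?R = T"
    by (rule monad_eqI [OF i(1) md t]) (use i(2,3) H.free_N H.free_D in simp_all)
  then show ?thesis
    using that [OF ra _ _ _ st] free_tight_eq [OF m j u] by simp
qed

text \<open>Whiskering by the right adjoint transposes to \<open>hact\<close>, so
  \<open>Lambda_L\<close> sends \<sigma> to its image under \<open>hact\<close>. Injectivity,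
  surjectivity and the strictness criterion are then \<open>left_mor_inj\<close>,
  \<open>monad_mor_left_mor\<close> and \<open>left_mor_strict\<close>, carried back along
  transposition.\<close>

lemma left_morphisms_bij:
  fixes R R' :: "('b, 'd) rel_adj"
  assumes m: "relative_monad X j T'" and j: "j \<in> Tight X" and u: "algebra_object X j T' u'"
    and R': "relative_adjunction X j R'" "ladj R' = free_tight X j T' u'" "radj R' = alg_tight u'"
      "sharp_transp j R' =
      hom_algebra_object.S X j (rm_tight T') (ext_transp T') (unit_transp j T') (alg_tight u') (act_transp T' u')"
    and R: "relative_adjunction X j R"
  shows "bij_betw (Lambda_L X R R') (RAdj_L_hom X j R R') (RMnd_hom X j T' (induced_monad X j R))"
    and "mor \<in> RAdj_L_hom X j R R' \<Longrightarrow> strict_left_morphism X R R' mor \<longleftrightarrow>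
      induced_monad X j R = T' \<and> Lambda_L X R R' mor = tight2_id X (rm_tight T')"
proof -
  let ?v = "alg_tight u'" and ?t = "rm_tight T'" and ?l = "ladj R" and ?r = "radj R"
  have ad: "adj_data j R" and ha: "hom_adjunction X j (ladj R) (radj R) (sharp_transp j R) (flat_transp R)"
    using R [unfolded relative_adjunction_iff [OF j]] by auto
  have ad': "adj_data j R'" using R'(1) [unfolded relative_adjunction_iff [OF j]] by auto
  have md: "monad_data j T'" by (rule relative_monad_data [OF j m])
  interpret G: hom_algebra_object_adjunction X j ?t "ext_transp T'" "unit_transp j T'" ?v "act_transp T' u'"
    ?l ?r "sharp_transp j R" "flat_transp R"
    by (rule hom_algebra_object_adjunction.intro [OF algebra_object_hom [OF m j u] ha])
  have l': "ladj R' = G.f" using R'(2) free_tight_eq [OF m j u] by simp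
  note i = induced_monad_data [OF ad ha]
  have ti: "rm_tight (induced_monad X j R) = ?r \<cdot> ?l" by (simp add: induced_monad_def)
  have ft: "cospan ?t (?r \<cdot> ?l)" using G.t cospanD [OF G.adj.j_rl] by (simp add: cospan_def)
  have dl: "tdom X (?r \<cdot> ?l) = tdom X ?l" using G.adj.l G.adj.r by simp
  have mor: "(c, \<sigma>) \<in> RAdj_L_hom X j R R' \<longleftrightarrow> \<sigma> \<in> globular X [] (hom X G.f (c \<cdot> ?l)) \<and>
      G.left_mor c (htransp G.f (c \<cdot> ?l) \<sigma>)" for c \<sigma>
  proof -
    have fc: "cospan G.f (c \<cdot> ?l)" if "c \<in> Tight X" "tdom X c = tdom X ?r" "tcod X c = tdom X ?v"
      using that G.f G.adj.l by (simp add: cospan_def)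
    show ?thesis
    proof (cases "\<sigma> \<in> globular X [] (hom X G.f (c \<cdot> ?l)) \<and> c \<in> Tight X \<and> tdom X c = tdom X ?r \<and>
        tcod X c = tdom X ?v \<and> ?r = ?v \<cdot> c")
      case True
      then have c: "c \<in> Tight X" "tdom X c = tdom X ?r" "tcod X c = tdom X ?v" "?v \<cdot> c = ?r"
        and \<sigma>: "\<sigma> \<in> globular X [] (hom X G.f (c \<cdot> ?l))"
        by auto
      note \<Sigma> = htransp_hom [OF fc [OF c(1-3)] \<sigma>]
      show ?thesis
        unfolding RAdj_L_hom_iff [OF ad ad', unfolded R'(4) l'] thom_iff R'(3) G.left_mor_def
        using True c(4) \<Sigma> G.left_mor_sharp [OF c \<Sigma>] by blast
    next
      case False
      then show ?thesis
        unfolding RAdj_L_hom_iff [OF ad ad', unfolded R'(4) l'] thom_iff R'(3) G.left_mor_def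
          eq_commute [of ?r "?v \<cdot> c"] by blast
    qed
  qed
  have mmor: "\<tau> \<in> RMnd_hom X j T' (induced_monad X j R) \<longleftrightarrow> \<tau> \<in> globular X [] (hom X ?t (?r \<cdot> ?l)) \<and>
      G.monad_mor (htransp ?t (?r \<cdot> ?l) \<tau>)" for \<tau>
    unfolding RMnd_hom_iff [OF md i(1)] i(2,3) unfolding ti dl G.monad_mor_def
    using htransp_hom [OF ft, of \<tau> "[]"] by auto
  have Lambda: "Lambda_L X R R' (c, \<sigma>) \<in> globular X [] (hom X ?t (?r \<cdot> ?l))"
      "htransp ?t (?r \<cdot> ?l) (Lambda_L X R R' (c, \<sigma>)) = hact ?v (htransp G.f (c \<cdot> ?l) \<sigma>)"
    if "(c, \<sigma>) \<in> RAdj_L_hom X j R R'" for c \<sigma>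
  proof -
    have \<sigma>: "\<sigma> \<in> globular X [] (hom X G.f (c \<cdot> ?l))" and c: "c \<in> Tight X" "tdom X c = tdom X ?r"
        "tcod X c = tdom X ?v" "?v \<cdot> c = ?r"
      using that unfolding mor G.left_mor_def by auto
    have fc: "cospan G.f (c \<cdot> ?l)" using c G.f G.adj.l by (simp add: cospan_def)
    have vf: "tdom X ?v = tcod X G.f" using G.f by simp
    have rl: "?v \<cdot> c \<cdot> ?l = ?r \<cdot> ?l"
      using tcomp_assoc_simp [OF G.adj.l(1) c(1) G.v(1)] c G.adj.l by simp
    note fr = frown_gcomp [OF fc G.v(1) vf \<sigma>, unfolded rl G.f(3)]
    show "Lambda_L X R R' (c, \<sigma>) \<in> globular X [] (hom X ?t (?r \<cdot> ?l))"
      "htransp ?t (?r \<cdot> ?l) (Lambda_L X R R' (c, \<sigma>)) = hact ?v (htransp G.f (c \<cdot> ?l) \<sigma>)"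
      using fr by (simp_all add: Lambda_L_def tight2_whisker_def l' R'(3))
  qed
  have fcl: "cospan G.f (c \<cdot> ?l)" if "G.left_mor c \<sigma>" for c \<sigma>
    using that G.f G.adj.l by (simp add: G.left_mor_def cospan_def)
  have "inj_on (Lambda_L X R R') (RAdj_L_hom X j R R')"
  proof (rule inj_onI)
    fix p q assume p: "p \<in> RAdj_L_hom X j R R'" and q: "q \<in> RAdj_L_hom X j R R'"
      and eq: "Lambda_L X R R' p = Lambda_L X R R' q"
    obtain c \<sigma> d \<rho> where pq: "p = (c, \<sigma>)" "q = (d, \<rho>)" by (cases p, cases q)
    note p' = p [unfolded pq mor] and q' = q [unfolded pq mor]
    have "hact ?v (htransp G.f (c \<cdot> ?l) \<sigma>) = hact ?v (htransp G.f (d \<cdot> ?l) \<rho>)"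
      using Lambda(2) [OF p [unfolded pq]] Lambda(2) [OF q [unfolded pq]] eq pq by simp
    with p' q' have *: "c = d \<and> htransp G.f (c \<cdot> ?l) \<sigma> = htransp G.f (d \<cdot> ?l) \<rho>"
      using G.left_mor_inj by blast
    then have "\<sigma> = \<rho>"
      using htransp_inj [OF fcl, of c _ \<sigma> "[]" \<rho> "[]"] p' q' by blast
    then show "p = q" using * pq by simp
  qed
  moreover have "Lambda_L X R R' ` RAdj_L_hom X j R R' = RMnd_hom X j T' (induced_monad X j R)"
  proof
    show "Lambda_L X R R' ` RAdj_L_hom X j R R' \<subseteq> RMnd_hom X j T' (induced_monad X j R)"
    proof (rule image_subsetI)
      fix p assume p: "p \<in> RAdj_L_hom X j R R'"
      obtain c \<sigma> where pq: "p = (c, \<sigma>)" by (cases p)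
      show "Lambda_L X R R' p \<in> RMnd_hom X j T' (induced_monad X j R)"
        unfolding mmor pq using Lambda [OF p [unfolded pq]] G.left_mor_monad_mor [OF conjunct2 [OF p [unfolded pq mor]]]
        by simp
    qed
    show "RMnd_hom X j T' (induced_monad X j R) \<subseteq> Lambda_L X R R' ` RAdj_L_hom X j R R'"
    proof
      fix \<tau> assume \<tau>: "\<tau> \<in> RMnd_hom X j T' (induced_monad X j R)"
      note \<tau>' = \<tau> [unfolded mmor]
      obtain c \<Sigma> where c: "G.left_mor c \<Sigma>" "hact ?v \<Sigma> = htransp ?t (?r \<cdot> ?l) \<tau>"
        using G.monad_mor_left_mor \<tau>' by blast
      have \<Sigma>: "\<Sigma> \<in> hom_cells G.f [] (c \<cdot> ?l)" using c(1) by (simp add: G.left_mor_def)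
      note h = htransp_hlift [OF fcl [OF c(1)] \<Sigma>]
      let ?\<sigma> = "hlift X G.f (c \<cdot> ?l) (tid X (tdom X G.f)) (tid X (tdom X (c \<cdot> ?l))) \<Sigma>"
      have p: "(c, ?\<sigma>) \<in> RAdj_L_hom X j R R'"
        unfolding mor using h c(1) by simp
      have "Lambda_L X R R' (c, ?\<sigma>) = \<tau>"
        using htransp_inj [OF ft Lambda(1) [OF p]] \<tau>' Lambda(2) [OF p] h(2) c(2) by metis
      then show "\<tau> \<in> Lambda_L X R R' ` RAdj_L_hom X j R R'" using p by (metis imageI)
    qed
  qed
  ultimately show "bij_betw (Lambda_L X R R') (RAdj_L_hom X j R R') (RMnd_hom X j T' (induced_monad X j R))"
    by (simp add: bij_betw_def)
  show "strict_left_morphism X R R' mor \<longleftrightarrow>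
      induced_monad X j R = T' \<and> Lambda_L X R R' mor = tight2_id X (rm_tight T')"
    if p: "mor \<in> RAdj_L_hom X j R R'"
  proof -
    obtain c \<sigma> where pq: "mor = (c, \<sigma>)" by (cases mor)
    note p' = p [unfolded pq mor] and La = Lambda [OF p [unfolded pq]]
    have lm: "G.left_mor c (htransp G.f (c \<cdot> ?l) \<sigma>)" using p' by blast
    note id_f = tight2_id_transp [OF G.f(1)] and id_t = tight2_id_transp [OF G.t(1)]
    have ff: "cospan G.f G.f" and tt: "cospan ?t ?t" using G.f G.t by (simp_all add: cospan_def)
    \<comment> \<open>Transposes decide equality only between 2-cells into the same hom loose-cell,
      so the equality of tight-cells must come before that of 2-cells. The comparison with the
      identity on \<open>?t\<close> below is conditional for the same reason.\<close>
    have "\<sigma> = tight2_id X G.f \<longleftrightarrow> htransp G.f (c \<cdot> ?l) \<sigma> = hone G.f" if "c \<cdot> ?l = G.f"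
      using htransp_eq_iff [OF ff _ id_f(1), of \<sigma> "[]"] p' id_f(2) that by simp
    then have "strict_left_morphism X R R' mor \<longleftrightarrow> c \<cdot> ?l = G.f \<and> htransp G.f (c \<cdot> ?l) \<sigma> = hone G.f"
      unfolding strict_left_morphism_def pq l' by auto
    also have "\<dots> \<longleftrightarrow> ?r \<cdot> ?l = ?t \<and> G.adj.D = ext_transp T' \<and> G.adj.N = unit_transp j T' \<and>
        hact ?v (htransp G.f (c \<cdot> ?l) \<sigma>) = hone ?t"
      by (rule G.left_mor_strict [OF lm])
    also have "\<dots> \<longleftrightarrow> induced_monad X j R = T' \<and> Lambda_L X R R' mor = tight2_id X ?t"
    proof -
      have "induced_monad X j R = T' \<longleftrightarrow> ?r \<cdot> ?l = ?t \<and> G.adj.D = ext_transp T' \<and> G.adj.N = unit_transp j T'"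
      proof
        assume eq: "induced_monad X j R = T'"
        show "?r \<cdot> ?l = ?t \<and> G.adj.D = ext_transp T' \<and> G.adj.N = unit_transp j T'"
          using ti i(2,3) unfolding eq by simp
      next
        assume "?r \<cdot> ?l = ?t \<and> G.adj.D = ext_transp T' \<and> G.adj.N = unit_transp j T'"
        then show "induced_monad X j R = T'"
          using monad_eqI [OF i(1) md] ti i(2,3) by simp
      qed
      moreover have "Lambda_L X R R' mor = tight2_id X ?t \<longleftrightarrow> hact ?v (htransp G.f (c \<cdot> ?l) \<sigma>) = hone ?t"
        if "?r \<cdot> ?l = ?t"
        using htransp_eq_iff [OF tt _ id_t(1), of "Lambda_L X R R' mor" "[]"] La id_t(2) that pq by simp
      ultimately show ?thesis by blast
    qed
    finally show ?thesis .
  qed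
qed

end

theorem theorem6p39:
  fixes X :: "('o, 't, 'l, 'c) vdc"
    and A E :: 'o and j :: 't
    and T' :: "('t, 'c) rel_monad" and u' :: "('t, 'c) rel_alg"
  assumes "virtual_equipment X"
    and "j \<in> thom X A E"
    and "relative_monad X j T'"
    and "algebra_object X j T' u'"
  shows "\<exists>R'. relative_adjunction X j R' \<and>
     ladj R' = free_tight X j T' u' \<and> radj R' = alg_tight u' \<and>
     adj_unit X j R' = rm_unit T' \<and>
     induced_monad X j R' = T' \<and>
     (\<forall>R. relative_adjunction X j R \<longrightarrow>
        relative_monad X j (induced_monad X j R) \<and>
        bij_betw (Lambda_L X R R') (RAdj_L_hom X j R R') (RMnd_hom X j T' (induced_monad X j R)) \<and>
        (\<forall>m \<in> RAdj_L_hom X j R R'.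
           strict_left_morphism X R R' m \<longleftrightarrow>
             induced_monad X j R = T' \<and> Lambda_L X R R' m = tight2_id X (rm_tight T')))"
proof -
  interpret virtual_equipment X by fact
  have j: "j \<in> Tight X" using assms(2) by (simp add: thom_iff)
  note a = assms(3) j assms(4)
  obtain R' :: "('t, 'c) rel_adj" where R': "relative_adjunction X j R'" "ladj R' = free_tight X j T' u'"
    "radj R' = alg_tight u'" "induced_monad X j R' = T'"
    "sharp_transp j R' =
      hom_algebra_object.S X j (rm_tight T') (ext_transp T') (unit_transp j T') (alg_tight u') (act_transp T' u')"
    by (rule free_adjunction [OF a])
  have "adj_unit X j R' = rm_unit (induced_monad X j R')" by (simp add: induced_monad_def)
  then have unit: "adj_unit X j R' = rm_unit T'" using R'(4) by simp
  note b = left_morphisms_bij [OF a R'(1,2,3,5)]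
  show ?thesis
    by (rule exI [of _ R']) (use R'(1-4) unit b induced_relative_monad [OF j] in blast)
qed

end
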